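(* Let $n\ge 1$, $0<\alpha<n$ and $1<p<q<\infty$ satisfy $\frac{\alpha}{n}+\frac1q=\frac1p$. Let $\mu,\lambda\in A_{p,q}$ be weights on $\mathbb{R}^n$ and let $\nu:=\mu\lambda^{-1}$. Then for every locally integrable function $b$ on $\mathbb{R}^n$, $$\left\|[b,I_\alpha]:L^p(\mu^p)\to L^q(\lambda^q)\right\|\simeq \|b\|_{BMO(\nu)}.$$ That is, there are constants $0<c\le C<\infty$, depending only on $n,\alpha,p,[\mu]_{A_{p,q}},[\lambda]_{A_{p,q}}$ (and not on $b$), such that $c\,\|b\|_{BMO(\nu)}\le \|[b,I_\alpha]:L^p(\mu^p)\to L^q(\lambda^q)\|\le C\,\|b\|_{BMO(\nu)}$. In particular, one side is finite if and only if the other is.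
   Context: A weight on $\mathbb{R}^n$ is a locally integrable, almost everywhere positive function $w$. For a cube $Q$ and a function $f$, write $\langle f\rangle_Q:=\frac{1}{|Q|}\int_Q f\,dx$ and $w(Q):=\int_Q w\,dx$. $L^p(w)$ denotes $L^p(\mathbb{R}^n, w\,dx)$; thus $L^p(\mu^p)$ has norm $(\int|f|^p\mu^p\,dx)^{1/p}$ and $L^q(\lambda^q)$ has norm $(\int|f|^q\lambda^q\,dx)^{1/q}$. $p'$ is the Hölder conjugate of $p$. A weight $w$ belongs to $A_{p,q}$ if $$[w]_{A_{p,q}}:=\sup_Q \langle w^q\rangle_Q\,\langle w^{-p'}\rangle_Q^{q/p'}<\infty,$$ the supremum being over all cubes $Q\subset\mathbb{R}^n$. The fractional integral operator (Riesz potential) is $I_\alpha f(x):=\int_{\mathbb{R}^n}\frac{f(y)}{|x-y|^{n-\alpha}}\,dy$. The commutator is $[b,I_\alpha]f:=b\,I_\alpha f-I_\alpha(bf)$. Its norm $\|[b,I_\alpha]:L^p(\mu^p)\to L^q(\lambda^q)\|\in[0,\infty]$ is the supremum of $\|[b,I_\alpha]f\|_{L^q(\lambda^q)}$ over all bounded compactly supported measurable $f$ (a dense subspace of $L^p(\mu^p)$) with $\|f\|_{L^p(\mu^p)}\le 1$. For a weight $w$ and locally integrable $b$, the weighted BMO norm is $$\|b\|_{BMO(w)}:=\sup_Q\frac{1}{w(Q)}\int_Q|b-\langle b\rangle_Q|\,dx\in[0,\infty],$$ the supremum being over all cubes $Q\subset\mathbb{R}^n$. *)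

theory Defs
  imports "HOL-Analysis.Analysis"
begin

definition ennpowr :: "ennreal \<Rightarrow> real \<Rightarrow> ennreal"  (* only used for exponents r > 0 *)
  where "ennpowr x r = (if x = top then top else ennreal (enn2real x powr r))"

definition hoelder_conj :: "real \<Rightarrow> real"
  where "hoelder_conj p = p / (p - 1)"

definition loc_integrable :: "('a::euclidean_space \<Rightarrow> 'b::{banach, second_countable_topology}) \<Rightarrow> bool"
  where "loc_integrable f \<longleftrightarrow> (\<forall>K. compact K \<longrightarrow> f absolutely_integrable_on K)"

definition weight :: "('a::euclidean_space \<Rightarrow> real) \<Rightarrow> bool"
  where "weight w \<longleftrightarrow> loc_integrable w \<and> (AE x in lebesgue. 0 < w x)"

text \<open>Cubes are axis-parallel, closed and nondegenerate.\<close>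

definition cubes :: "'a::euclidean_space set set"
  where "cubes = {cbox a (a + l *\<^sub>R One) | a l. 0 < l}"

definition avg :: "'a::euclidean_space set \<Rightarrow> ('a \<Rightarrow> 'b::{banach, second_countable_topology}) \<Rightarrow> 'b"
  where "avg Q f = (LINT x:Q|lebesgue. f x) /\<^sub>R measure lebesgue Q"

text \<open>The average of a nonnegative function that need not be integrable on \<open>Q\<close>.\<close>

definition nn_avg :: "'a::euclidean_space set \<Rightarrow> ('a \<Rightarrow> real) \<Rightarrow> ennreal"
  where "nn_avg Q g = (\<integral>\<^sup>+x\<in>Q. ennreal (g x) \<partial>lebesgue) / emeasure lebesgue Q"

definition Apq_const :: "real \<Rightarrow> real \<Rightarrow> ('a::euclidean_space \<Rightarrow> real) \<Rightarrow> ennreal"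
  where "Apq_const p q w =
    (SUP Q\<in>cubes. nn_avg Q (\<lambda>x. w x powr q) *
       ennpowr (nn_avg Q (\<lambda>x. w x powr (- hoelder_conj p))) (q / hoelder_conj p))"

definition Apq :: "real \<Rightarrow> real \<Rightarrow> ('a::euclidean_space \<Rightarrow> real) set"
  where "Apq p q = {w. weight w \<and> Apq_const p q w < top}"

definition Lp_norm :: "real \<Rightarrow> ('a::euclidean_space \<Rightarrow> real) \<Rightarrow> ('a \<Rightarrow> complex) \<Rightarrow> ennreal"
  where "Lp_norm p w f = ennpowr (\<integral>\<^sup>+x. ennreal (cmod (f x) powr p * w x) \<partial>lebesgue) (1 / p)"

text \<open>
  If \<open>f\<close> is integrable with compact support, the integral converges absolutely for almost every
  \<open>x\<close>; on the remaining null set the Bochner integral takes its default value 0.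
\<close>

definition riesz_potential :: "real \<Rightarrow> ('a::euclidean_space \<Rightarrow> complex) \<Rightarrow> 'a \<Rightarrow> complex"
  where "riesz_potential \<alpha> f x =
    (LINT y|lebesgue. f y /\<^sub>R norm (x - y) powr (real DIM('a) - \<alpha>))"

definition commutator ::
    "('a \<Rightarrow> complex) \<Rightarrow> (('a \<Rightarrow> complex) \<Rightarrow> 'a \<Rightarrow> complex) \<Rightarrow> ('a \<Rightarrow> complex) \<Rightarrow> 'a \<Rightarrow> complex"
  where "commutator b T f x = b x * T f x - T (\<lambda>y. b y * f y) x"

definition test_functions :: "('a::euclidean_space \<Rightarrow> complex) set"
  where "test_functions =
    {f \<in> borel_measurable lebesgue. bounded (range f) \<and> compact (closure {x. f x \<noteq> 0})}"

definition op_norm ::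
    "real \<Rightarrow> ('a::euclidean_space \<Rightarrow> real) \<Rightarrow> real \<Rightarrow> ('a \<Rightarrow> real) \<Rightarrow>
     (('a \<Rightarrow> complex) \<Rightarrow> 'a \<Rightarrow> complex) \<Rightarrow> ennreal"
  where "op_norm p v q w T = (SUP f\<in>{f \<in> test_functions. Lp_norm p v f \<le> 1}. Lp_norm q w (T f))"

definition bmo_norm :: "('a::euclidean_space \<Rightarrow> real) \<Rightarrow> ('a \<Rightarrow> complex) \<Rightarrow> ennreal"
  where "bmo_norm w b =
    (SUP Q\<in>cubes. (\<integral>\<^sup>+x\<in>Q. ennreal (cmod (b x - avg Q b)) \<partial>lebesgue) /
                   (\<integral>\<^sup>+x\<in>Q. ennreal (w x) \<partial>lebesgue))"

end

theory Submission
  imports Defs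
begin

text \<open>
  Upper bound. Pointwise, \<open>[b, I\<^sub>\<alpha>] f\<close> is at most the integral of
  \<open>\<bar>b x - b y\<bar> \<bar>f y\<bar> \<bar>x - y\<bar> powr (\<alpha> - n)\<close> in \<open>y\<close>. Two distinct points always share a cell
  of comparable size in one of \<open>2^n\<close> shifted dyadic grids (\<open>shifted_cell_contains_pair\<close>), so this
  positive operator is dominated by finitely many sums over dyadic cells \<open>Q\<close>. Writing
  \<open>\<bar>b x - b y\<bar> \<le> \<bar>b x - b\<^sub>Q\<bar> + \<bar>b y - b\<^sub>Q\<bar>\<close> with \<open>b\<^sub>Q\<close> the average of \<open>b\<close> on \<open>Q\<close>, and pairing with a
  function \<open>g\<close>, leaves the sums of \<open>\<bar>Q\<bar> powr (\<alpha>/n - 1)\<close> times the product of \<open>\<integral>\<^sub>Q \<bar>b - b\<^sub>Q\<bar> g\<close> and \<open>\<integral>\<^sub>Q f\<close>,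
  and of the same product with \<open>f\<close> and \<open>g\<close> exchanged.

  Three facts finish the estimate.
   \<^item> \<open>bmo_maximal_domination\<close>: \<open>\<integral>\<^sub>Q \<bar>b - b\<^sub>Q\<bar> g \<le> C \<parallel>b\<parallel> \<integral>\<^sub>Q (M g) \<nu>\<close>, where \<open>M\<close> is the dyadic maximal
     function. This is a Calderon-Zygmund stopping argument: the part of \<open>Q\<close> outside the stopping cells
     carries a fixed share of \<open>\<nu>(Q)\<close> and pays for \<open>Q\<close>, and the stopping cells pay for themselves.
   \<^item> \<open>dyadic_max_weighted\<close>: \<open>M\<close> is bounded on the weighted \<open>L^p\<close> spaces of Muckenhoupt weights.
     Both \<open>\<mu>^p\<close> and \<open>\<lambda> powr (- q')\<close> are such weights (\<open>\<lambda>\<close> is the weight \<open>lam\<close> of the theorem).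
   \<^item> \<open>frac_form_bound\<close>: the bilinear form with terms \<open>\<bar>Q\<bar> powr (\<alpha>/n - 1) \<integral>\<^sub>Q f \<integral>\<^sub>Q g\<close> is bounded on
     \<open>L^p(w^p) \<times> L^{q'}(w powr (- q'))\<close> for every \<open>w\<close> in \<open>A\<^sub>p\<^sub>q\<close>. With \<open>\<sigma> = w powr (- p')\<close> and
     \<open>u = w^q\<close> the \<open>A\<^sub>p\<^sub>q\<close> condition turns each term into
     \<open>(\<sigma>(Q)^{1/p} \<langle>F\<rangle>\<^sub>Q) (u(Q)^{1/q'} \<langle>G\<rangle>\<^sub>Q)\<close>, with averages taken against \<open>\<sigma>\<close> and \<open>u\<close>. Because
     \<open>p < q\<close> there is an exponent \<open>r\<close> strictly between them, and Hoelder's inequality with \<open>r\<close> and \<open>r'\<close> puts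
     both factors into sequence spaces in which they are summable over \<^emph>\<open>all\<close> cells
     (\<open>off_diagonal_embedding\<close>).

  One of the two sums is then controlled with \<open>w = \<lambda>\<close> applied to \<open>(M f) \<nu>\<close>, since
  \<open>\<nu> \<lambda> = \<mu>\<close>, and the other one with \<open>w = \<mu>\<close> applied to \<open>(M g) \<nu>\<close>. Duality gives the norm bound.

  Lower bound. The kernel is positive, so on a cube \<open>Q\<close> with a median \<open>m\<close> of (the real part of) \<open>b\<close> the
  commutator applied to the indicator of \<open>F = {y \<in> Q. b y \<le> m}\<close> has no cancellation at the points with
  \<open>b x \<ge> m\<close>: there it is at least a multiple of \<open>l^\<alpha> (b x - m)\<close>, \<open>l\<close> being the side of \<open>Q\<close>
  (\<open>commutator_indicator_lower_AE\<close>). Hoelder's inequality and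
  \<open>\<langle>\<mu>^p\<rangle>\<^sub>Q^{1/p} \<langle>\<lambda> powr (- q')\<rangle>\<^sub>Q^{1/q'} \<le> C \<langle>\<nu>\<rangle>\<^sub>Q\<close> (\<open>product_average_le_\<nu>\<close>) then bound the oscillation of \<open>b\<close> by
  the norm of the commutator times \<open>\<nu>(Q)\<close>.
\<close>

section \<open>Powers of extended nonnegative reals and Hoelder's inequality\<close>

lemma ennpowr_top [simp]: "ennpowr top r = top"
  by (simp add: ennpowr_def)

lemma ennpowr_0 [simp]: "ennpowr 0 r = 0"
  by (simp add: ennpowr_def)

lemma ennpowr_ennreal: "0 \<le> c \<Longrightarrow> ennpowr (ennreal c) r = ennreal (c powr r)"
  by (simp add: ennpowr_def)

lemma ennpowr_1 [simp]: "ennpowr 1 r = 1"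
  using ennpowr_ennreal[of 1 r] by simp

lemma ennpowr_one [simp]: "ennpowr x 1 = x"
  by (cases x) (auto simp: ennpowr_ennreal)

lemma ennpowr_mono: "x \<le> y \<Longrightarrow> 0 \<le> r \<Longrightarrow> ennpowr x r \<le> ennpowr y r"
  by (cases x; cases y) (auto simp: ennpowr_ennreal powr_mono2 top_unique)

lemma ennpowr_mult: "0 < r \<Longrightarrow> ennpowr (x * y) r = ennpowr x r * ennpowr y r"
  by (cases x; cases y)
     (auto simp: ennpowr_ennreal powr_mult ennreal_mult_top ennreal_top_mult simp flip: ennreal_mult')

lemma ennpowr_ennpowr: "0 < a \<Longrightarrow> 0 < c \<Longrightarrow> ennpowr (ennpowr x a) c = ennpowr x (a * c)"
  by (cases x) (auto simp: ennpowr_ennreal powr_powr)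

lemma ennpowr_add: "0 < a \<Longrightarrow> 0 < c \<Longrightarrow> ennpowr x (a + c) = ennpowr x a * ennpowr x c"
  by (cases x) (auto simp: ennpowr_ennreal powr_add ennreal_mult' ennreal_top_mult)

lemma ennpowr_eq_0_iff [simp]: "ennpowr x r = 0 \<longleftrightarrow> x = 0"
  by (cases x) (auto simp: ennpowr_ennreal)

lemma ennpowr_eq_top_iff [simp]: "ennpowr x r = top \<longleftrightarrow> x = top"
  by (cases x) (auto simp: ennpowr_ennreal)

text \<open>
  For \<open>r > 0\<close> the power map is an order isomorphism with inverse \<open>\<lambda>y. ennpowr y (1 / r)\<close>, so it
  commutes with suprema.
\<close>

lemma ennpowr_le_iff:
  assumes "0 < r"
  shows "ennpowr x r \<le> y \<longleftrightarrow> x \<le> ennpowr y (1 / r)"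
proof
  assume "ennpowr x r \<le> y"
  from ennpowr_mono[OF this, of "1 / r"] assms show "x \<le> ennpowr y (1 / r)"
    by (simp add: ennpowr_ennpowr)
next
  assume "x \<le> ennpowr y (1 / r)"
  from ennpowr_mono[OF this, of r] assms show "ennpowr x r \<le> y"
    by (simp add: ennpowr_ennpowr)
qed

lemma ennpowr_SUP:
  assumes "0 < r"
  shows "ennpowr (SUP i\<in>I. f i) r = (SUP i\<in>I. ennpowr (f i) r)"
proof (rule antisym)
  show "ennpowr (SUP i\<in>I. f i) r \<le> (SUP i\<in>I. ennpowr (f i) r)"
    unfolding ennpowr_le_iff[OF assms]
    by (rule SUP_least) (auto simp flip: ennpowr_le_iff[OF assms] intro: SUP_upper)
  show "(SUP i\<in>I. ennpowr (f i) r) \<le> ennpowr (SUP i\<in>I. f i) r"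
    using assms by (intro SUP_least ennpowr_mono SUP_upper) auto
qed

lemma borel_measurable_ennpowr [measurable]:
  assumes [measurable]: "f \<in> borel_measurable M"
  shows "(\<lambda>x. ennpowr (f x) r) \<in> borel_measurable M"
  unfolding ennpowr_def by measurable

lemma indicator_ennpowr: "ennpowr (f * indicator A x) r = ennpowr f r * indicator A x"
  by (auto simp: indicator_def)

lemma conjugate_exponent_gt_1:
  assumes "1 < p" "1 / p + 1 / p' = 1"
  shows "1 < (p' :: real)"
proof -
  have "1/p' = 1 - 1/p" using assms by simp
  moreover have "0 < 1 - 1/p" "1 - 1/p < 1" using assms(1) by auto
  ultimately have "0 < 1/p'" "1/p' < 1" by auto
  then show ?thesis by (simp add: divide_less_eq_1 split: if_splits)
qed

lemma ennreal_Young: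
  assumes "1 < p" "1 / p + 1 / p' = 1"
  shows "x * y \<le> ennreal (1 / p) * ennpowr x p + ennreal (1 / p') * ennpowr y p'"
proof -
  have p': "1 < p'" by (rule conjugate_exponent_gt_1) (use assms in auto)
  consider "x = top" | "y = top" | a c where "x = ennreal a" "y = ennreal c" "0 \<le> a" "0 \<le> c"
    by (cases x; cases y) auto
  then show ?thesis
  proof cases
    case 3
    have "a * c \<le> a powr p / p + c powr p' / p'"
      using Youngs_inequality[of p p' a c] assms p' 3 by simp
    then show ?thesis using 3 assms p'
      by (simp add: ennpowr_ennreal flip: ennreal_mult' ennreal_plus)
  qed (use assms p' in \<open>auto simp: ennreal_mult_top\<close>)
qed

theorem nn_integral_Hoelder:
  assumes p: "1 < p" and pp: "1 / p + 1 / p' = 1"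
    and [measurable]: "f \<in> borel_measurable M" "g \<in> borel_measurable M"
  shows "(\<integral>\<^sup>+x. f x * g x \<partial>M) \<le>
    ennpowr (\<integral>\<^sup>+x. ennpowr (f x) p \<partial>M) (1 / p) * ennpowr (\<integral>\<^sup>+x. ennpowr (g x) p' \<partial>M) (1 / p')"
    (is "_ \<le> ?A * ?B")
proof -
  have p': "1 < p'" by (rule conjugate_exponent_gt_1) (use assms in auto)
  consider "?A = 0" | "?B = 0" | "?A \<noteq> 0" "?B = top" | "?B \<noteq> 0" "?A = top"
    | a c where "?A = ennreal a" "?B = ennreal c" "0 < a" "0 < c"
  proof -
    obtain x y where xy: "x = ?A" "y = ?B" by blast
    have "x = 0 \<or> y = 0 \<or> (x \<noteq> 0 \<and> y = top) \<or> (y \<noteq> 0 \<and> x = top) \<or>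
       (\<exists>a c. x = ennreal a \<and> y = ennreal c \<and> 0 < a \<and> 0 < c)"
      by (cases x; cases y) (auto simp: less_le)
    then show thesis using that unfolding xy by blast
  qed
  then show ?thesis
  proof cases
    case 1
    then have "AE x in M. f x = 0" by (simp add: nn_integral_0_iff_AE)
    then have "(\<integral>\<^sup>+x. f x * g x \<partial>M) = (\<integral>\<^sup>+x. 0 \<partial>M)" by (intro nn_integral_cong_AE) auto
    then show ?thesis by simp
  next
    case 2
    then have "AE x in M. g x = 0" by (simp add: nn_integral_0_iff_AE)
    then have "(\<integral>\<^sup>+x. f x * g x \<partial>M) = (\<integral>\<^sup>+x. 0 \<partial>M)" by (intro nn_integral_cong_AE) auto
    then show ?thesis by simp
  next
    case 3
    then have "?A * ?B = top" by (metis ennreal_mult_top)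
    then show ?thesis by (metis top_greatest)
  next
    case 4
    then have "?A * ?B = top" by (metis ennreal_top_mult)
    then show ?thesis by (metis top_greatest)
  next
    case 5
    have If: "(\<integral>\<^sup>+x. ennpowr (f x) p \<partial>M) = ennreal (a powr p)"
    proof -
      have "ennpowr ?A p = ennreal (a powr p)" using 5 by (simp add: ennpowr_ennreal)
      then show ?thesis using p by (simp add: ennpowr_ennpowr)
    qed
    have Ig: "(\<integral>\<^sup>+x. ennpowr (g x) p' \<partial>M) = ennreal (c powr p')"
    proof -
      have "ennpowr ?B p' = ennreal (c powr p')" using 5 by (simp add: ennpowr_ennreal)
      then show ?thesis using p' by (simp add: ennpowr_ennpowr)
    qed
    have eq: "f x * g x = ennreal (a * c) * ((ennreal (1 / a) * f x) * (ennreal (1 / c) * g x))" for x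
    proof -
      have "ennreal (a * c) * (ennreal (1 / a) * ennreal (1 / c)) = 1"
        using 5 by (simp flip: ennreal_mult')
      then show ?thesis by (metis (no_types, lifting) mult.assoc mult.commute mult.right_neutral)
    qed
    have "(\<integral>\<^sup>+x. f x * g x \<partial>M) = ennreal (a * c) * (\<integral>\<^sup>+x. (ennreal (1 / a) * f x) * (ennreal (1 / c) * g x) \<partial>M)"
      by (subst eq, rule nn_integral_cmult) measurable
    also have "\<dots> \<le> ennreal (a * c) * (\<integral>\<^sup>+x. ennreal (1 / p) * (ennreal ((1 / a) powr p) * ennpowr (f x) p)
                 + ennreal (1 / p') * (ennreal ((1 / c) powr p') * ennpowr (g x) p') \<partial>M)"
    proof (intro mult_left_mono nn_integral_mono)
      fix x
      show "(ennreal (1 / a) * f x) * (ennreal (1 / c) * g x) \<le> ennreal (1 / p) * (ennreal ((1 / a) powr p) * ennpowr (f x) p)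
                 + ennreal (1 / p') * (ennreal ((1 / c) powr p') * ennpowr (g x) p')"
        using ennreal_Young[OF p pp, of "ennreal (1 / a) * f x" "ennreal (1 / c) * g x"] p p' 5
        by (simp add: ennpowr_mult ennpowr_ennreal)
    qed simp
    also have "\<dots> = ennreal (a * c) * (ennreal (1 / p) * (ennreal ((1 / a) powr p) * ennreal (a powr p))
                 + ennreal (1 / p') * (ennreal ((1 / c) powr p') * ennreal (c powr p')))"
      by (simp add: nn_integral_add nn_integral_cmult If Ig)
    also have "\<dots> = ennreal (a * c) * ennreal (1 / p + 1 / p')"
      using 5 p p' by (simp add: powr_divide flip: ennreal_mult' ennreal_plus)
    finally show ?thesis using 5 pp by (simp add: ennreal_mult)
  qed
qed

corollary nn_set_integral_Hoelder:
  assumes p: "1 < p" and pp: "1 / p + 1 / p' = 1"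
    and [measurable]: "f \<in> borel_measurable M" "g \<in> borel_measurable M" "A \<in> sets M"
  shows "(\<integral>\<^sup>+x\<in>A. f x * g x \<partial>M) \<le>
    ennpowr (\<integral>\<^sup>+x\<in>A. ennpowr (f x) p \<partial>M) (1 / p) * ennpowr (\<integral>\<^sup>+x\<in>A. ennpowr (g x) p' \<partial>M) (1 / p')"
proof -
  have "(\<integral>\<^sup>+x\<in>A. f x * g x \<partial>M) = (\<integral>\<^sup>+x. (f x * indicator A x) * (g x * indicator A x) \<partial>M)"
    by (intro nn_integral_cong) (auto simp: indicator_def)
  then show ?thesis
    using nn_integral_Hoelder[OF p pp, of "\<lambda>x. f x * indicator A x" M "\<lambda>x. g x * indicator A x"]
    by (simp add: indicator_ennpowr)
qed

text \<open>
  Hoelder's inequality against the constant 1: the means of order \<open>r\<close> increase with \<open>r\<close>.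
\<close>

corollary nn_set_integral_power_mean:
  assumes "0 < r" "r < s" and [measurable]: "f \<in> borel_measurable M" "A \<in> sets M"
  shows "ennpowr (\<integral>\<^sup>+x\<in>A. ennpowr (f x) r \<partial>M) (1 / r) \<le>
    ennpowr (\<integral>\<^sup>+x\<in>A. ennpowr (f x) s \<partial>M) (1 / s) * ennpowr (emeasure M A) (1 / r - 1 / s)"
proof -
  define p where "p = s / r"
  define p' where "p' = s / (s - r)"
  have p: "1 < p" "1 / p + 1 / p' = 1" "0 < p'" using assms by (auto simp: p_def p'_def field_simps)
  have "(\<integral>\<^sup>+x\<in>A. ennpowr (f x) r * 1 \<partial>M) \<le> ennpowr (\<integral>\<^sup>+x\<in>A. ennpowr (ennpowr (f x) r) p \<partial>M) (1 / p) *
      ennpowr (\<integral>\<^sup>+x\<in>A. ennpowr 1 p' \<partial>M) (1 / p')"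
    by (rule nn_set_integral_Hoelder[OF p(1,2)]) measurable
  also have "\<dots> = ennpowr (\<integral>\<^sup>+x\<in>A. ennpowr (f x) s \<partial>M) (r / s) * ennpowr (emeasure M A) (1 - r / s)"
  proof -
    have "1 / p = r / s" "1 / p' = 1 - r / s" "r * p = s" using assms by (auto simp: p_def p'_def field_simps)
    then show ?thesis using assms p by (simp add: ennpowr_ennpowr)
  qed
  finally have *: "(\<integral>\<^sup>+x\<in>A. ennpowr (f x) r \<partial>M) \<le>
     ennpowr (\<integral>\<^sup>+x\<in>A. ennpowr (f x) s \<partial>M) (r / s) * ennpowr (emeasure M A) (1 - r / s)" by simp
  have rs: "(1 - r / s) * (1/r) = 1/r - 1/s" "0 < r/s" "0 < 1 - r/s" using assms by (auto simp: field_simps)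
  have "ennpowr (\<integral>\<^sup>+x\<in>A. ennpowr (f x) r \<partial>M) (1 / r) \<le>
     ennpowr (ennpowr (\<integral>\<^sup>+x\<in>A. ennpowr (f x) s \<partial>M) (r / s) * ennpowr (emeasure M A) (1 - r / s)) (1 / r)"
    using assms by (intro ennpowr_mono *) auto
  also have "\<dots> = ennpowr (\<integral>\<^sup>+x\<in>A. ennpowr (f x) s \<partial>M) (1 / s) * ennpowr (emeasure M A) (1/r - 1/s)"
    using assms rs by (simp add: ennpowr_mult ennpowr_ennpowr)
  finally show ?thesis .
qed

lemma powr_base_less_one: "0 \<le> \<theta> \<Longrightarrow> \<theta> < 1 \<Longrightarrow> 0 < \<gamma> \<Longrightarrow> \<theta> powr \<gamma> < (1::real)"
  using powr_less_mono2[of \<gamma> \<theta> 1] by simp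

text \<open>
  The terms below the threshold \<open>T\<close> form a geometric series whose first term is at most \<open>T powr \<gamma>\<close>:
  decay forces \<open>s k\<close> above \<open>T\<close> for very negative \<open>k\<close>, so there is a first index with \<open>s k \<le> T\<close>. Every
  infinite sum over dyadic levels below is reduced to this one.
\<close>

lemma geometric_level_sum:
  fixes s :: "int \<Rightarrow> real"
  assumes pos: "\<And>k. 0 < s k" and dec: "\<And>k. s (k + 1) \<le> \<theta> * s k"
    and \<theta>: "0 < \<theta>" "\<theta> < 1" and \<gamma>: "0 < \<gamma>"
  shows "(\<integral>\<^sup>+k. (if s k \<le> T then ennreal (s k powr \<gamma>) else 0) \<partial>count_space UNIV)
    \<le> ennreal (T powr \<gamma> / (1 - \<theta> powr \<gamma>))"
proof (cases "\<exists>k. s k \<le> T")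
  case False
  then have "(\<integral>\<^sup>+k. (if s k \<le> T then ennreal (s k powr \<gamma>) else 0) \<partial>count_space UNIV) =
     (\<integral>\<^sup>+k. 0 \<partial>count_space (UNIV::int set))"
    by (intro nn_integral_cong) auto
  then show ?thesis by simp
next
  case True
  then obtain k1 where k1: "s k1 \<le> T" by auto
  then have T: "0 < T" using pos[of k1] by linarith
  have iter: "s (k + int i) \<le> \<theta> ^ i * s k" for k i
  proof (induction i)
    case (Suc i)
    have "s (k + int (Suc i)) \<le> \<theta> * s (k + int i)" using dec[of "k + int i"] by (simp add: add_ac)
    also have "\<dots> \<le> \<theta> * (\<theta> ^ i * s k)" using Suc \<theta> by (intro mult_left_mono) auto
    finally show ?case by simp
  qed simp
  \<comment> \<open>Going \<open>m\<close> levels back from \<open>k1\<close> multiplies \<open>s\<close> by more than \<open>T / s k1\<close>.\<close>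
  obtain m where m: "\<theta> ^ m < s k1 / T"
    using real_arch_pow_inv[of "s k1 / T" \<theta>] T pos \<theta> by auto
  have above: "k1 - int m < k" if "s k \<le> T" for k
  proof (rule ccontr)
    assume "\<not> ?thesis"
    then have i: "k1 = k + int i" "m \<le> i" if "i = nat (k1 - k)" for i
      using that by auto
    define i where "i = nat (k1 - k)"
    note i = i[OF i_def]
    have "s k1 \<le> \<theta> ^ i * s k" using iter[of k i] i by simp
    also have "\<dots> \<le> \<theta> ^ m * T"
      using i that pos[of k] \<theta> by (intro mult_mono power_decreasing) (auto intro: less_imp_le)
    also have "\<dots> < s k1" using m T by (simp add: field_simps)
    finally show False by simp
  qed
  define n0 where "n0 = (LEAST n. s (k1 - int m + int n) \<le> T)"
  have ex: "s (k1 - int m + int m) \<le> T" using k1 by simp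
  have n0: "s (k1 - int m + int n0) \<le> T" unfolding n0_def by (rule LeastI[of _ m]) (rule ex)
  define k2 where "k2 = k1 - int m + int n0"
  have ge: "k2 \<le> k" if "s k \<le> T" for k
  proof -
    have "k = k1 - int m + int (nat (k - (k1 - int m)))" using above[OF that] by simp
    then obtain n where n: "k = k1 - int m + int n" by blast
    then have "n0 \<le> n" unfolding n0_def using that by (intro Least_le) auto
    then show ?thesis by (simp add: n k2_def)
  qed
  have "(\<integral>\<^sup>+k. (if s k \<le> T then ennreal (s k powr \<gamma>) else 0) \<partial>count_space UNIV)
     \<le> (\<integral>\<^sup>+k. ennreal (s k powr \<gamma>) \<partial>count_space {k2..})"
    using ge by (subst (2) nn_integral_count_space_indicator) (auto intro!: nn_integral_mono simp: indicator_def)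
  also have "\<dots> = (\<integral>\<^sup>+i. ennreal (s (k2 + int i) powr \<gamma>) \<partial>count_space (UNIV :: nat set))"
    by (rule nn_integral_bij_count_space[symmetric, of "\<lambda>i. k2 + int i" UNIV "{k2..}" "\<lambda>k. ennreal (s k powr \<gamma>)"])
       (auto simp: bij_betw_def inj_on_def image_def zle_iff_zadd)
  also have "\<dots> = (\<Sum>i. ennreal (s (k2 + int i) powr \<gamma>))"
    by (rule nn_integral_count_space_nat)
  also have "\<dots> \<le> (\<Sum>i. ennreal (T powr \<gamma> * (\<theta> powr \<gamma>) ^ i))"
  proof (intro suminf_le ennreal_leI)
    fix i
    have "s (k2 + int i) \<le> \<theta> ^ i * T"
      using iter[of k2 i] n0 \<theta> by (auto simp: k2_def intro: order_trans mult_left_mono)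
    then have "s (k2 + int i) powr \<gamma> \<le> (\<theta> ^ i * T) powr \<gamma>"
      using pos[of "k2 + int i"] \<gamma> by (intro powr_mono2) auto
    then show "s (k2 + int i) powr \<gamma> \<le> T powr \<gamma> * (\<theta> powr \<gamma>) ^ i"
      using \<theta> T by (simp add: powr_mult powr_powr mult_ac flip: powr_realpow)
  qed auto
  also have "\<dots> = ennreal (T powr \<gamma> / (1 - \<theta> powr \<gamma>))"
  proof -
    have "\<theta> powr \<gamma> < 1" using \<theta> \<gamma> by (simp add: powr_base_less_one)
    then have "(\<lambda>i. T powr \<gamma> * (\<theta> powr \<gamma>) ^ i) sums (T powr \<gamma> * (1 / (1 - \<theta> powr \<gamma>)))"
      by (intro sums_mult geometric_sums) auto
    then show ?thesis
      by (intro suminf_ennreal_eq) auto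
  qed
  finally show ?thesis .
qed

section \<open>Dyadic grids\<close>

lemma ennreal_divide_mult_cancel: "0 < m \<Longrightarrow> m < top \<Longrightarrow> I / m * m = (I::ennreal)"
  by (simp add: ennreal_divide_times ennreal_mult_divide_eq less_top)

lemma nn_integral_disjoint_Union:
  assumes "countable \<F>" "disjoint \<F>" "\<F> \<subseteq> sets M" "f \<in> borel_measurable M"
  shows "(\<integral>\<^sup>+x\<in>\<Union>\<F>. f x \<partial>M) = (\<integral>\<^sup>+Q. (\<integral>\<^sup>+x\<in>Q. f x \<partial>M) \<partial>count_space \<F>)"
proof -
  have U: "\<Union>\<F> \<in> sets M" using assms by (auto intro: sets.countable_Union)
  have "emeasure (density M f) (\<Union>((\<lambda>Q. Q) ` \<F>)) = (\<integral>\<^sup>+Q. emeasure (density M f) Q \<partial>count_space \<F>)"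
    using assms by (intro emeasure_UN_countable) (auto simp: disjoint_family_on_def disjoint_def)
  moreover have "(\<integral>\<^sup>+Q. emeasure (density M f) Q \<partial>count_space \<F>) = (\<integral>\<^sup>+Q. (\<integral>\<^sup>+x\<in>Q. f x \<partial>M) \<partial>count_space \<F>)"
    using assms by (intro nn_integral_cong) (auto simp: emeasure_density)
  ultimately show ?thesis using assms U by (simp add: emeasure_density)
qed

text \<open>
  Generation \<open>k\<close> consists of cells of side \<open>2 powr (- k)\<close>; the generations range over all integers, so
  cells become arbitrarily large as \<open>k\<close> decreases.
\<close>

definition side :: "int \<Rightarrow> real"
  where "side k = 2 powr (- real_of_int k)"

lemma side_pos [simp]: "0 < side k"
  by (simp add: side_def)

lemma side_Suc: "side (k + 1) = side k / 2"
  by (simp add: side_def powr_diff)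

lemma side_strict_antimono: "j < k \<Longrightarrow> side k < side j"
  by (simp add: side_def)

lemma side_bracket:
  assumes "0 < y"
  shows "\<exists>k. side k < y \<and> y \<le> 2 * side k"
proof -
  define m where "m = \<lceil>log 2 y\<rceil> - 1"
  have m: "real_of_int m < log 2 y" "log 2 y \<le> real_of_int m + 1"
    unfolding m_def by linarith+
  have "2 powr real_of_int m < y" using m(1) assms by (simp add: less_log_iff)
  moreover have "y \<le> 2 powr (real_of_int m + 1)" using m(2) assms by (simp add: log_le_iff)
  ultimately have "side (- m) < y \<and> y \<le> 2 * side (- m)" by (simp add: side_def powr_add)
  then show ?thesis by blast
qed

text \<open>
  The cells of one generation partition the space. Up to a null set each is a closed cube, which is how
  hypotheses on cubes are transferred to cells.
\<close>

locale dyadic_grid =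
  fixes cell :: "int \<Rightarrow> 'a::euclidean_space \<Rightarrow> 'a set"
  assumes cell_self [simp]: "x \<in> cell k x"
    and cell_eq: "y \<in> cell k x \<Longrightarrow> cell k y = cell k x"
    and cell_Suc: "cell (k + 1) x \<subseteq> cell k x"
    and countable_cells: "countable (range (cell k))"
    and cell_cube: "\<exists>a. box a (a + side k *\<^sub>R One) \<subseteq> cell k x \<and> cell k x \<subseteq> cbox a (a + side k *\<^sub>R One)"
begin

lemma cell_mono: "j \<le> k \<Longrightarrow> cell k x \<subseteq> cell j x"
proof (induction k rule: int_ge_induct)
  case (step i)
  then show ?case using cell_Suc[of i x] by blast
qed simp

lemma cell_eq_iff: "y \<in> cell k x \<longleftrightarrow> cell k y = cell k x"
  using cell_eq cell_self by metis

lemma cell_eq_mono: "j \<le> k \<Longrightarrow> y \<in> cell k x \<Longrightarrow> cell j y = cell j x"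
  using cell_mono cell_eq by blast

lemma cell_closed_cube: "\<exists>Q\<in>cubes. cell k x \<subseteq> Q \<and> Q - cell k x \<in> null_sets lebesgue"
proof -
  obtain a where a: "box a (a + side k *\<^sub>R One) \<subseteq> cell k x" "cell k x \<subseteq> cbox a (a + side k *\<^sub>R One)"
    using cell_cube by blast
  have "cbox a (a + side k *\<^sub>R One) - cell k x \<subseteq> cbox a (a + side k *\<^sub>R One) - box a (a + side k *\<^sub>R One)"
    using a by blast
  moreover have "negligible (cbox a (a + side k *\<^sub>R One) - box a (a + side k *\<^sub>R One))"
    by (rule negligible_frontier_interval)
  ultimately have "negligible (cbox a (a + side k *\<^sub>R One) - cell k x)"
    using negligible_subset by blast
  moreover have "cbox a (a + side k *\<^sub>R One) \<in> cubes"
    unfolding cubes_def using side_pos by blast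
  ultimately show ?thesis using a(2) by (auto simp: negligible_iff_null_sets)
qed

lemma cell_lebesgue [measurable, simp]: "cell k x \<in> sets lebesgue"
proof -
  obtain Q where Q: "Q \<in> cubes" "cell k x \<subseteq> Q" "Q - cell k x \<in> null_sets lebesgue"
    using cell_closed_cube by blast
  have "Q \<in> sets lebesgue" using Q(1) by (auto simp: cubes_def)
  then have "Q - (Q - cell k x) \<in> sets lebesgue" using Q(3) by (rule sets.Diff[OF _ null_setsD2])
  moreover have "Q - (Q - cell k x) = cell k x" using Q(2) by blast
  ultimately show ?thesis by metis
qed

lemma emeasure_cell: "emeasure lebesgue (cell k x) = ennreal (side k ^ DIM('a))"
proof -
  obtain a where a: "box a (a + side k *\<^sub>R One) \<subseteq> cell k x" "cell k x \<subseteq> cbox a (a + side k *\<^sub>R One)"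
    using cell_cube by blast
  have "emeasure lebesgue (cbox a (a + side k *\<^sub>R One)) = ennreal (side k ^ DIM('a))"
    by (simp add: emeasure_lborel_cbox_eq inner_simps less_imp_le)
  moreover have "emeasure lebesgue (box a (a + side k *\<^sub>R One)) = ennreal (side k ^ DIM('a))"
    by (simp add: emeasure_lborel_box_eq inner_simps less_imp_le)
  ultimately show ?thesis
    using emeasure_mono[OF a(1), of lebesgue] emeasure_mono[OF a(2), of lebesgue] by auto
qed

lemma cell_inj: "cell j x = cell k y \<Longrightarrow> j = k"
proof (rule ccontr)
  assume *: "cell j x = cell k y" "j \<noteq> k"
  have "side j \<noteq> side k" using side_strict_antimono[of j k] side_strict_antimono[of k j] *(2) by force
  then have "side j ^ DIM('a) \<noteq> side k ^ DIM('a)"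
    using power_eq_iff_eq_base[of "DIM('a)" "side j" "side k"] by (simp add: less_imp_le)
  moreover have "ennreal (side j ^ DIM('a)) = ennreal (side k ^ DIM('a))"
    using *(1) emeasure_cell by metis
  ultimately show False by (simp add: less_imp_le)
qed

definition cells :: "'a set set"
  where "cells = (\<Union>k. range (cell k))"

lemma cell_in_cells [simp]: "cell k x \<in> cells"
  by (auto simp: cells_def)

lemma countable_all_cells [simp]: "countable cells"
  unfolding cells_def using countable_cells by (intro countable_UN) auto

lemma cells_lebesgue: "Q \<in> cells \<Longrightarrow> Q \<in> sets lebesgue"
  by (auto simp: cells_def)

text \<open>
  The cells containing \<open>x\<close> form one chain, with exactly one cell in every generation. Together with
  \<open>sum_over_cells\<close> this turns sums over the whole grid into integrals of sums along a chain.
\<close>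

lemma sum_over_cells_at:
  "(\<integral>\<^sup>+Q. \<Psi> Q * indicator Q x \<partial>count_space cells) = (\<integral>\<^sup>+k. \<Psi> (cell k x) \<partial>count_space UNIV)"
proof -
  have "(\<integral>\<^sup>+Q. \<Psi> Q * indicator Q x \<partial>count_space cells) =
      (\<integral>\<^sup>+Q. \<Psi> Q * indicator Q x \<partial>count_space (range (\<lambda>k. cell k x)))"
    by (rule nn_integral_count_space_eq) (auto simp: cells_def indicator_def cell_eq_iff, metis rangeI)
  also have "\<dots> = (\<integral>\<^sup>+k. \<Psi> (cell k x) * indicator (cell k x) x \<partial>count_space UNIV)"
    by (rule nn_integral_bij_count_space[symmetric]) (auto simp: bij_betw_def inj_on_def dest: cell_inj)
  finally show ?thesis by simp
qed

lemma sum_over_cells: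
  assumes "sets \<rho> = sets lebesgue" and h: "h \<in> borel_measurable lebesgue"
  shows "(\<integral>\<^sup>+Q. \<Psi> Q * (\<integral>\<^sup>+x\<in>Q. h x \<partial>\<rho>) \<partial>count_space cells) =
    (\<integral>\<^sup>+x. h x * (\<integral>\<^sup>+k. \<Psi> (cell k x) \<partial>count_space UNIV) \<partial>\<rho>)"
proof -
  note assms(1)[measurable_cong]
  have [measurable]: "h \<in> borel_measurable \<rho>" using h assms(1) by (simp cong: measurable_cong_sets)
  have m: "(\<lambda>x. \<Psi> Q * (h x * indicator Q x)) \<in> borel_measurable \<rho>" if "Q \<in> cells" for Q
  proof -
    have [measurable]: "Q \<in> sets \<rho>" using that assms(1) by (simp add: cells_lebesgue)
    show ?thesis by measurable
  qed
  have "(\<integral>\<^sup>+Q. \<Psi> Q * (\<integral>\<^sup>+x\<in>Q. h x \<partial>\<rho>) \<partial>count_space cells) =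
      (\<integral>\<^sup>+Q. (\<integral>\<^sup>+x. \<Psi> Q * (h x * indicator Q x) \<partial>\<rho>) \<partial>count_space cells)"
  proof (intro nn_integral_cong)
    fix Q assume "Q \<in> space (count_space cells)"
    then have [measurable]: "Q \<in> sets \<rho>" using assms(1) by (simp add: cells_lebesgue)
    show "\<Psi> Q * (\<integral>\<^sup>+x\<in>Q. h x \<partial>\<rho>) = (\<integral>\<^sup>+x. \<Psi> Q * (h x * indicator Q x) \<partial>\<rho>)"
      by (rule nn_integral_cmult[symmetric]) measurable
  qed
  also have "\<dots> = (\<integral>\<^sup>+x. (\<integral>\<^sup>+Q. \<Psi> Q * (h x * indicator Q x) \<partial>count_space cells) \<partial>\<rho>)"
    using m by (intro nn_integral_count_space_nn_integral[symmetric]) auto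
  also have "\<dots> = (\<integral>\<^sup>+x. h x * (\<integral>\<^sup>+Q. \<Psi> Q * indicator Q x \<partial>count_space cells) \<partial>\<rho>)"
    by (subst nn_integral_cmult[symmetric]) (auto intro!: nn_integral_cong simp: mult_ac)
  finally show ?thesis by (simp add: sum_over_cells_at)
qed

text \<open>
  The maximal cells, among those of generation at least \<open>k0\<close>, on which \<open>P\<close> holds. Bounding the generation
  from below is what makes maximal cells exist.
\<close>

definition stopping_cells :: "int \<Rightarrow> (int \<Rightarrow> 'a set \<Rightarrow> bool) \<Rightarrow> 'a set set"
  where "stopping_cells k0 P = {cell k x | k x. k0 \<le> k \<and> P k (cell k x) \<and> (\<forall>j. k0 \<le> j \<and> j < k \<longrightarrow> \<not> P j (cell j x))}"

lemma stopping_cells_subset: "stopping_cells k0 P \<subseteq> cells"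
  by (auto simp: stopping_cells_def)

lemma countable_stopping_cells: "countable (stopping_cells k0 P)"
  using stopping_cells_subset countable_all_cells countable_subset by blast

lemma disjoint_stopping_cells: "disjoint (stopping_cells k0 P)"
proof (rule disjointI)
  fix Q R assume Q: "Q \<in> stopping_cells k0 P" and R: "R \<in> stopping_cells k0 P" and "Q \<noteq> R"
  obtain k x where k: "Q = cell k x" "k0 \<le> k" "P k (cell k x)" "\<And>j. k0 \<le> j \<Longrightarrow> j < k \<Longrightarrow> \<not> P j (cell j x)"
    using Q by (auto simp: stopping_cells_def)
  obtain l y where l: "R = cell l y" "k0 \<le> l" "P l (cell l y)" "\<And>j. k0 \<le> j \<Longrightarrow> j < l \<Longrightarrow> \<not> P j (cell j y)"
    using R by (auto simp: stopping_cells_def)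
  show "Q \<inter> R = {}"
  proof (rule ccontr)
    assume "Q \<inter> R \<noteq> {}"
    then obtain z where z: "z \<in> cell k x" "z \<in> cell l y" using k l by auto
    have "\<not> k < l" using l(4)[of k] k z cell_eq_mono[of k l z y] cell_eq[of z k x] by auto
    moreover have "\<not> l < k" using k(4)[of l] l z cell_eq_mono[of l k z x] cell_eq[of z l y] by auto
    ultimately have "k = l" by simp
    then have "Q = R" using k l z cell_eq by metis
    then show False using \<open>Q \<noteq> R\<close> by simp
  qed
qed

lemma Union_stopping_cells: "\<Union>(stopping_cells k0 P) = {x. \<exists>k\<ge>k0. P k (cell k x)}"
proof (intro antisym subsetI)
  fix y assume "y \<in> \<Union>(stopping_cells k0 P)"
  then obtain k x where "y \<in> cell k x" "k0 \<le> k" "P k (cell k x)" by (auto simp: stopping_cells_def)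
  then show "y \<in> {x. \<exists>k\<ge>k0. P k (cell k x)}" using cell_eq by auto
next
  fix x assume "x \<in> {x. \<exists>k\<ge>k0. P k (cell k x)}"
  then obtain k where k: "k0 \<le> k" "P k (cell k x)" by auto
  define n where "n = (LEAST n. P (k0 + int n) (cell (k0 + int n) x))"
  have ex: "P (k0 + int (nat (k - k0))) (cell (k0 + int (nat (k - k0))) x)" using k by simp
  have n: "P (k0 + int n) (cell (k0 + int n) x)" unfolding n_def by (rule LeastI) (rule ex)
  have min: "\<not> P j (cell j x)" if "k0 \<le> j" "j < k0 + int n" for j
  proof -
    have "\<not> P (k0 + int (nat (j - k0))) (cell (k0 + int (nat (j - k0))) x)"
      using that not_less_Least[of "nat (j - k0)" "\<lambda>n. P (k0 + int n) (cell (k0 + int n) x)"]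
      unfolding n_def[symmetric] by linarith
    then show ?thesis using that by simp
  qed
  have "cell (k0 + int n) x \<in> stopping_cells k0 P"
    unfolding stopping_cells_def using n min
    by (intro CollectI exI[of _ "k0 + int n"] exI[of _ x]) auto
  then show "x \<in> \<Union>(stopping_cells k0 P)" by (meson UnionI cell_self)
qed

section \<open>The dyadic maximal function\<close>

definition cell_measure :: "'a measure \<Rightarrow> bool"
  where "cell_measure \<rho> \<longleftrightarrow> sets \<rho> = sets lebesgue \<and> (\<forall>Q\<in>cells. 0 < emeasure \<rho> Q \<and> emeasure \<rho> Q < top)"

definition nn_mean :: "'a measure \<Rightarrow> ('a \<Rightarrow> ennreal) \<Rightarrow> 'a set \<Rightarrow> ennreal"
  where "nn_mean \<rho> F Q = (\<integral>\<^sup>+y\<in>Q. F y \<partial>\<rho>) / emeasure \<rho> Q"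

definition dyadic_max :: "'a measure \<Rightarrow> ('a \<Rightarrow> ennreal) \<Rightarrow> 'a \<Rightarrow> ennreal"
  where "dyadic_max \<rho> F x = (SUP k. nn_mean \<rho> F (cell k x))"

lemma cell_measureD:
  assumes "cell_measure \<rho>"
  shows "sets \<rho> = sets lebesgue" "Q \<in> cells \<Longrightarrow> 0 < emeasure \<rho> Q" "Q \<in> cells \<Longrightarrow> emeasure \<rho> Q < top"
  using assms by (auto simp: cell_measure_def)

lemma cell_measure_lebesgue: "cell_measure lebesgue"
  by (auto simp: cell_measure_def cells_def emeasure_cell)

lemma nn_mean_mult:
  assumes "cell_measure \<rho>" "Q \<in> cells"
  shows "nn_mean \<rho> F Q * emeasure \<rho> Q = (\<integral>\<^sup>+y\<in>Q. F y \<partial>\<rho>)"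
  using assms by (auto simp: nn_mean_def cell_measure_def ennreal_divide_mult_cancel)

lemma nn_mean_le_dyadic_max: "Q \<in> cells \<Longrightarrow> x \<in> Q \<Longrightarrow> nn_mean \<rho> F Q \<le> dyadic_max \<rho> F x"
  unfolding dyadic_max_def cells_def by (auto simp: cell_eq_iff) (metis SUP_upper UNIV_I)

text \<open>
  A function of the cell takes countably many values, each on a union of cells.
\<close>

lemma measurable_cell_function [measurable]: "(\<lambda>x. \<phi> (cell k x)) \<in> borel_measurable lebesgue"
proof -
  have "cell k \<in> measurable lebesgue (count_space (range (cell k)))"
  proof (subst measurable_count_space_eq_countable[OF countable_cells], intro conjI ballI)
    fix Q assume "Q \<in> range (cell k)"
    then obtain x where "Q = cell k x" by auto
    then have "cell k -` {Q} \<inter> space lebesgue = cell k x" using cell_eq_iff by auto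
    then show "cell k -` {Q} \<inter> space lebesgue \<in> sets lebesgue" by simp
  qed auto
  then show ?thesis by (rule measurable_compose) simp
qed

lemma measurable_dyadic_max [measurable]: "dyadic_max \<rho> F \<in> borel_measurable lebesgue"
  unfolding dyadic_max_def[abs_def] by measurable

lemma dyadic_max_mono: "(\<And>x. F x \<le> G x) \<Longrightarrow> dyadic_max \<rho> F x \<le> dyadic_max \<rho> G x"
  unfolding dyadic_max_def nn_mean_def
  by (intro SUP_mono' divide_right_mono_ennreal nn_integral_mono mult_right_mono) auto

text \<open>
  The set where the maximal function exceeds \<open>t\<close> is the increasing union, over the lower bound \<open>- N\<close> for
  the generation, of the disjoint maximal cells with mean above \<open>t\<close>.
\<close>

lemma weak_type:
  assumes \<rho>: "cell_measure \<rho>" and F: "F \<in> borel_measurable lebesgue"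
  shows "t * emeasure \<rho> {x. t < dyadic_max \<rho> F x} \<le> (\<integral>\<^sup>+x. F x \<partial>\<rho>)"
proof -
  note s = cell_measureD(1)[OF \<rho>]
  have F': "F \<in> borel_measurable \<rho>" using F s by (simp cong: measurable_cong_sets)
  define S where "S N = stopping_cells (- int N) (\<lambda>k Q. t < nn_mean \<rho> F Q)" for N
  have SN: "countable (S N)" "disjoint (S N)" "S N \<subseteq> sets \<rho>" for N
    unfolding S_def using s countable_stopping_cells disjoint_stopping_cells stopping_cells_subset cells_lebesgue
    by blast+
  have sets: "\<Union>(S N) \<in> sets \<rho>" for N
    using SN by (intro sets.countable_Union) auto
  have inc: "incseq (\<lambda>N. \<Union>(S N))"
    unfolding incseq_def S_def Union_stopping_cells by (auto, meson dual_order.trans neg_le_iff_le of_nat_le_iff)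
  have U: "{x. t < dyadic_max \<rho> F x} = (\<Union>N. \<Union>(S N))"
  proof -
    have "(\<exists>N. \<exists>k\<ge>- int N. P k) \<longleftrightarrow> (\<exists>k. P k)" for P :: "int \<Rightarrow> bool"
    proof
      assume "\<exists>k. P k"
      then obtain k where "P k" by auto
      moreover have "- int (nat \<bar>k\<bar>) \<le> k" by simp
      ultimately show "\<exists>N. \<exists>k\<ge>- int N. P k" by blast
    qed auto
    then show ?thesis
      unfolding S_def Union_stopping_cells dyadic_max_def less_SUP_iff by auto
  qed
  have le: "t * emeasure \<rho> (\<Union>(S N)) \<le> (\<integral>\<^sup>+x. F x \<partial>\<rho>)" for N
  proof -
    have "t * emeasure \<rho> (\<Union>(S N)) = (\<integral>\<^sup>+x\<in>\<Union>(S N). t \<partial>\<rho>)"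
      using sets by (simp add: nn_integral_cmult_indicator)
    also have "\<dots> = (\<integral>\<^sup>+Q. (\<integral>\<^sup>+x\<in>Q. t \<partial>\<rho>) \<partial>count_space (S N))"
      by (rule nn_integral_disjoint_Union[OF SN]) simp
    also have "\<dots> \<le> (\<integral>\<^sup>+Q. (\<integral>\<^sup>+x\<in>Q. F x \<partial>\<rho>) \<partial>count_space (S N))"
    proof (rule nn_integral_mono)
      fix Q assume "Q \<in> space (count_space (S N))"
      then have Q: "Q \<in> cells" "t < nn_mean \<rho> F Q"
        unfolding S_def by (auto simp: stopping_cells_def)
      have "Q \<in> sets \<rho>" using Q(1) s cells_lebesgue by simp
      note Q = Q this
      have "(\<integral>\<^sup>+x\<in>Q. t \<partial>\<rho>) = t * emeasure \<rho> Q" using Q by (simp add: nn_integral_cmult_indicator)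
      also have "\<dots> \<le> nn_mean \<rho> F Q * emeasure \<rho> Q" using Q by (intro mult_right_mono) auto
      finally show "(\<integral>\<^sup>+x\<in>Q. t \<partial>\<rho>) \<le> (\<integral>\<^sup>+x\<in>Q. F x \<partial>\<rho>)" using nn_mean_mult[OF \<rho> Q(1)] by simp
    qed
    also have "\<dots> = (\<integral>\<^sup>+x\<in>\<Union>(S N). F x \<partial>\<rho>)"
      by (rule nn_integral_disjoint_Union[OF SN F', symmetric])
    also have "\<dots> \<le> (\<integral>\<^sup>+x. F x \<partial>\<rho>)"
      by (intro nn_integral_mono) (auto simp: indicator_def)
    finally show ?thesis .
  qed
  have "t * emeasure \<rho> {x. t < dyadic_max \<rho> F x} = t * (SUP N. emeasure \<rho> (\<Union>(S N)))"
    unfolding U using sets inc by (subst SUP_emeasure_incseq) auto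
  also have "\<dots> \<le> (\<integral>\<^sup>+x. F x \<partial>\<rho>)"
    unfolding SUP_mult_left_ennreal by (rule SUP_least) (rule le)
  finally show ?thesis .
qed

end

text \<open>
  The value comes from summing the weak type estimate over the levels \<open>2 powr (- k)\<close>. It does not depend
  on the measure, which is essential for \<open>dyadic_max_weighted\<close>.
\<close>

definition doob_const :: "real \<Rightarrow> real"
  where "doob_const p = 4 powr p / (1 - (1/2) powr (p - 1))"

lemma doob_const_pos: "1 < p \<Longrightarrow> 0 < doob_const p"
  unfolding doob_const_def by (intro divide_pos_pos) (auto simp: powr_base_less_one)

text \<open>
  A single level \<open>side k < X \<le> 2 * side k\<close> already accounts for \<open>X powr p\<close>; for \<open>X = top\<close> these levels are
  unbounded.
\<close>

lemma layer_cake_lower: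
  assumes "0 < p"
  shows "ennpowr X p \<le> (\<integral>\<^sup>+k. ennreal (2 powr p * side k powr p) * indicator {y. ennreal (side k) < y} X \<partial>count_space UNIV)"
    (is "_ \<le> ?S")
proof -
  have *: "ennreal (y powr p) \<le> ?S" if y: "0 < y" "ennreal y \<le> X" for y
  proof -
    obtain k where k: "side k < y" "y \<le> 2 * side k" using side_bracket[OF y(1)] by blast
    have kX: "ennreal (side k) < X"
      using k(1) y by (meson ennreal_lessI less_le_trans)
    have "y powr p \<le> 2 powr p * side k powr p"
      using k y assms powr_mono2[of p y "2 * side k"] by (simp add: powr_mult less_imp_le)
    then have "ennreal (y powr p) \<le> ennreal (2 powr p * side k powr p) * indicator {y. ennreal (side k) < y} X"
      using kX by (simp add: ennreal_leI)
    also have "\<dots> \<le> ?S"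
      by (rule nn_integral_ge_point) simp
    finally show ?thesis .
  qed
  show ?thesis
  proof (cases X)
    case (real y)
    then show ?thesis using *[of y] by (cases "y = 0") (auto simp: ennpowr_ennreal)
  next
    case top
    have "?S = top"
    proof (rule ccontr)
      assume "?S \<noteq> top"
      then obtain c where c: "?S = ennreal c" "0 \<le> c" by (cases ?S) auto
      have "ennreal (((c + 1) powr (1 / p)) powr p) \<le> ?S"
        using c top by (intro *) auto
      then show False using c assms by (simp add: powr_powr)
    qed
    then show ?thesis by simp
  qed
qed

context dyadic_grid
begin

theorem dyadic_max_strong_type:
  assumes p: "1 < p" and \<rho>: "cell_measure \<rho>" and F: "F \<in> borel_measurable lebesgue"
  shows "(\<integral>\<^sup>+x. ennpowr (dyadic_max \<rho> F x) p \<partial>\<rho>) \<le> ennreal (doob_const p) * (\<integral>\<^sup>+x. ennpowr (F x) p \<partial>\<rho>)"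
proof -
  note s = cell_measureD(1)[OF \<rho>]
  note s[measurable_cong]
  have F' [measurable]: "F \<in> borel_measurable \<rho>" using F s by (simp cong: measurable_cong_sets)
  have M [measurable]: "dyadic_max \<rho> F \<in> borel_measurable \<rho>"
    using measurable_dyadic_max s by (simp cong: measurable_cong_sets)
  define Fk where "Fk k x = F x * indicator {x. ennreal (side k / 2) \<le> F x} x" for k x
  have Fk_m: "Fk k \<in> borel_measurable lebesgue" for k unfolding Fk_def using F by measurable
  have Fk_m' [measurable]: "Fk k \<in> borel_measurable \<rho>" for k unfolding Fk_def by measurable
  \<comment> \<open>Only the part of \<open>F\<close> above half the level contributes to the level set of the maximal function.\<close>
  have split: "{x. ennreal (side k) < dyadic_max \<rho> F x} \<subseteq> {x. ennreal (side k / 2) < dyadic_max \<rho> (Fk k) x}" for k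
  proof (intro subsetI CollectI)
    fix x assume "x \<in> {x. ennreal (side k) < dyadic_max \<rho> F x}"
    then obtain j where j: "ennreal (side k) < nn_mean \<rho> F (cell j x)"
      by (auto simp: dyadic_max_def less_SUP_iff)
    let ?Q = "cell j x"
    have Q: "?Q \<in> sets \<rho>" using s by simp
    have "(\<integral>\<^sup>+y\<in>?Q. F y \<partial>\<rho>) \<le> (\<integral>\<^sup>+y. Fk k y * indicator ?Q y + ennreal (side k / 2) * indicator ?Q y \<partial>\<rho>)"
      by (intro nn_integral_mono) (auto simp: Fk_def indicator_def less_imp_le)
    also have "\<dots> = (\<integral>\<^sup>+y\<in>?Q. Fk k y \<partial>\<rho>) + ennreal (side k / 2) * emeasure \<rho> ?Q"
      using Q by (subst nn_integral_add) (auto simp: nn_integral_cmult_indicator)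
    finally have "nn_mean \<rho> F ?Q * emeasure \<rho> ?Q \<le> (nn_mean \<rho> (Fk k) ?Q + ennreal (side k / 2)) * emeasure \<rho> ?Q"
      by (simp add: nn_mean_mult[OF \<rho>] distrib_right)
    then have "nn_mean \<rho> F ?Q \<le> nn_mean \<rho> (Fk k) ?Q + ennreal (side k / 2)"
      using cell_measureD(2,3)[OF \<rho>, of ?Q] by (simp add: ennreal_mult_le_mult_iff mult.commute[of _ "emeasure _ _"] less_top)
    then have less: "ennreal (side k / 2) + ennreal (side k / 2) < nn_mean \<rho> (Fk k) ?Q + ennreal (side k / 2)"
    proof -
      have "ennreal (side k / 2) + ennreal (side k / 2) = ennreal (side k)"
        by (subst ennreal_plus[symmetric]) (auto simp: less_imp_le)
      then show ?thesis using j \<open>nn_mean \<rho> F ?Q \<le> _\<close> by (metis less_le_trans)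
    qed
    have "ennreal (side k / 2) < nn_mean \<rho> (Fk k) ?Q"
    proof (rule ccontr)
      assume "\<not> ?thesis"
      then have "nn_mean \<rho> (Fk k) ?Q + ennreal (side k / 2) \<le> ennreal (side k / 2) + ennreal (side k / 2)"
        by (intro add_right_mono) simp
      then show False using less by simp
    qed
    then show "ennreal (side k / 2) < dyadic_max \<rho> (Fk k) x"
      using nn_mean_le_dyadic_max[of ?Q x \<rho> "Fk k"] by simp
  qed
  have level: "ennreal (2 powr p * side k powr p) * emeasure \<rho> {x. ennreal (side k) < dyadic_max \<rho> F x}
      \<le> ennreal (4 powr p * (side k / 2) powr (p - 1)) * (\<integral>\<^sup>+x. Fk k x \<partial>\<rho>)" for k
  proof -
    have "2 powr p * side k powr p = 4 powr p * (side k / 2) powr (p - 1) * (side k / 2)"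
    proof -
      have "(side k / 2) powr (p - 1) * (side k / 2) = (side k / 2) powr p"
        using powr_add[of "side k / 2" "p - 1" 1] by (simp add: abs_of_pos)
      moreover have "4 powr p * (side k / 2) powr p = 2 powr p * side k powr p"
        by (simp add: less_imp_le flip: powr_mult)
      ultimately show ?thesis by (metis mult.assoc)
    qed
    note eq = this
    have "ennreal (2 powr p * side k powr p) * emeasure \<rho> {x. ennreal (side k) < dyadic_max \<rho> F x}
      = ennreal (4 powr p * (side k / 2) powr (p - 1)) *
         (ennreal (side k / 2) * emeasure \<rho> {x. ennreal (side k) < dyadic_max \<rho> F x})"
      unfolding eq by (subst ennreal_mult) (auto simp: less_imp_le intro: mult.assoc)
    also have "\<dots> \<le> ennreal (4 powr p * (side k / 2) powr (p - 1)) *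
         (ennreal (side k / 2) * emeasure \<rho> {x. ennreal (side k / 2) < dyadic_max \<rho> (Fk k) x})"
    proof -
      have "{x \<in> space \<rho>. ennreal (side k / 2) < dyadic_max \<rho> (Fk k) x} \<in> sets \<rho>"
        using measurable_dyadic_max[of \<rho> "Fk k"] s by (measurable)
      moreover have "space \<rho> = UNIV" using sets_eq_imp_space_eq[OF s] by simp
      ultimately show ?thesis using split by (intro mult_left_mono emeasure_mono) auto
    qed
    also have "\<dots> \<le> ennreal (4 powr p * (side k / 2) powr (p - 1)) * (\<integral>\<^sup>+x. Fk k x \<partial>\<rho>)"
      by (intro mult_left_mono weak_type[OF \<rho> Fk_m]) simp
    finally show ?thesis .
  qed
  have sp: "space \<rho> = UNIV" using sets_eq_imp_space_eq[OF s] by simp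
  have lev_sets [measurable]: "{x. ennreal (side k) < dyadic_max \<rho> F x} \<in> sets \<rho>" for k
  proof -
    have "{x \<in> space \<rho>. ennreal (side k) < dyadic_max \<rho> F x} \<in> sets \<rho>" by measurable
    then show ?thesis by (simp add: sp)
  qed
  have "(\<integral>\<^sup>+x. ennpowr (dyadic_max \<rho> F x) p \<partial>\<rho>) \<le>
     (\<integral>\<^sup>+x. (\<integral>\<^sup>+k. ennreal (2 powr p * side k powr p) * indicator {x. ennreal (side k) < dyadic_max \<rho> F x} x \<partial>count_space UNIV) \<partial>\<rho>)"
    using layer_cake_lower[of p] p by (intro nn_integral_mono) (auto simp: indicator_def)
  also have "\<dots> = (\<integral>\<^sup>+k. (\<integral>\<^sup>+x. ennreal (2 powr p * side k powr p) * indicator {x. ennreal (side k) < dyadic_max \<rho> F x} x \<partial>\<rho>) \<partial>count_space UNIV)"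
    by (intro nn_integral_count_space_nn_integral) auto
  also have "\<dots> = (\<integral>\<^sup>+k. ennreal (2 powr p * side k powr p) * emeasure \<rho> {x. ennreal (side k) < dyadic_max \<rho> F x} \<partial>count_space UNIV)"
    using lev_sets by (intro nn_integral_cong) (simp add: nn_integral_cmult_indicator)
  also have "\<dots> \<le> (\<integral>\<^sup>+k. ennreal (4 powr p * (side k / 2) powr (p - 1)) * (\<integral>\<^sup>+x. Fk k x \<partial>\<rho>) \<partial>count_space UNIV)"
    by (intro nn_integral_mono level)
  also have "\<dots> = (\<integral>\<^sup>+k. (\<integral>\<^sup>+x. ennreal (4 powr p * (side k / 2) powr (p - 1)) * Fk k x \<partial>\<rho>) \<partial>count_space UNIV)"
    by (intro nn_integral_cong) (simp add: nn_integral_cmult)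
  also have "\<dots> = (\<integral>\<^sup>+x. (\<integral>\<^sup>+k. ennreal (4 powr p * (side k / 2) powr (p - 1)) * Fk k x \<partial>count_space UNIV) \<partial>\<rho>)"
    by (intro nn_integral_count_space_nn_integral[symmetric]) auto
  also have "\<dots> \<le> (\<integral>\<^sup>+x. ennreal (doob_const p) * ennpowr (F x) p \<partial>\<rho>)"
  proof (intro nn_integral_mono)
    fix x
    show "(\<integral>\<^sup>+k. ennreal (4 powr p * (side k / 2) powr (p - 1)) * Fk k x \<partial>count_space UNIV) \<le> ennreal (doob_const p) * ennpowr (F x) p"
    proof (cases "F x")
      case top
      then show ?thesis using doob_const_pos[OF p] by (simp add: ennreal_mult_top)
    next
      case (real y)
      have "(\<integral>\<^sup>+k. ennreal (4 powr p * (side k / 2) powr (p - 1)) * Fk k x \<partial>count_space UNIV) =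
         (\<integral>\<^sup>+k. (ennreal (4 powr p) * F x) * (if side k / 2 \<le> y then ennreal ((side k / 2) powr (p - 1)) else 0) \<partial>count_space UNIV)"
        using real by (intro nn_integral_cong) (auto simp: Fk_def indicator_def ennreal_mult mult_ac)
      also have "\<dots> = (ennreal (4 powr p) * F x) * (\<integral>\<^sup>+k. (if side k / 2 \<le> y then ennreal ((side k / 2) powr (p - 1)) else 0) \<partial>count_space UNIV)"
        by (rule nn_integral_cmult) simp
      also have "\<dots> \<le> (ennreal (4 powr p) * F x) * ennreal (y powr (p - 1) / (1 - (1/2) powr (p - 1)))"
        using p by (intro mult_left_mono geometric_level_sum) (auto simp: side_Suc)
      also have "\<dots> = ennreal (doob_const p) * ennpowr (F x) p"
      proof -
        have 1: "(1/2) powr (p - 1) < (1::real)" using p by (simp add: powr_base_less_one)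
        have "y powr p = y * y powr (p - 1)"
          using real p powr_add[of y 1 "p - 1"] by (cases "y = 0") auto
        then show ?thesis using real p 1
          by (simp add: ennpowr_ennreal doob_const_def mult_ac flip: ennreal_mult')
      qed
      finally show ?thesis .
    qed
  qed
  also have "\<dots> = ennreal (doob_const p) * (\<integral>\<^sup>+x. ennpowr (F x) p \<partial>\<rho>)"
    by (rule nn_integral_cmult) simp
  finally show ?thesis .
qed

end

section \<open>An off-diagonal Carleson embedding\<close>

text \<open>
  Along a chain of cells the means \<open>a k\<close> are bounded both by the maximal function \<open>A\<close> and by
  \<open>(I / s k) powr (1 / p)\<close>, where \<open>s k\<close> is the measure of the cell. The first bound makes the small cells
  summable because \<open>r > p\<close>, the second one the large cells. Using each on its side of the size \<open>T\<close> at
  which they agree gives two geometric sums of the same order.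
\<close>

lemma two_regime_sum:
  fixes s a :: "int \<Rightarrow> real"
  assumes s: "\<And>k. 0 < s k" "\<And>k. s (k + 1) \<le> \<theta> * s k" and \<theta>: "0 < \<theta>" "\<theta> < 1"
    and p: "0 < p" "p < r"
    and a: "\<And>k. 0 \<le> a k" "\<And>k. a k \<le> A" "\<And>k. a k powr p * s k \<le> I" and pos: "0 < A" "0 < I"
  shows "(\<integral>\<^sup>+k. ennreal (s k powr (r / p - 1) * a k powr r) \<partial>count_space UNIV)
    \<le> ennreal ((1 / (1 - \<theta> powr (r / p - 1)) + 1 / (1 - \<theta>)) * (A powr p * I powr (r / p - 1)))"
proof -
  define \<gamma> where "\<gamma> = r / p - 1"
  have \<gamma>: "0 < \<gamma>" "p * \<gamma> = r - p" "1 + \<gamma> = r / p" using p by (auto simp: \<gamma>_def field_simps)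
  define T where "T = I / A powr p"
  have T: "0 < T" using pos by (simp add: T_def)
  define X where "X = A powr p * I powr \<gamma>"
  have 1: "A powr r * T powr \<gamma> = X"
  proof -
    have "T powr \<gamma> = I powr \<gamma> / A powr (r - p)"
      using pos \<gamma> by (simp add: T_def powr_divide powr_powr)
    moreover have "A powr r = A powr (r - p) * A powr p" by (simp flip: powr_add)
    ultimately show ?thesis using pos by (simp add: X_def)
  qed
  have 2: "I powr (r / p) * (1 / T) = X"
    using pos \<gamma>(3)[symmetric] by (simp add: T_def X_def powr_add)
  have bound: "s k powr \<gamma> * a k powr r \<le> A powr r * (if s k \<le> T then s k powr \<gamma> else 0)
      + I powr (r / p) * (if 1 / s k \<le> 1 / T then (1 / s k) powr 1 else 0)" for k
  proof (cases "s k \<le> T")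
    case True
    have "a k powr r \<le> A powr r" using a p by (intro powr_mono2) auto
    then have "s k powr \<gamma> * a k powr r \<le> A powr r * s k powr \<gamma>"
      by (subst mult.commute) (rule mult_right_mono, auto)
    moreover have "0 \<le> I powr (r / p) * (if 1 / s k \<le> 1 / T then (1 / s k) powr 1 else 0)" by simp
    ultimately show ?thesis unfolding if_P[OF True] by linarith
  next
    case False
    have "(a k powr p * s k) powr (r / p) \<le> I powr (r / p)" using a p s by (intro powr_mono2) (auto simp: less_imp_le)
    then have "a k powr r * s k powr (r / p) \<le> I powr (r / p)"
      using a s p by (simp add: powr_mult powr_powr less_imp_le)
    then have "a k powr r * s k powr (1 + \<gamma>) \<le> I powr (r / p)" using \<gamma> by simp
    then have "s k powr \<gamma> * a k powr r \<le> I powr (r / p) * (1 / s k)"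
      using s[of k] by (simp add: powr_add field_simps)
    then show ?thesis using False s(1)[of k] T by (simp add: field_simps abs_of_pos)
  qed
  have "(\<integral>\<^sup>+k. ennreal (s k powr \<gamma> * a k powr r) \<partial>count_space UNIV) \<le>
     (\<integral>\<^sup>+k. ennreal (A powr r) * (if s k \<le> T then ennreal (s k powr \<gamma>) else 0) +
        ennreal (I powr (r / p)) * (if 1 / s k \<le> 1 / T then ennreal ((1 / s k) powr 1) else 0) \<partial>count_space UNIV)"
  proof (intro nn_integral_mono)
    fix k
    have "ennreal (s k powr \<gamma> * a k powr r) \<le> ennreal (A powr r * (if s k \<le> T then s k powr \<gamma> else 0)
      + I powr (r / p) * (if 1 / s k \<le> 1 / T then (1 / s k) powr 1 else 0))"
      using bound by (rule ennreal_leI)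
    also have "\<dots> = ennreal (A powr r) * (if s k \<le> T then ennreal (s k powr \<gamma>) else 0) +
        ennreal (I powr (r / p)) * (if 1 / s k \<le> 1 / T then ennreal ((1 / s k) powr 1) else 0)"
      by (simp add: ennreal_mult)
    finally show "ennreal (s k powr \<gamma> * a k powr r) \<le> ennreal (A powr r) * (if s k \<le> T then ennreal (s k powr \<gamma>) else 0) +
        ennreal (I powr (r / p)) * (if 1 / s k \<le> 1 / T then ennreal ((1 / s k) powr 1) else 0)" .
  qed
  also have "\<dots> = ennreal (A powr r) * (\<integral>\<^sup>+k. (if s k \<le> T then ennreal (s k powr \<gamma>) else 0) \<partial>count_space UNIV) +
        ennreal (I powr (r / p)) * (\<integral>\<^sup>+k. (if 1 / s k \<le> 1 / T then ennreal ((1 / s k) powr 1) else 0) \<partial>count_space UNIV)"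
    by (subst nn_integral_add) (auto simp: nn_integral_cmult)
  also have "(\<integral>\<^sup>+k. (if 1 / s k \<le> 1 / T then ennreal ((1 / s k) powr 1) else 0) \<partial>count_space UNIV) =
      (\<integral>\<^sup>+k. (if 1 / s (- k) \<le> 1 / T then ennreal ((1 / s (- k)) powr 1) else 0) \<partial>count_space UNIV)"
    by (rule nn_integral_bij_count_space[symmetric, of uminus UNIV UNIV "\<lambda>k. if 1 / s k \<le> 1 / T then ennreal ((1 / s k) powr 1) else 0"])
       (auto simp: bij_betw_def inj_on_def intro!: surjI[of uminus uminus])
  also have "ennreal (A powr r) * (\<integral>\<^sup>+k. (if s k \<le> T then ennreal (s k powr \<gamma>) else 0) \<partial>count_space UNIV) +
        ennreal (I powr (r / p)) * (\<integral>\<^sup>+k. (if 1 / s (- k) \<le> 1 / T then ennreal ((1 / s (- k)) powr 1) else 0) \<partial>count_space UNIV) \<le>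
     ennreal (A powr r) * ennreal (T powr \<gamma> / (1 - \<theta> powr \<gamma>)) + ennreal (I powr (r / p)) * ennreal ((1 / T) powr 1 / (1 - \<theta> powr 1))"
  proof (intro add_mono mult_left_mono geometric_level_sum)
    fix k
    show "1 / s (- (k + 1)) \<le> \<theta> * (1 / s (- k))"
      using s(2)[of "- (k + 1)"] s(1)[of "- k"] s(1)[of "- (k + 1)"] by (simp add: field_simps)
  qed (use s \<theta> \<gamma> in auto)
  also have "\<dots> = ennreal (A powr r * T powr \<gamma> / (1 - \<theta> powr \<gamma>) + I powr (r / p) * (1 / T) / (1 - \<theta>))"
    using \<theta> T powr_base_less_one[of \<theta> \<gamma>] \<gamma> by (simp flip: ennreal_mult' ennreal_plus)
  also have "\<dots> = ennreal ((1 / (1 - \<theta> powr \<gamma>) + 1 / (1 - \<theta>)) * X)"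
    unfolding 1 2 by (simp add: algebra_simps)
  finally show ?thesis unfolding X_def \<gamma>_def .
qed

definition embedding_const :: "real \<Rightarrow> real \<Rightarrow> real \<Rightarrow> real"
  where "embedding_const p r \<theta> = (1 / (1 - \<theta> powr (r / p - 1)) + 1 / (1 - \<theta>)) * doob_const p"

lemma embedding_const_pos:
  assumes "1 < p" "p < r" "0 < \<theta>" "\<theta> < 1"
  shows "0 < embedding_const p r \<theta>"
proof -
  have "\<theta> powr (r / p - 1) < 1" using assms by (intro powr_base_less_one) (auto simp: field_simps)
  then show ?thesis unfolding embedding_const_def using assms doob_const_pos[of p]
    by (intro mult_pos_pos add_pos_pos) auto
qed

context dyadic_grid
begin

lemma nn_mean_power_le:
  assumes p: "1 < p" and \<rho>: "cell_measure \<rho>" and Q: "Q \<in> cells" and F: "F \<in> borel_measurable lebesgue"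
  shows "ennpowr (nn_mean \<rho> F Q) p * emeasure \<rho> Q \<le> (\<integral>\<^sup>+x\<in>Q. ennpowr (F x) p \<partial>\<rho>)"
proof -
  note s = cell_measureD(1)[OF \<rho>]
  have m: "F \<in> borel_measurable \<rho>" "Q \<in> sets \<rho>" using F s Q cells_lebesgue by (auto cong: measurable_cong_sets)
  let ?m = "emeasure \<rho> Q" and ?I = "\<integral>\<^sup>+x\<in>Q. ennpowr (F x) p \<partial>\<rho>"
  have q: "0 < 1 - 1 / p" using p by simp
  have "nn_mean \<rho> F Q * ?m = (\<integral>\<^sup>+x\<in>Q. ennpowr (F x) 1 \<partial>\<rho>)"
    using nn_mean_mult[OF \<rho> Q] by simp
  also have "\<dots> \<le> ennpowr ?I (1 / p) * ennpowr ?m (1 - 1 / p)"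
    using nn_set_integral_power_mean[of 1 p F \<rho> Q] p m by simp
  finally have "ennpowr (nn_mean \<rho> F Q * ?m) p \<le> ennpowr (ennpowr ?I (1 / p) * ennpowr ?m (1 - 1 / p)) p"
    using p by (intro ennpowr_mono) auto
  also have "\<dots> = ?I * ennpowr ?m (p - 1)"
    using p q by (simp add: ennpowr_mult ennpowr_ennpowr algebra_simps)
  finally have "ennpowr (nn_mean \<rho> F Q) p * ennpowr ?m (1 + (p - 1)) \<le> ?I * ennpowr ?m (p - 1)"
    using p by (simp add: ennpowr_mult)
  then have "ennpowr ?m (p - 1) * (ennpowr (nn_mean \<rho> F Q) p * ?m) \<le> ennpowr ?m (p - 1) * ?I"
    using p by (subst (asm) ennpowr_add) (auto simp: mult_ac)
  then show ?thesis
    using cell_measureD(2,3)[OF \<rho> Q] by (subst (asm) ennreal_mult_le_mult_iff) auto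
qed

text \<open>
  If the measure shrinks geometrically from a cell to its children, then for \<open>r > p\<close> the Carleson embedding
  holds for the sum over all cells. The sum over the grid is the integral of the chain sums of \<open>two_regime_sum\<close>, and
  their bound is a multiple of the \<open>p\<close>-th power of the maximal function.
\<close>

theorem off_diagonal_embedding:
  assumes p: "1 < p" "p < r" and \<theta>: "0 < \<theta>" "\<theta> < 1" and \<rho>: "cell_measure \<rho>"
    and shrink: "\<And>k x. emeasure \<rho> (cell (k + 1) x) \<le> ennreal \<theta> * emeasure \<rho> (cell k x)"
    and F: "F \<in> borel_measurable lebesgue"
  shows "(\<integral>\<^sup>+Q. ennpowr (emeasure \<rho> Q) (r / p) * ennpowr (nn_mean \<rho> F Q) r \<partial>count_space cells) \<le>
    ennreal (embedding_const p r \<theta>) * ennpowr (\<integral>\<^sup>+x. ennpowr (F x) p \<partial>\<rho>) (r / p)"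
proof -
  define I where "I = (\<integral>\<^sup>+x. ennpowr (F x) p \<partial>\<rho>)"
  define \<gamma> where "\<gamma> = r / p - 1"
  have \<gamma>: "0 < \<gamma>" "\<gamma> + 1 = r / p" using p by (auto simp: \<gamma>_def field_simps)
  define C where "C = 1 / (1 - \<theta> powr \<gamma>) + 1 / (1 - \<theta>)"
  have "\<theta> powr \<gamma> < 1" using \<theta> \<gamma> by (intro powr_base_less_one) auto
  then have C: "0 < C" unfolding C_def using \<theta> by (intro add_pos_pos) auto
  note s = cell_measureD(1)[OF \<rho>]
  have mean_le: "ennpowr (nn_mean \<rho> F Q) p * emeasure \<rho> Q \<le> I" if "Q \<in> cells" for Q
  proof -
    have "(\<integral>\<^sup>+x\<in>Q. ennpowr (F x) p \<partial>\<rho>) \<le> I" unfolding I_def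
      by (intro nn_integral_mono) (auto simp: indicator_def)
    then show ?thesis using nn_mean_power_le[OF p(1) \<rho> that F] by simp
  qed
  consider "I = top" | "I = 0" | "0 < I" "I < top" by (metis less_top not_gr_zero)
  then show ?thesis
  proof cases
    case 1
    then show ?thesis using embedding_const_pos[OF p \<theta>] by (simp add: I_def ennreal_mult_top)
  next
    case 2
    have "nn_mean \<rho> F Q = 0" if "Q \<in> cells" for Q
      using mean_le[OF that] 2 cell_measureD(2)[OF \<rho> that] by auto
    then have "(\<integral>\<^sup>+Q. ennpowr (emeasure \<rho> Q) (r / p) * ennpowr (nn_mean \<rho> F Q) r \<partial>count_space cells) =
       (\<integral>\<^sup>+Q. 0 \<partial>count_space cells)" by (intro nn_integral_cong) auto
    then show ?thesis by simp
  next
    case 3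
    define i where "i = enn2real I"
    have i: "I = ennreal i" "0 < i" using 3 by (auto simp: i_def enn2real_positive_iff)
    have point: "(\<integral>\<^sup>+k. ennpowr (emeasure \<rho> (cell k x)) \<gamma> * ennpowr (nn_mean \<rho> F (cell k x)) r \<partial>count_space UNIV)
       \<le> ennreal C * ennpowr I \<gamma> * ennpowr (dyadic_max \<rho> F x) p" for x
    proof -
      consider "dyadic_max \<rho> F x = top" | "dyadic_max \<rho> F x = 0"
        | A where "dyadic_max \<rho> F x = ennreal A" "0 < A"
        by (cases "dyadic_max \<rho> F x") (auto simp: less_le)
      then show ?thesis
      proof cases
        case 1
        then show ?thesis using C 3 by (simp add: ennreal_mult_top)
      next
        case 2
        then have "nn_mean \<rho> F (cell k x) = 0" for k
          using nn_mean_le_dyadic_max[of "cell k x" x \<rho> F] by simp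
        then show ?thesis by simp
      next
        case 3
        define s where "s k = enn2real (emeasure \<rho> (cell k x))" for k
        define a where "a k = enn2real (nn_mean \<rho> F (cell k x))" for k
        have s: "emeasure \<rho> (cell k x) = ennreal (s k)" "0 < s k" for k
          using cell_measureD(2,3)[OF \<rho>, of "cell k x"] by (auto simp: s_def enn2real_positive_iff)
        have aA: "nn_mean \<rho> F (cell k x) \<le> ennreal A" for k
          using nn_mean_le_dyadic_max[of "cell k x" x \<rho> F] 3 by simp
        have a: "nn_mean \<rho> F (cell k x) = ennreal (a k)" "0 \<le> a k" for k
          using aA[of k] by (cases "nn_mean \<rho> F (cell k x)"; auto simp: a_def top_unique)+
        have ai: "a k powr p * s k \<le> i" for k
          using mean_le[of "cell k x"] i s[of k] a[of k]
          by (simp add: ennpowr_ennreal less_imp_le flip: ennreal_mult')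
        have dec: "s (k + 1) \<le> \<theta> * s k" for k
          using shrink[of k x] s \<theta> by (simp add: less_imp_le flip: ennreal_mult')
        have "(\<integral>\<^sup>+k. ennreal (s k powr (r / p - 1) * a k powr r) \<partial>count_space UNIV)
          \<le> ennreal ((1 / (1 - \<theta> powr (r / p - 1)) + 1 / (1 - \<theta>)) * (A powr p * i powr (r / p - 1)))"
        proof (rule two_regime_sum)
          show "a k \<le> A" for k using aA[of k] a[of k] 3 by (simp add: less_imp_le)
        qed (use s dec \<theta> p a ai 3 i in auto)
        also have "\<dots> = ennreal C * ennpowr I \<gamma> * ennpowr (dyadic_max \<rho> F x) p"
          unfolding C_def[symmetric] \<gamma>_def[symmetric] using C 3 i
          by (simp add: ennpowr_ennreal less_imp_le mult_ac flip: ennreal_mult')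
        finally show ?thesis
          using s a by (simp add: ennpowr_ennreal less_imp_le \<gamma>_def flip: ennreal_mult')
      qed
    qed
    have "(\<integral>\<^sup>+Q. ennpowr (emeasure \<rho> Q) (r / p) * ennpowr (nn_mean \<rho> F Q) r \<partial>count_space cells) =
       (\<integral>\<^sup>+Q. (ennpowr (emeasure \<rho> Q) \<gamma> * ennpowr (nn_mean \<rho> F Q) r) * (\<integral>\<^sup>+x\<in>Q. 1 \<partial>\<rho>) \<partial>count_space cells)"
    proof (intro nn_integral_cong)
      fix Q assume "Q \<in> space (count_space cells)"
      then have "Q \<in> sets \<rho>" using s cells_lebesgue by simp
      then show "ennpowr (emeasure \<rho> Q) (r / p) * ennpowr (nn_mean \<rho> F Q) r =
         (ennpowr (emeasure \<rho> Q) \<gamma> * ennpowr (nn_mean \<rho> F Q) r) * (\<integral>\<^sup>+x\<in>Q. 1 \<partial>\<rho>)"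
        using \<gamma> by (simp add: ennpowr_add mult_ac flip: \<gamma>(2))
    qed
    also have "\<dots> = (\<integral>\<^sup>+x. 1 * (\<integral>\<^sup>+k. ennpowr (emeasure \<rho> (cell k x)) \<gamma> * ennpowr (nn_mean \<rho> F (cell k x)) r \<partial>count_space UNIV) \<partial>\<rho>)"
      by (rule sum_over_cells[OF s]) simp
    also have "\<dots> \<le> (\<integral>\<^sup>+x. ennreal C * ennpowr I \<gamma> * ennpowr (dyadic_max \<rho> F x) p \<partial>\<rho>)"
      using point by (intro nn_integral_mono) simp
    also have "\<dots> = ennreal C * ennpowr I \<gamma> * (\<integral>\<^sup>+x. ennpowr (dyadic_max \<rho> F x) p \<partial>\<rho>)"
    proof (rule nn_integral_cmult)
      have [measurable]: "dyadic_max \<rho> F \<in> borel_measurable \<rho>" using s by (simp cong: measurable_cong_sets)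
      show "(\<lambda>x. ennpowr (dyadic_max \<rho> F x) p) \<in> borel_measurable \<rho>" by measurable
    qed
    also have "\<dots> \<le> ennreal C * ennpowr I \<gamma> * (ennreal (doob_const p) * I)"
      unfolding I_def by (intro mult_left_mono dyadic_max_strong_type p \<rho> F) simp
    also have "\<dots> = ennreal (C * doob_const p) * ennpowr I (\<gamma> + 1)"
    proof -
      have "ennpowr I (\<gamma> + 1) = ennpowr I \<gamma> * I" using ennpowr_add[OF \<gamma>(1), of 1 I] by simp
      then show ?thesis using C doob_const_pos[OF p(1)] by (simp add: ennreal_mult less_imp_le mult_ac)
    qed
    finally show ?thesis unfolding \<gamma>(2) unfolding embedding_const_def C_def \<gamma>_def I_def .
  qed
qed

end

section \<open>Muckenhoupt weights\<close>

text \<open>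
  The classical \<open>A\<^sub>s\<close> condition; the second average is that of the dual weight.
\<close>

definition muckenhoupt :: "real \<Rightarrow> real \<Rightarrow> ('a::euclidean_space \<Rightarrow> real) \<Rightarrow> bool"
  where "muckenhoupt s K w \<longleftrightarrow> w \<in> borel_measurable lebesgue \<and> (AE x in lebesgue. 0 < w x) \<and>
    (\<forall>Q\<in>cubes. nn_avg Q w * ennpowr (nn_avg Q (\<lambda>x. w x powr (- 1 / (s - 1)))) (s - 1) \<le> ennreal K)"

definition weighted :: "('a::euclidean_space \<Rightarrow> real) \<Rightarrow> 'a measure"
  where "weighted w = density lebesgue (\<lambda>x. ennreal (w x))"

lemma sets_weighted [simp, measurable_cong]: "sets (weighted w) = sets lebesgue"
  by (simp add: weighted_def)

lemma nn_integral_weighted: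
  "w \<in> borel_measurable lebesgue \<Longrightarrow> F \<in> borel_measurable lebesgue \<Longrightarrow>
    (\<integral>\<^sup>+x. F x \<partial>weighted w) = (\<integral>\<^sup>+x. F x * ennreal (w x) \<partial>lebesgue)"
  by (simp add: weighted_def nn_integral_density mult.commute)

lemma nn_set_integral_weighted:
  "w \<in> borel_measurable lebesgue \<Longrightarrow> F \<in> borel_measurable lebesgue \<Longrightarrow> Q \<in> sets lebesgue \<Longrightarrow>
    (\<integral>\<^sup>+x\<in>Q. F x \<partial>weighted w) = (\<integral>\<^sup>+x\<in>Q. F x * ennreal (w x) \<partial>lebesgue)"
  by (subst nn_integral_weighted) (auto simp: mult_ac)

lemma emeasure_weighted:
  "w \<in> borel_measurable lebesgue \<Longrightarrow> Q \<in> sets lebesgue \<Longrightarrow>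
    emeasure (weighted w) Q = (\<integral>\<^sup>+x\<in>Q. ennreal (w x) \<partial>lebesgue)"
  by (simp add: weighted_def emeasure_density)

lemma nn_set_integral_cong_set_AE:
  assumes "A \<in> sets M" "B \<in> sets M" "A - B \<in> null_sets M" "B - A \<in> null_sets M"
  shows "(\<integral>\<^sup>+x\<in>A. f x \<partial>M) = (\<integral>\<^sup>+x\<in>B. f x \<partial>M)"
proof (rule nn_integral_cong_AE)
  have "AE x in M. x \<notin> A - B" "AE x in M. x \<notin> B - A"
    using AE_not_in assms(3,4) by blast+
  then show "AE x in M. f x * indicator A x = f x * indicator B x"
    by eventually_elim (auto simp: indicator_def)
qed

lemma nn_set_integral_pos:
  assumes "w \<in> borel_measurable lebesgue" "AE x in lebesgue. 0 < w x"
    and "Q \<in> sets lebesgue" "0 < emeasure lebesgue Q"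
  shows "0 < (\<integral>\<^sup>+x\<in>Q. ennreal (w x) \<partial>lebesgue)"
proof (rule ccontr)
  assume "\<not> ?thesis"
  then have "AE x in lebesgue. ennreal (w x) * indicator Q x = 0"
    using assms by (subst (asm) not_gr_zero, subst (asm) nn_integral_0_iff_AE) auto
  with assms(2) have "AE x in lebesgue. x \<notin> Q"
    by eventually_elim (auto simp: indicator_def split: if_splits)
  then have "Q \<in> null_sets lebesgue" using assms(3) AE_iff_null_sets by blast
  then show False using assms(4) by auto
qed

text \<open>
  Raising the condition to the power \<open>1 / (s - 1)\<close> exchanges the roles of the weight and of its dual
  weight.
\<close>

lemma muckenhoupt_dual:
  fixes w :: "'a::euclidean_space \<Rightarrow> real"
  assumes w: "muckenhoupt s K w" and s: "1 < s" and K: "0 \<le> K"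
  shows "muckenhoupt (s / (s - 1)) (K powr (1 / (s - 1))) (\<lambda>x. w x powr (- 1 / (s - 1)))"
proof -
  have wm [measurable]: "w \<in> borel_measurable lebesgue" and wp: "AE x in lebesgue. 0 < w x"
    using w by (auto simp: muckenhoupt_def)
  have s': "s / (s - 1) - 1 = 1 / (s - 1)" using s by (simp add: field_simps)
  have e: "- 1 / (s - 1) * (- 1 / (1 / (s - 1))) = 1" using s by (simp add: divide_simps)
  have pw: "(w x powr (- 1 / (s - 1))) powr (- 1 / (s / (s - 1) - 1)) = w x" if "0 < w x" for x
    using that unfolding powr_powr s' e by simp
  have "nn_avg Q (\<lambda>x. w x powr (- 1 / (s - 1))) *
     ennpowr (nn_avg Q (\<lambda>x. (w x powr (- 1 / (s - 1))) powr (- 1 / (s / (s - 1) - 1)))) (s / (s - 1) - 1) \<le> ennreal (K powr (1 / (s - 1)))"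
    if Q: "Q \<in> cubes" for Q :: "'a set"
  proof -
    have 1: "nn_avg Q (\<lambda>x. (w x powr (- 1 / (s - 1))) powr (- 1 / (s / (s - 1) - 1))) = nn_avg Q w"
      unfolding nn_avg_def using wp
      by (intro arg_cong2[where f="(/)"] nn_integral_cong_AE refl, eventually_elim) (simp only: pw)
    have "ennpowr (nn_avg Q w * ennpowr (nn_avg Q (\<lambda>x. w x powr (- 1 / (s - 1)))) (s - 1)) (1 / (s - 1)) \<le> ennpowr (ennreal K) (1 / (s - 1))"
      using w Q s unfolding muckenhoupt_def by (intro ennpowr_mono) auto
    then show ?thesis unfolding 1 unfolding s' using s K by (simp add: ennpowr_mult ennpowr_ennpowr ennpowr_ennreal mult.commute)
  qed
  then show ?thesis unfolding muckenhoupt_def using wp by (auto elim: eventually_mono)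
qed

context dyadic_grid
begin

lemma cell_pos: "Q \<in> cells \<Longrightarrow> 0 < emeasure lebesgue Q" and cell_finite: "Q \<in> cells \<Longrightarrow> emeasure lebesgue Q < top"
  by (auto simp: cells_def emeasure_cell)

lemma nn_avg_cell:
  assumes "Q \<in> cells"
  shows "\<exists>R\<in>cubes. emeasure lebesgue R = emeasure lebesgue Q \<and>
     (\<forall>f. (\<integral>\<^sup>+x\<in>R. f x \<partial>lebesgue) = (\<integral>\<^sup>+x\<in>Q. f x \<partial>lebesgue))"
proof -
  obtain k x where Q: "Q = cell k x" using assms by (auto simp: cells_def)
  obtain R where R: "R \<in> cubes" "Q \<subseteq> R" "R - Q \<in> null_sets lebesgue" using cell_closed_cube Q by blast
  have m: "R \<in> sets lebesgue" "Q \<in> sets lebesgue" using R(1) Q by (auto simp: cubes_def)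
  have *: "(\<integral>\<^sup>+x\<in>R. f x \<partial>lebesgue) = (\<integral>\<^sup>+x\<in>Q. f x \<partial>lebesgue)" for f
    using R m by (intro nn_set_integral_cong_set_AE) (auto simp: Diff_eq_empty_iff[THEN iffD2])
  show ?thesis using R(1) * *[of "\<lambda>_. 1"] m by (intro bexI[of _ R]) auto
qed

lemma muckenhoupt_cell:
  assumes w: "muckenhoupt s K w" and s: "1 < s" and Q: "Q \<in> cells"
  shows "(\<integral>\<^sup>+x\<in>Q. ennreal (w x) \<partial>lebesgue) * ennpowr (\<integral>\<^sup>+x\<in>Q. ennreal (w x powr (- 1 / (s - 1))) \<partial>lebesgue) (s - 1)
     \<le> ennreal K * ennpowr (emeasure lebesgue Q) s" (is "?W * ennpowr ?V _ \<le> _ * ennpowr ?m s")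
proof -
  obtain R where R: "R \<in> cubes" "emeasure lebesgue R = ?m"
     "\<And>f. (\<integral>\<^sup>+x\<in>R. f x \<partial>lebesgue) = (\<integral>\<^sup>+x\<in>Q. f x \<partial>lebesgue)" using nn_avg_cell[OF Q] by blast
  have m: "0 < ?m" "?m < top" using Q cell_pos cell_finite by auto
  have "?W / ?m * ennpowr (?V / ?m) (s - 1) \<le> ennreal K"
    using w R(1) unfolding muckenhoupt_def nn_avg_def R(2)[symmetric] R(3)[symmetric] by blast
  then have "(?W / ?m * ennpowr (?V / ?m) (s - 1)) * (?m * ennpowr ?m (s - 1)) \<le> ennreal K * (?m * ennpowr ?m (s - 1))"
    by (rule mult_right_mono) simp
  moreover have "(?W / ?m * ennpowr (?V / ?m) (s - 1)) * (?m * ennpowr ?m (s - 1)) = (?W / ?m * ?m) * ennpowr (?V / ?m * ?m) (s - 1)"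
    using s by (simp add: ennpowr_mult mult_ac)
  moreover have "?m * ennpowr ?m (s - 1) = ennpowr ?m s"
    using ennpowr_add[of 1 "s - 1" ?m] s by simp
  ultimately show ?thesis using m by (simp add: ennreal_divide_mult_cancel)
qed

lemma muckenhoupt_measures:
  assumes w: "muckenhoupt s K w" and s: "1 < s"
  shows "cell_measure (weighted w)" "cell_measure (weighted (\<lambda>x. w x powr (- 1 / (s - 1))))"
proof -
  let ?v = "\<lambda>x. w x powr (- 1 / (s - 1))"
  have wm [measurable]: "w \<in> borel_measurable lebesgue" and wp: "AE x in lebesgue. 0 < w x"
    using w by (auto simp: muckenhoupt_def)
  have vp: "AE x in lebesgue. 0 < ?v x" using wp by eventually_elim auto
  have *: "0 < emeasure (weighted w) Q \<and> emeasure (weighted w) Q < top \<and> 0 < emeasure (weighted ?v) Q \<and> emeasure (weighted ?v) Q < top"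
    if Q: "Q \<in> cells" for Q
  proof -
    have Qm: "Q \<in> sets lebesgue" using Q cells_lebesgue by simp
    have "0 < emeasure (weighted w) Q" "0 < emeasure (weighted ?v) Q"
      using nn_set_integral_pos[OF wm wp Qm] nn_set_integral_pos[OF _ vp Qm] cell_pos[OF Q] Qm by (auto simp: emeasure_weighted)
    moreover have "emeasure (weighted w) Q * ennpowr (emeasure (weighted ?v) Q) (s - 1) < top"
    proof (rule le_less_trans)
      show "emeasure (weighted w) Q * ennpowr (emeasure (weighted ?v) Q) (s - 1) \<le> ennreal K * ennpowr (emeasure lebesgue Q) s"
        using muckenhoupt_cell[OF w s Q] by (simp add: emeasure_weighted Qm)
      show "ennreal K * ennpowr (emeasure lebesgue Q) s < top"
        using cell_finite[OF Q] unfolding less_top[symmetric] by (auto simp only: ennreal_mult_eq_top_iff ennpowr_eq_top_iff ennreal_neq_top)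
    qed
    ultimately show ?thesis
      unfolding less_top[symmetric] by (auto simp only: ennreal_mult_eq_top_iff ennpowr_eq_top_iff ennpowr_eq_0_iff zero_less_iff_neq_zero)
  qed
  then show "cell_measure (weighted w)" "cell_measure (weighted ?v)"
    by (auto simp: cell_measure_def)
qed

text \<open>
  Hoelder's inequality applied to \<open>1 = w powr (1 / s) * w powr (- 1 / s)\<close> on \<open>E\<close>. A large part of a cell
  therefore carries a fixed share of its weight.
\<close>

lemma muckenhoupt_A_infinity:
  assumes w: "muckenhoupt s K w" and s: "1 < s" and Q: "Q \<in> cells" and E: "E \<in> sets lebesgue" "E \<subseteq> Q"
  shows "ennpowr (emeasure lebesgue E) s * emeasure (weighted w) Q \<le>
    ennreal K * ennpowr (emeasure lebesgue Q) s * emeasure (weighted w) E"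
proof -
  let ?v = "\<lambda>x. w x powr (- 1 / (s - 1))"
  have wm [measurable]: "w \<in> borel_measurable lebesgue" and wp: "AE x in lebesgue. 0 < w x"
    using w by (auto simp: muckenhoupt_def)
  note E(1)[measurable]
  have Qm [measurable]: "Q \<in> sets lebesgue" using Q cells_lebesgue by simp
  define s' where "s' = s / (s - 1)"
  have s': "1 / s + 1 / s' = 1" "1 < s'" "1 / s' = (s - 1) / s" using s by (auto simp: s'_def field_simps)
  have "emeasure lebesgue E = (\<integral>\<^sup>+x\<in>E. 1 \<partial>lebesgue)" by simp
  also have "\<dots> = (\<integral>\<^sup>+x\<in>E. ennreal (w x powr (1 / s)) * ennreal (w x powr (- 1 / s)) \<partial>lebesgue)"
    using wp by (intro nn_integral_cong_AE, eventually_elim) (auto simp: powr_minus simp flip: ennreal_mult')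
  also have "\<dots> \<le> ennpowr (\<integral>\<^sup>+x\<in>E. ennpowr (ennreal (w x powr (1 / s))) s \<partial>lebesgue) (1 / s) *
      ennpowr (\<integral>\<^sup>+x\<in>E. ennpowr (ennreal (w x powr (- 1 / s))) s' \<partial>lebesgue) (1 / s')"
    using s s' by (intro nn_set_integral_Hoelder) auto
  also have "(\<integral>\<^sup>+x\<in>E. ennpowr (ennreal (w x powr (1 / s))) s \<partial>lebesgue) = emeasure (weighted w) E"
    unfolding emeasure_weighted[OF wm E(1)]
    using wp by (intro nn_integral_cong_AE, eventually_elim) (use s in \<open>auto simp: ennpowr_ennreal powr_powr\<close>)
  also have "(\<integral>\<^sup>+x\<in>E. ennpowr (ennreal (w x powr (- 1 / s))) s' \<partial>lebesgue) = emeasure (weighted ?v) E"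
  proof -
    have "- 1 / s * s' = - 1 / (s - 1)" using s by (simp add: s'_def)
    then show ?thesis
      by (subst emeasure_weighted) (auto simp: ennpowr_ennreal powr_powr)
  qed
  finally have "ennpowr (emeasure lebesgue E) s \<le>
     ennpowr (ennpowr (emeasure (weighted w) E) (1 / s) * ennpowr (emeasure (weighted ?v) E) (1 / s')) s"
    using s by (intro ennpowr_mono) auto
  also have "\<dots> = emeasure (weighted w) E * ennpowr (emeasure (weighted ?v) E) (s - 1)"
    using s s' by (simp add: ennpowr_mult ennpowr_ennpowr)
  also have "\<dots> \<le> emeasure (weighted w) E * ennpowr (emeasure (weighted ?v) Q) (s - 1)"
    using E s Qm by (intro mult_left_mono ennpowr_mono emeasure_mono) auto
  finally have "ennpowr (emeasure lebesgue E) s * emeasure (weighted w) Q \<le>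
      (emeasure (weighted w) E * ennpowr (emeasure (weighted ?v) Q) (s - 1)) * emeasure (weighted w) Q"
    by (rule mult_right_mono) simp
  also have "\<dots> = emeasure (weighted w) E * (emeasure (weighted w) Q * ennpowr (emeasure (weighted ?v) Q) (s - 1))"
    by (simp add: mult_ac)
  also have "\<dots> \<le> emeasure (weighted w) E * (ennreal K * ennpowr (emeasure lebesgue Q) s)"
    using muckenhoupt_cell[OF w s Q] Qm by (intro mult_left_mono) (auto simp: emeasure_weighted)
  finally show ?thesis by (simp add: mult_ac)
qed

lemma muckenhoupt_half:
  assumes w: "muckenhoupt s K w" and s: "1 < s" and K: "0 \<le> K" and Q: "Q \<in> cells" and E: "E \<in> sets lebesgue" "E \<subseteq> Q"
    and half: "emeasure lebesgue Q \<le> 2 * emeasure lebesgue E"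
  shows "emeasure (weighted w) Q \<le> ennreal (K * 2 powr s) * emeasure (weighted w) E"
proof -
  let ?m = "emeasure lebesgue Q"
  have "ennpowr ?m s * emeasure (weighted w) Q \<le> ennpowr (2 * emeasure lebesgue E) s * emeasure (weighted w) Q"
    using half s by (intro mult_right_mono ennpowr_mono) auto
  also have "\<dots> = ennreal (2 powr s) * (ennpowr (emeasure lebesgue E) s * emeasure (weighted w) Q)"
    using s ennpowr_ennreal[of 2 s] by (simp add: ennpowr_mult mult.assoc)
  also have "\<dots> \<le> ennreal (2 powr s) * (ennreal K * ennpowr ?m s * emeasure (weighted w) E)"
    by (intro mult_left_mono muckenhoupt_A_infinity[OF w s Q E]) simp
  finally have "ennpowr ?m s * emeasure (weighted w) Q \<le> ennpowr ?m s * (ennreal (K * 2 powr s) * emeasure (weighted w) E)"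
    using K by (simp add: ennreal_mult mult_ac)
  then show ?thesis
    using cell_pos[OF Q] cell_finite[OF Q] by (subst (asm) ennreal_mult_le_mult_iff) auto
qed

lemma emeasure_cell_Suc: "2 * emeasure lebesgue (cell (k + 1) x) \<le> emeasure lebesgue (cell k x)"
proof -
  have "2 * side (k + 1) ^ DIM('a) \<le> side k ^ DIM('a)"
    unfolding side_Suc using power_increasing[of 1 "DIM('a)" "2::real"]
    by (simp add: power_divide divide_simps DIM_ge_Suc0)
  then have "ennreal (2 * side (k + 1) ^ DIM('a)) \<le> ennreal (side k ^ DIM('a))" by (rule ennreal_leI)
  then show ?thesis by (simp add: emeasure_cell ennreal_mult less_imp_le)
qed

text \<open>
  The complement of a child in its parent has at least half of the Lebesgue measure, in any dimension, and
  so keeps a fixed share of the weight.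
\<close>

lemma muckenhoupt_shrink:
  assumes w: "muckenhoupt s K w" and s: "1 < s" and K: "1 \<le> K"
  shows "emeasure (weighted w) (cell (k + 1) x) \<le> ennreal (1 - 1 / (K * 2 powr s)) * emeasure (weighted w) (cell k x)"
proof -
  let ?P = "cell k x" and ?R = "cell (k + 1) x"
  let ?E = "?P - ?R"
  note cm = muckenhoupt_measures(1)[OF w s]
  define C where "C = K * 2 powr s"
  have C: "1 < C"
  proof -
    have "1 < 2 powr s" using s by simp
    then show ?thesis unfolding C_def using K by (metis less_1_mult less_eq_real_def mult_1)
  qed
  have E: "?E \<in> sets lebesgue" by auto
  have split: "emeasure \<rho> ?P = emeasure \<rho> ?R + emeasure \<rho> ?E" if "sets \<rho> = sets lebesgue" for \<rho>
  proof -
    have "?R \<union> ?E = ?P" using cell_Suc by blast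
    then show ?thesis using that plus_emeasure[of ?R \<rho> ?E] by auto
  qed
  have fin: "emeasure lebesgue ?R < top" by (simp add: emeasure_cell)
  have "emeasure lebesgue ?R \<le> emeasure lebesgue ?E"
  proof -
    have "emeasure lebesgue ?R + emeasure lebesgue ?R \<le> emeasure lebesgue ?R + emeasure lebesgue ?E"
      using emeasure_cell_Suc[of k x] split[of lebesgue] by (simp add: mult_2)
    then show ?thesis using fin by (auto simp: ennreal_add_left_cancel_le)
  qed
  then have "emeasure lebesgue ?P \<le> 2 * emeasure lebesgue ?E"
    using split[of lebesgue] by (simp add: mult_2 add_right_mono)
  then have *: "emeasure (weighted w) ?P \<le> ennreal C * emeasure (weighted w) ?E"
    unfolding C_def using K by (intro muckenhoupt_half[OF w s _ _ E]) auto
  define a where "a = enn2real (emeasure (weighted w) ?P)"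
  define b where "b = enn2real (emeasure (weighted w) ?R)"
  define c where "c = enn2real (emeasure (weighted w) ?E)"
  have sum: "emeasure (weighted w) ?P = emeasure (weighted w) ?R + emeasure (weighted w) ?E"
    by (rule split) simp
  have "emeasure (weighted w) ?P < top" using cell_measureD(3)[OF cm] by simp
  then have e: "emeasure (weighted w) ?P = ennreal a" "emeasure (weighted w) ?R = ennreal b" "emeasure (weighted w) ?E = ennreal c"
    using sum by (auto simp: a_def b_def c_def)
  have nn: "0 \<le> a" "0 \<le> b" "0 \<le> c" by (auto simp: a_def b_def c_def)
  have aC: "a \<le> C * c" using * nn C unfolding e by (simp flip: ennreal_mult')
  have abc: "a = b + c" using sum nn unfolding e by (simp flip: ennreal_plus)
  have "a / C \<le> c" using aC C by (simp add: divide_le_eq mult.commute)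
  moreover have "(1 - 1 / C) * a = a - a / C" by (simp add: left_diff_distrib)
  ultimately have b: "b \<le> (1 - 1 / C) * a" using abc by linarith
  have C': "0 \<le> 1 - 1 / C" using C by (simp add: field_simps)
  have "ennreal b \<le> ennreal ((1 - 1 / C) * a)" using b by (rule ennreal_leI)
  also have "\<dots> = ennreal (1 - 1 / C) * ennreal a" using C' nn(1) by (rule ennreal_mult)
  finally show ?thesis unfolding e C_def[symmetric] .
qed

text \<open>
  Lerner's argument: with \<open>v = w powr (- 1 / (p - 1))\<close> and \<open>F = f / v\<close>, the \<open>A\<^sub>p\<close> condition gives
  \<open>(M f)^{p-1} \<le> K M\<^sub>w ((M\<^sub>v F)^{p-1} / w)\<close> pointwise, where \<open>M\<^sub>w\<close> and \<open>M\<^sub>v\<close> average with respect to the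
  measures \<open>w dx\<close> and \<open>v dx\<close>. The universal bounds for these two maximal functions, on
  \<open>L^{p/(p-1)}(w)\<close> and on \<open>L^p(v)\<close>, finish the proof.
\<close>

theorem dyadic_max_weighted:
  assumes w: "muckenhoupt p K w" and p: "1 < p" and K: "0 \<le> K" and f: "f \<in> borel_measurable lebesgue"
  shows "(\<integral>\<^sup>+x. ennpowr (dyadic_max lebesgue f x) p * ennreal (w x) \<partial>lebesgue) \<le>
    ennreal (K powr (p / (p - 1)) * doob_const (p / (p - 1)) * doob_const p) * (\<integral>\<^sup>+x. ennpowr (f x) p * ennreal (w x) \<partial>lebesgue)"
proof -
  define v where "v x = w x powr (- 1 / (p - 1))" for x
  define p' where "p' = p / (p - 1)"
  have p': "1 < p'" "0 < p'" "(p - 1) * p' = p" using p by (auto simp: p'_def field_simps)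
  note f[measurable]
  have wm [measurable]: "w \<in> borel_measurable lebesgue" and wp: "AE x in lebesgue. 0 < w x"
    using w by (auto simp: muckenhoupt_def)
  have vm [measurable]: "v \<in> borel_measurable lebesgue" unfolding v_def by measurable
  note cw = muckenhoupt_measures(1)[OF w p] and cv = muckenhoupt_measures(2)[OF w p, folded v_def]
  define F where "F x = f x * ennreal (w x powr (1 / (p - 1)))" for x
  have Fm [measurable]: "F \<in> borel_measurable lebesgue" unfolding F_def by measurable
  define MF where "MF = dyadic_max (weighted v) F"
  have MFm [measurable]: "MF \<in> borel_measurable lebesgue" unfolding MF_def by measurable
  define H where "H x = ennpowr (MF x) (p - 1) * ennreal (1 / w x)" for x
  have Hm [measurable]: "H \<in> borel_measurable lebesgue" unfolding H_def by measurable
  have mean: "ennpowr (nn_mean lebesgue f Q) (p - 1) \<le> ennreal K * nn_mean (weighted w) H Q" if Q: "Q \<in> cells" for Q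
  proof -
    let ?m = "emeasure lebesgue Q" and ?w = "emeasure (weighted w) Q" and ?v = "emeasure (weighted v) Q"
    let ?a = "nn_mean (weighted v) F Q"
    have Qm [measurable]: "Q \<in> sets lebesgue" using Q cells_lebesgue by simp
    have "(\<integral>\<^sup>+x\<in>Q. f x \<partial>lebesgue) = (\<integral>\<^sup>+x\<in>Q. F x * ennreal (v x) \<partial>lebesgue)"
      using wp by (intro nn_integral_cong_AE, eventually_elim)
        (auto simp: F_def v_def mult.assoc powr_minus simp flip: ennreal_mult' powr_add)
    also have "\<dots> = ?a * ?v"
      by (simp add: nn_set_integral_weighted[symmetric] nn_mean_mult[OF cv Q])
    finally have fv: "nn_mean lebesgue f Q * ?m = ?a * ?v" using nn_mean_mult[OF cell_measure_lebesgue Q] by simp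
    have "ennpowr ?a (p - 1) * ?m = (\<integral>\<^sup>+x\<in>Q. ennpowr ?a (p - 1) \<partial>lebesgue)"
      by (simp add: nn_integral_cmult_indicator)
    also have "\<dots> \<le> (\<integral>\<^sup>+x\<in>Q. ennpowr (MF x) (p - 1) \<partial>lebesgue)"
      using p Q by (intro nn_integral_mono) (auto simp: indicator_def MF_def intro!: ennpowr_mono nn_mean_le_dyadic_max)
    also have "\<dots> = (\<integral>\<^sup>+x\<in>Q. H x * ennreal (w x) \<partial>lebesgue)"
      using wp by (intro nn_integral_cong_AE, eventually_elim) (auto simp: H_def mult.assoc simp flip: ennreal_mult')
    also have "\<dots> = nn_mean (weighted w) H Q * ?w"
      by (simp add: nn_set_integral_weighted[symmetric] nn_mean_mult[OF cw Q])
    finally have am: "ennpowr ?a (p - 1) * ?m \<le> nn_mean (weighted w) H Q * ?w" .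
    have Ap: "?w * ennpowr ?v (p - 1) \<le> ennreal K * ennpowr ?m p"
      using muckenhoupt_cell[OF w p Q] by (simp add: emeasure_weighted v_def)
    have "(ennpowr ?m p * ?w) * ennpowr (nn_mean lebesgue f Q) (p - 1) = ennpowr (nn_mean lebesgue f Q * ?m) (p - 1) * (?m * ?w)"
      using p ennpowr_add[of "p - 1" 1 ?m] by (simp add: ennpowr_mult mult_ac)
    also have "\<dots> = ennpowr ?a (p - 1) * ?m * (?w * ennpowr ?v (p - 1))"
      unfolding fv using p by (simp add: ennpowr_mult mult_ac)
    also have "\<dots> \<le> nn_mean (weighted w) H Q * ?w * (ennreal K * ennpowr ?m p)"
      by (intro mult_mono am Ap) auto
    finally have "(ennpowr ?m p * ?w) * ennpowr (nn_mean lebesgue f Q) (p - 1) \<le> (ennpowr ?m p * ?w) * (ennreal K * nn_mean (weighted w) H Q)"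
      by (simp add: mult_ac)
    moreover have "0 < ennpowr ?m p * ?w" "ennpowr ?m p * ?w < top"
      using cell_pos[OF Q] cell_finite[OF Q] cell_measureD(2,3)[OF cw Q]
      by (auto simp: zero_less_iff_neq_zero ennreal_mult_eq_top_iff less_top[symmetric] simp del: emeasure_completion)
    ultimately show ?thesis by (subst (asm) ennreal_mult_le_mult_iff) auto
  qed
  have point: "ennpowr (dyadic_max lebesgue f x) p \<le> ennreal (K powr p') * ennpowr (dyadic_max (weighted w) H x) p'" for x
  proof -
    have "ennpowr (dyadic_max lebesgue f x) (p - 1) \<le> ennreal K * dyadic_max (weighted w) H x"
      unfolding dyadic_max_def[of lebesgue] using p
      by (subst ennpowr_SUP) (auto intro!: SUP_least order_trans[OF mean] mult_left_mono nn_mean_le_dyadic_max)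
    then have "ennpowr (ennpowr (dyadic_max lebesgue f x) (p - 1)) p' \<le> ennpowr (ennreal K * dyadic_max (weighted w) H x) p'"
      using p' by (intro ennpowr_mono) auto
    then show ?thesis using p p' K by (simp add: ennpowr_ennpowr ennpowr_mult ennpowr_ennreal)
  qed
  have "(\<integral>\<^sup>+x. ennpowr (dyadic_max lebesgue f x) p * ennreal (w x) \<partial>lebesgue) \<le>
     (\<integral>\<^sup>+x. ennreal (K powr p') * (ennpowr (dyadic_max (weighted w) H x) p' * ennreal (w x)) \<partial>lebesgue)"
    unfolding mult.assoc[symmetric] by (intro nn_integral_mono mult_right_mono point) simp
  also have "\<dots> = ennreal (K powr p') * (\<integral>\<^sup>+x. ennpowr (dyadic_max (weighted w) H x) p' \<partial>weighted w)"
    by (simp add: nn_integral_cmult nn_integral_weighted)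
  also have "\<dots> \<le> ennreal (K powr p') * (ennreal (doob_const p') * (\<integral>\<^sup>+x. ennpowr (H x) p' \<partial>weighted w))"
    by (intro mult_left_mono dyadic_max_strong_type p' cw Hm) simp
  also have "(\<integral>\<^sup>+x. ennpowr (H x) p' \<partial>weighted w) = (\<integral>\<^sup>+x. ennpowr (MF x) p \<partial>weighted v)"
  proof -
    have "(\<integral>\<^sup>+x. ennpowr (H x) p' \<partial>weighted w) = (\<integral>\<^sup>+x. ennpowr (H x) p' * ennreal (w x) \<partial>lebesgue)"
      by (simp add: nn_integral_weighted)
    also have "\<dots> = (\<integral>\<^sup>+x. ennpowr (MF x) p * ennreal (v x) \<partial>lebesgue)"
      using wp
    proof (intro nn_integral_cong_AE, eventually_elim)
      case (elim x)
      have "(1 / w x) powr p' * w x = v x"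
      proof -
        have "(1 / w x) powr p' * w x = w x powr (- p' + 1)"
          using elim by (simp add: powr_diff powr_divide)
        moreover have "- p' + 1 = - 1 / (p - 1)" using p by (simp add: p'_def field_simps)
        ultimately show ?thesis by (simp add: v_def)
      qed
      then have "ennreal ((1 / w x) powr p') * ennreal (w x) = ennreal (v x)"
        by (simp add: ennreal_mult'[symmetric])
      then show ?case using p p' elim
        by (simp add: H_def ennpowr_mult ennpowr_ennpowr ennpowr_ennreal mult.assoc)
    qed
    also have "\<dots> = (\<integral>\<^sup>+x. ennpowr (MF x) p \<partial>weighted v)" by (simp add: nn_integral_weighted)
    finally show ?thesis .
  qed
  also have "ennreal (K powr p') * (ennreal (doob_const p') * (\<integral>\<^sup>+x. ennpowr (MF x) p \<partial>weighted v)) \<le>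
     ennreal (K powr p') * (ennreal (doob_const p') * (ennreal (doob_const p) * (\<integral>\<^sup>+x. ennpowr (F x) p \<partial>weighted v)))"
    unfolding MF_def by (intro mult_left_mono dyadic_max_strong_type p cv Fm) auto
  also have "(\<integral>\<^sup>+x. ennpowr (F x) p \<partial>weighted v) = (\<integral>\<^sup>+x. ennpowr (f x) p * ennreal (w x) \<partial>lebesgue)"
  proof -
    have "(\<integral>\<^sup>+x. ennpowr (F x) p \<partial>weighted v) = (\<integral>\<^sup>+x. ennpowr (F x) p * ennreal (v x) \<partial>lebesgue)"
      by (simp add: nn_integral_weighted)
    also have "\<dots> = (\<integral>\<^sup>+x. ennpowr (f x) p * ennreal (w x) \<partial>lebesgue)"
      using wp
    proof (intro nn_integral_cong_AE, eventually_elim)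
      case (elim x)
      have "(w x powr (1 / (p - 1))) powr p * v x = w x"
      proof -
        have "(w x powr (1 / (p - 1))) powr p * v x = w x powr (1 / (p - 1) * p + - 1 / (p - 1))"
          by (simp add: powr_powr v_def powr_add[symmetric])
        also have "1 / (p - 1) * p + - 1 / (p - 1) = (p - 1) / (p - 1)" by (simp flip: diff_divide_distrib)
        also have "\<dots> = 1" using p by simp
        finally show ?thesis using elim by simp
      qed
      then have "ennreal ((w x powr (1 / (p - 1))) powr p) * ennreal (v x) = ennreal (w x)"
        by (simp add: ennreal_mult'[symmetric])
      then show ?case using p elim
        by (simp add: F_def ennpowr_mult ennpowr_ennreal mult.assoc)
    qed
    finally show ?thesis .
  qed
  also have "ennreal (K powr p') * (ennreal (doob_const p') * (ennreal (doob_const p) * X)) =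
      ennreal (K powr p' * doob_const p' * doob_const p) * X" for X
    using doob_const_pos[OF p] doob_const_pos[OF p'(1)] by (simp add: ennreal_mult mult.assoc)
  finally show ?thesis unfolding p'_def .
qed

end

section \<open>The bilinear form of the fractional integral\<close>

definition frac_form_const :: "real \<Rightarrow> real \<Rightarrow> real \<Rightarrow> real"
  where "frac_form_const p q K =
    (let s = 1 + q * (p - 1) / p; r = (p + q) / 2; K' = K powr (1 / (s - 1)) in
     K powr (1 / q)
     * embedding_const p r (1 - 1 / (K' * 2 powr (s / (s - 1)))) powr (1 / r)
     * embedding_const (q / (q - 1)) (r / (r - 1)) (1 - 1 / (K * 2 powr s)) powr ((r - 1) / r))"

context dyadic_grid
begin

definition frac_form :: "real \<Rightarrow> ('a \<Rightarrow> ennreal) \<Rightarrow> ('a \<Rightarrow> ennreal) \<Rightarrow> ennreal"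
  where "frac_form c f g = (\<integral>\<^sup>+Q. ennreal (measure lebesgue Q powr c) *
    ((\<integral>\<^sup>+x\<in>Q. f x \<partial>lebesgue) * (\<integral>\<^sup>+x\<in>Q. g x \<partial>lebesgue)) \<partial>count_space cells)"

text \<open>
  Both weights \<open>u = lam powr q\<close> and \<open>v = lam powr (- p')\<close> shrink from cells to children, so
  \<open>off_diagonal_embedding\<close> applies to either factor once Hoelder's inequality is used with exponents \<open>r\<close>
  and \<open>r'\<close> satisfying \<open>p < r\<close> and \<open>q' < r'\<close>. Any \<open>r\<close> between \<open>p\<close> and \<open>q\<close> has this property; the midpoint
  is taken.
\<close>

theorem frac_form_bound:
  fixes lam :: "'a \<Rightarrow> real"
  assumes p: "1 < p" "p < q" and K: "1 \<le> K"
    and lm [measurable]: "lam \<in> borel_measurable lebesgue" and lp: "AE x in lebesgue. 0 < lam x"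
    and w: "muckenhoupt (1 + q * (p - 1) / p) K (\<lambda>x. lam x powr q)"
    and [measurable]: "f \<in> borel_measurable lebesgue" "g \<in> borel_measurable lebesgue"
  shows "frac_form (1 / p - 1 / q - 1) f g \<le> ennreal (frac_form_const p q K) *
    (ennpowr (\<integral>\<^sup>+x. ennpowr (f x) p * ennreal (lam x powr p) \<partial>lebesgue) (1 / p) *
     ennpowr (\<integral>\<^sup>+x. ennpowr (g x) (q / (q - 1)) * ennreal (lam x powr (- (q / (q - 1)))) \<partial>lebesgue) (1 / (q / (q - 1))))"
proof -
  define p' where "p' = p / (p - 1)"
  define q' where "q' = q / (q - 1)"
  define s where "s = 1 + q * (p - 1) / p"
  define s' where "s' = s / (s - 1)"
  define r where "r = (p + q) / 2"
  define r' where "r' = r / (r - 1)"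
  define c where "c = 1 / p - 1 / q - 1"
  define K' where "K' = K powr (1 / (s - 1))"
  define \<theta> where "\<theta> = 1 - 1 / (K * 2 powr s)"
  define \<theta>' where "\<theta>' = 1 - 1 / (K' * 2 powr s')"
  define u where "u x = lam x powr q" for x
  define v where "v x = u x powr (- 1 / (s - 1))" for x
  have s: "1 < s" "s - 1 = q * (p - 1) / p" using p by (auto simp: s_def)
  have s': "1 < s'" unfolding s'_def using s(1) by (simp add: less_divide_eq)
  have r: "p < r" "r < q" "1 < r" using p by (auto simp: r_def)
  have q': "1 < q'" "0 < q'" using p by (auto simp: q'_def field_simps)
  have r': "q' < r'" "1 / r + 1 / r' = 1" "1 / r' = (r - 1) / r" using p r by (auto simp: q'_def r'_def field_simps)
  have exps: "1 / p' + 1 / p = 1" "1 / q + 1 / q' = 1" "0 < p'" "(s - 1) * (1 / q) = 1 / p'" "s * (1 / q) = - c" "- c = 1 / q + 1 / p'"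
    using p s by (auto simp: p'_def q'_def c_def s_def field_simps)
  have K': "1 \<le> K'" unfolding K'_def using K s(1) by (intro ge_one_powr_ge_zero) auto
  have \<theta>: "0 < \<theta>" "\<theta> < 1" and \<theta>': "0 < \<theta>'" "\<theta>' < 1"
  proof -
    have "1 * 1 < K * 2 powr s" "1 * 1 < K' * 2 powr s'"
      using K K' s s' by (intro mult_le_less_imp_less; simp)+
    then show "0 < \<theta>" "\<theta> < 1" "0 < \<theta>'" "\<theta>' < 1" by (auto simp: \<theta>_def \<theta>'_def)
  qed
  have um [measurable]: "u \<in> borel_measurable lebesgue" unfolding u_def by measurable
  have vm [measurable]: "v \<in> borel_measurable lebesgue" unfolding v_def by measurable
  have wu: "muckenhoupt s K u" using w unfolding s_def u_def .
  have wv: "muckenhoupt s' K' v" unfolding s'_def K'_def v_def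
    using muckenhoupt_dual[OF wu s(1)] K by simp
  note cu = muckenhoupt_measures(1)[OF wu s(1)] and cv = muckenhoupt_measures(1)[OF wv s'(1)]
  have vl: "v x = lam x powr (- p')" if "0 < lam x" for x
  proof -
    have "q * (- 1 / (s - 1)) = - p'" using p s by (simp add: p'_def field_simps)
    then show ?thesis unfolding v_def u_def powr_powr by simp
  qed
  define F where "F x = f x * ennreal (lam x powr p')" for x
  define G where "G x = g x * ennreal (lam x powr (- q))" for x
  have Fm [measurable]: "F \<in> borel_measurable lebesgue" unfolding F_def by measurable
  have Gm [measurable]: "G \<in> borel_measurable lebesgue" unfolding G_def by measurable
  let ?a = "\<lambda>Q. nn_mean (weighted v) F Q" and ?b = "\<lambda>Q. nn_mean (weighted u) G Q"
  let ?s = "\<lambda>Q. emeasure (weighted v) Q" and ?u = "\<lambda>Q. emeasure (weighted u) Q"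
  have term_le: "ennreal (measure lebesgue Q powr c) * ((\<integral>\<^sup>+x\<in>Q. f x \<partial>lebesgue) * (\<integral>\<^sup>+x\<in>Q. g x \<partial>lebesgue)) \<le>
     ennreal (K powr (1 / q)) * ((ennpowr (?s Q) (1 / p) * ?a Q) * (ennpowr (?u Q) (1 / q') * ?b Q))"
    if Q: "Q \<in> cells" for Q
  proof -
    have Qm [measurable]: "Q \<in> sets lebesgue" using Q cells_lebesgue by simp
    define m where "m = measure lebesgue Q"
    have m: "emeasure lebesgue Q = ennreal m" "0 < m"
      using cell_pos[OF Q] cell_finite[OF Q] by (auto simp: m_def emeasure_eq_ennreal_measure less_top)
    have "(\<integral>\<^sup>+x\<in>Q. f x \<partial>lebesgue) = (\<integral>\<^sup>+x\<in>Q. F x * ennreal (v x) \<partial>lebesgue)"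
      using lp
    proof (intro nn_integral_cong_AE, eventually_elim)
      case (elim x)
      have "ennreal (lam x powr p') * ennreal (v x) = 1"
        using elim by (simp add: vl powr_minus ennreal_mult'[symmetric])
      then show ?case by (simp add: F_def mult.assoc)
    qed
    also have "\<dots> = ?a Q * ?s Q"
      by (simp add: nn_set_integral_weighted[symmetric] nn_mean_mult[OF cv Q])
    finally have fI: "(\<integral>\<^sup>+x\<in>Q. f x \<partial>lebesgue) = ?a Q * ?s Q" .
    have "(\<integral>\<^sup>+x\<in>Q. g x \<partial>lebesgue) = (\<integral>\<^sup>+x\<in>Q. G x * ennreal (u x) \<partial>lebesgue)"
      using lp
    proof (intro nn_integral_cong_AE, eventually_elim)
      case (elim x)
      have "ennreal (lam x powr (- q)) * ennreal (u x) = 1"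
        using elim by (simp add: u_def powr_minus ennreal_mult'[symmetric])
      then show ?case by (simp add: G_def mult.assoc)
    qed
    also have "\<dots> = ?b Q * ?u Q"
      by (simp add: nn_set_integral_weighted[symmetric] nn_mean_mult[OF cu Q])
    finally have gI: "(\<integral>\<^sup>+x\<in>Q. g x \<partial>lebesgue) = ?b Q * ?u Q" .
    have "ennpowr (?u Q * ennpowr (?s Q) (s - 1)) (1 / q) \<le> ennpowr (ennreal K * ennpowr (ennreal m) s) (1 / q)"
      using muckenhoupt_cell[OF wu s(1) Q] p m
      by (intro ennpowr_mono) (auto simp: emeasure_weighted v_def)
    then have Kb: "ennpowr (?u Q) (1 / q) * ennpowr (?s Q) (1 / p') \<le> ennreal (K powr (1 / q)) * ennreal (m powr (- c))"
      using p s exps(4,5) K m by (simp add: ennpowr_mult ennpowr_ennpowr ennpowr_ennreal powr_powr)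
    have su: "?s Q = ennpowr (?s Q) (1 / p') * ennpowr (?s Q) (1 / p)"
      using ennpowr_add[of "1 / p'" "1 / p" "?s Q"] exps p by simp
    have uu: "?u Q = ennpowr (?u Q) (1 / q) * ennpowr (?u Q) (1 / q')"
      using ennpowr_add[of "1 / q" "1 / q'" "?u Q"] exps p q' by simp
    have "ennreal (m powr c) * (ennpowr (?u Q) (1 / q) * ennpowr (?s Q) (1 / p')) \<le>
       ennreal (m powr c) * (ennreal (K powr (1 / q)) * ennreal (m powr (- c)))"
      by (intro mult_left_mono Kb) simp
    also have "\<dots> = ennreal (K powr (1 / q))"
      using m by (simp add: powr_minus ennreal_mult'[symmetric])
    finally have 1: "ennreal (m powr c) * (ennpowr (?u Q) (1 / q) * ennpowr (?s Q) (1 / p')) \<le> ennreal (K powr (1 / q))" .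
    have "ennreal (m powr c) * ((?a Q * ?s Q) * (?b Q * ?u Q)) =
      (ennreal (m powr c) * (ennpowr (?u Q) (1 / q) * ennpowr (?s Q) (1 / p'))) *
        ((ennpowr (?s Q) (1 / p) * ?a Q) * (ennpowr (?u Q) (1 / q') * ?b Q))"
      by (subst su, subst uu) (simp only: mult_ac)
    also have "\<dots> \<le> ennreal (K powr (1 / q)) * ((ennpowr (?s Q) (1 / p) * ?a Q) * (ennpowr (?u Q) (1 / q') * ?b Q))"
      by (intro mult_right_mono 1) simp
    finally show ?thesis unfolding fI gI m_def .
  qed
  have emb: "ennpowr (\<integral>\<^sup>+Q. ennpowr (ennpowr (emeasure \<rho> Q) (1 / t) * nn_mean \<rho> H Q) \<tau> \<partial>count_space cells) (1 / \<tau>) \<le>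
      ennreal (embedding_const t \<tau> \<eta> powr (1 / \<tau>)) * ennpowr (\<integral>\<^sup>+x. ennpowr (H x) t \<partial>\<rho>) (1 / t)"
    if "1 < t" "t < \<tau>" "0 < \<eta>" "\<eta> < 1" "cell_measure \<rho>" "H \<in> borel_measurable lebesgue"
      "\<And>k x. emeasure \<rho> (cell (k + 1) x) \<le> ennreal \<eta> * emeasure \<rho> (cell k x)" for \<rho> H t \<tau> \<eta>
  proof -
    have "(\<integral>\<^sup>+Q. ennpowr (ennpowr (emeasure \<rho> Q) (1 / t) * nn_mean \<rho> H Q) \<tau> \<partial>count_space cells) =
        (\<integral>\<^sup>+Q. ennpowr (emeasure \<rho> Q) (\<tau> / t) * ennpowr (nn_mean \<rho> H Q) \<tau> \<partial>count_space cells)"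
      using that by (simp add: ennpowr_mult ennpowr_ennpowr)
    also have "\<dots> \<le> ennreal (embedding_const t \<tau> \<eta>) * ennpowr (\<integral>\<^sup>+x. ennpowr (H x) t \<partial>\<rho>) (\<tau> / t)"
      using that by (intro off_diagonal_embedding)
    finally have "ennpowr (\<integral>\<^sup>+Q. ennpowr (ennpowr (emeasure \<rho> Q) (1 / t) * nn_mean \<rho> H Q) \<tau> \<partial>count_space cells) (1 / \<tau>) \<le>
       ennpowr (ennreal (embedding_const t \<tau> \<eta>) * ennpowr (\<integral>\<^sup>+x. ennpowr (H x) t \<partial>\<rho>) (\<tau> / t)) (1 / \<tau>)"
      using that by (intro ennpowr_mono) auto
    then show ?thesis using that embedding_const_pos[of t \<tau> \<eta>]
      by (simp add: ennpowr_mult ennpowr_ennpowr ennpowr_ennreal less_imp_le)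
  qed
  have embF: "ennpowr (\<integral>\<^sup>+Q. ennpowr (ennpowr (?s Q) (1 / p) * ?a Q) r \<partial>count_space cells) (1 / r) \<le>
      ennreal (embedding_const p r \<theta>' powr (1 / r)) * ennpowr (\<integral>\<^sup>+x. ennpowr (F x) p \<partial>weighted v) (1 / p)"
    using p r \<theta>' cv by (intro emb) (auto simp: \<theta>'_def intro!: muckenhoupt_shrink[OF wv s' K'])
  have embG: "ennpowr (\<integral>\<^sup>+Q. ennpowr (ennpowr (?u Q) (1 / q') * ?b Q) r' \<partial>count_space cells) (1 / r') \<le>
      ennreal (embedding_const q' r' \<theta> powr (1 / r')) * ennpowr (\<integral>\<^sup>+x. ennpowr (G x) q' \<partial>weighted u) (1 / q')"
    using q' r' \<theta> cu by (intro emb) (auto simp: \<theta>_def intro!: muckenhoupt_shrink[OF wu s(1) K])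
  have NF: "(\<integral>\<^sup>+x. ennpowr (F x) p \<partial>weighted v) = (\<integral>\<^sup>+x. ennpowr (f x) p * ennreal (lam x powr p) \<partial>lebesgue)"
  proof -
    have "(\<integral>\<^sup>+x. ennpowr (F x) p \<partial>weighted v) = (\<integral>\<^sup>+x. ennpowr (F x) p * ennreal (v x) \<partial>lebesgue)"
      by (simp add: nn_integral_weighted)
    also have "\<dots> = (\<integral>\<^sup>+x. ennpowr (f x) p * ennreal (lam x powr p) \<partial>lebesgue)"
      using lp
    proof (intro nn_integral_cong_AE, eventually_elim)
      case (elim x)
      have "p' * (p - 1) = p" using p by (simp add: p'_def)
      then have "p' * p + - p' = p" by (simp add: algebra_simps)
      then have "lam x powr (p' * p) * v x = lam x powr p"
        unfolding vl[OF elim(2)] powr_add[symmetric] by simp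
      then have "ennreal (lam x powr (p' * p)) * ennreal (v x) = ennreal (lam x powr p)"
        by (simp add: ennreal_mult'[symmetric])
      then show ?case using p by (simp add: F_def ennpowr_mult ennpowr_ennreal powr_powr mult.assoc)
    qed
    finally show ?thesis .
  qed
  have NG: "(\<integral>\<^sup>+x. ennpowr (G x) q' \<partial>weighted u) = (\<integral>\<^sup>+x. ennpowr (g x) q' * ennreal (lam x powr (- q')) \<partial>lebesgue)"
  proof -
    have "(\<integral>\<^sup>+x. ennpowr (G x) q' \<partial>weighted u) = (\<integral>\<^sup>+x. ennpowr (G x) q' * ennreal (u x) \<partial>lebesgue)"
      by (simp add: nn_integral_weighted)
    also have "\<dots> = (\<integral>\<^sup>+x. ennpowr (g x) q' * ennreal (lam x powr (- q')) \<partial>lebesgue)"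
      using lp
    proof (intro nn_integral_cong_AE, eventually_elim)
      case (elim x)
      have "q' * (q - 1) = q" using p by (simp add: q'_def)
      then have "- q * q' + q = - q'" by (simp add: algebra_simps)
      then have "lam x powr (- q * q') * u x = lam x powr (- q')"
        unfolding u_def powr_add[symmetric] by simp
      then have "ennreal (lam x powr (- q * q')) * ennreal (u x) = ennreal (lam x powr (- q'))"
        by (simp add: ennreal_mult'[symmetric])
      then show ?case using q' by (simp add: G_def ennpowr_mult ennpowr_ennreal powr_powr mult.assoc)
    qed
    finally show ?thesis .
  qed
  have "frac_form c f g \<le> (\<integral>\<^sup>+Q. ennreal (K powr (1 / q)) * ((ennpowr (?s Q) (1 / p) * ?a Q) * (ennpowr (?u Q) (1 / q') * ?b Q)) \<partial>count_space cells)"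
    unfolding frac_form_def by (intro nn_integral_mono term_le) simp
  also have "\<dots> = ennreal (K powr (1 / q)) * (\<integral>\<^sup>+Q. (ennpowr (?s Q) (1 / p) * ?a Q) * (ennpowr (?u Q) (1 / q') * ?b Q) \<partial>count_space cells)"
    by (rule nn_integral_cmult) simp
  also have "\<dots> \<le> ennreal (K powr (1 / q)) *
     (ennpowr (\<integral>\<^sup>+Q. ennpowr (ennpowr (?s Q) (1 / p) * ?a Q) r \<partial>count_space cells) (1 / r) *
      ennpowr (\<integral>\<^sup>+Q. ennpowr (ennpowr (?u Q) (1 / q') * ?b Q) r' \<partial>count_space cells) (1 / r'))"
    using r r' by (intro mult_left_mono nn_integral_Hoelder) auto
  also have "\<dots> \<le> ennreal (K powr (1 / q)) *
     ((ennreal (embedding_const p r \<theta>' powr (1 / r)) * ennpowr (\<integral>\<^sup>+x. ennpowr (F x) p \<partial>weighted v) (1 / p)) *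
      (ennreal (embedding_const q' r' \<theta> powr (1 / r')) * ennpowr (\<integral>\<^sup>+x. ennpowr (G x) q' \<partial>weighted u) (1 / q')))"
    by (intro mult_left_mono mult_mono embF embG) auto
  also have "\<dots> = ennreal (K powr (1 / q) * embedding_const p r \<theta>' powr (1 / r) * embedding_const q' r' \<theta> powr (1 / r')) *
     (ennpowr (\<integral>\<^sup>+x. ennpowr (F x) p \<partial>weighted v) (1 / p) * ennpowr (\<integral>\<^sup>+x. ennpowr (G x) q' \<partial>weighted u) (1 / q'))"
    by (simp add: ennreal_mult mult_ac)
  finally show ?thesis
    unfolding NF NG c_def[symmetric] q'_def[symmetric] frac_form_const_def Let_def
      s_def[symmetric] r_def[symmetric] K'_def[symmetric] s'_def[symmetric] r'_def[symmetric] \<theta>_def[symmetric] \<theta>'_def[symmetric]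
      r'(3)[symmetric] .
qed

end

section \<open>Averages and mean oscillation\<close>

lemma loc_integrable_measurable:
  fixes b :: "'a::euclidean_space \<Rightarrow> 'b::{banach, second_countable_topology}"
  assumes "loc_integrable b"
  shows "b \<in> borel_measurable lebesgue"
proof (rule borel_measurable_LIMSEQ_metric)
  fix i :: nat
  have "set_integrable lebesgue (cball 0 (real i)) b"
    using assms by (auto simp: loc_integrable_def)
  then show "(\<lambda>x. indicator (cball 0 (real i)) x *\<^sub>R b x) \<in> borel_measurable lebesgue"
    unfolding set_integrable_def by (rule borel_measurable_integrable)
next
  fix x :: 'a
  obtain N :: nat where N: "norm x \<le> real N" using real_arch_simple by blast
  have "eventually (\<lambda>i. indicator (cball 0 (real i)) x *\<^sub>R b x = b x) sequentially"
    unfolding eventually_sequentially using N by (intro exI[of _ N]) (auto simp: indicator_def)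
  then show "(\<lambda>i. indicator (cball 0 (real i)) x *\<^sub>R b x) \<longlonglongrightarrow> b x"
    by (rule tendsto_eventually)
qed

lemma norm_avg_minus_le:
  fixes b :: "'a::euclidean_space \<Rightarrow> 'b::{banach, second_countable_topology}"
  assumes b: "set_integrable lebesgue R b" and R: "R \<in> sets lebesgue" "0 < emeasure lebesgue R" "emeasure lebesgue R < top"
  shows "ennreal (norm (avg R b - c)) * emeasure lebesgue R \<le> (\<integral>\<^sup>+x\<in>R. ennreal (norm (b x - c)) \<partial>lebesgue)"
proof -
  define m where "m = measure lebesgue R"
  have m: "emeasure lebesgue R = ennreal m" "0 < m"
    using R by (auto simp: m_def emeasure_eq_ennreal_measure less_top)
  have ci: "set_integrable lebesgue R (\<lambda>_. c)"
    using R by (simp add: set_integrable_def less_top)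
  have bc: "set_integrable lebesgue R (\<lambda>x. b x - c)" using b ci by (rule set_integral_diff(1))
  have "(LINT x:R|lebesgue. b x - c) = (LINT x:R|lebesgue. b x) - m *\<^sub>R c"
    using R by (subst set_integral_diff(2)[OF b ci]) (simp add: set_lebesgue_integral_def m_def)
  then have "m *\<^sub>R (avg R b - c) = (LINT x:R|lebesgue. b x - c)"
    using m by (simp add: avg_def m_def[symmetric] scaleR_diff_right)
  then have "m * norm (avg R b - c) = norm (LINT x:R|lebesgue. b x - c)"
    using m by (metis abs_of_pos norm_scaleR)
  also have "\<dots> \<le> (LINT x:R|lebesgue. norm (b x - c))"
    using bc unfolding set_lebesgue_integral_def set_integrable_def
    by (intro order_trans[OF integral_norm_bound]) simp
  finally have "ennreal (m * norm (avg R b - c)) \<le> ennreal (LINT x:R|lebesgue. norm (b x - c))"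
    by (rule ennreal_leI)
  also have "\<dots> = (\<integral>\<^sup>+x. ennreal (indicator R x *\<^sub>R norm (b x - c)) \<partial>lebesgue)"
    unfolding set_lebesgue_integral_def
    using set_integrable_norm[OF bc] unfolding set_integrable_def
    by (intro nn_integral_eq_integral[symmetric]) auto
  also have "\<dots> = (\<integral>\<^sup>+x\<in>R. ennreal (norm (b x - c)) \<partial>lebesgue)"
    by (intro nn_integral_cong) (auto simp: indicator_def)
  finally show ?thesis using m by (simp add: ennreal_mult mult.commute less_imp_le)
qed

context dyadic_grid
begin

lemma set_integrable_cell:
  assumes "loc_integrable b" "Q \<in> cells"
  shows "set_integrable lebesgue Q b"
proof -
  obtain k x where Q: "Q = cell k x" using assms by (auto simp: cells_def)
  obtain a where "Q \<subseteq> cbox a (a + side k *\<^sub>R One)" using cell_cube Q by blast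
  moreover have "set_integrable lebesgue (cbox a (a + side k *\<^sub>R One)) b"
    using assms(1) by (auto simp: loc_integrable_def)
  ultimately show ?thesis using Q by (metis set_integrable_subset cell_lebesgue)
qed

lemma norm_avg_cell_minus_le:
  assumes "loc_integrable b" "Q \<in> cells"
  shows "ennreal (norm (avg Q b - c)) * emeasure lebesgue Q \<le> (\<integral>\<^sup>+x\<in>Q. ennreal (norm (b x - c)) \<partial>lebesgue)"
  using assms by (intro norm_avg_minus_le set_integrable_cell cells_lebesgue cell_pos cell_finite)

lemma norm_avg_cell_le:
  assumes "loc_integrable b" "Q \<in> cells"
    and "(\<integral>\<^sup>+x\<in>Q. ennreal (norm (b x - c)) \<partial>lebesgue) \<le> t * emeasure lebesgue Q"
  shows "ennreal (norm (avg Q b - c)) \<le> t"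
proof -
  have "emeasure lebesgue Q * ennreal (norm (avg Q b - c)) \<le> emeasure lebesgue Q * t"
    using norm_avg_cell_minus_le[OF assms(1,2), of c] assms(3) by (simp add: mult.commute)
  then show ?thesis using cell_pos[OF assms(2)] cell_finite[OF assms(2)]
    by (simp add: ennreal_mult_le_mult_iff less_top)
qed

lemma emeasure_parent: "emeasure lebesgue (cell (k - 1) x) = ennreal (2 ^ DIM('a)) * emeasure lebesgue (cell k x)"
proof -
  have "side (k - 1) = 2 * side k" using side_Suc[of "k - 1"] by simp
  then show ?thesis by (simp add: emeasure_cell power_mult_distrib ennreal_mult less_imp_le)
qed

text \<open>
  The conditional expectation of \<open>b\<close> on the cells of generation \<open>k\<close>.
\<close>

definition level_avg :: "('a \<Rightarrow> 'b::{banach, second_countable_topology}) \<Rightarrow> int \<Rightarrow> 'a \<Rightarrow> 'b"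
  where "level_avg b k y = avg (cell k y) b"

lemma level_avg_measurable [measurable]: "(\<lambda>y. ennreal (norm (level_avg b k y - c))) \<in> borel_measurable lebesgue"
  unfolding level_avg_def by (rule measurable_cell_function)

text \<open>
  With \<open>b\<close> replaced by its averages of generation \<open>K\<close> the claim is proved by downward induction on the
  generation of the cell; for generation \<open>K\<close> itself the left side vanishes. In the step for \<open>Q\<close> one stops at the
  maximal cells on which the mean of \<open>\<bar>b - b\<^sub>Q\<bar>\<close> exceeds \<open>2 * a\<close>, twice its bound \<open>a\<close> on \<open>Q\<close>. The constant
  is the same in every generation, because the term \<open>a * \<integral>\<^sub>Q g\<close> produced by the step is absorbed by the integral
  of the maximal function over the part of \<open>Q\<close> that did not stop, while the induction hypothesis is used only
  on the stopping cells.
\<close>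

lemma level_avg_oscillation:
  fixes b :: "'a \<Rightarrow> 'b::{banach, second_countable_topology}"
  assumes b: "loc_integrable b" and \<nu>: "cell_measure \<nu>" and B: "0 < B" and C: "0 \<le> C"
    and half: "\<And>Q E. Q \<in> cells \<Longrightarrow> E \<in> sets lebesgue \<Longrightarrow> E \<subseteq> Q \<Longrightarrow> emeasure lebesgue Q \<le> 2 * emeasure lebesgue E \<Longrightarrow>
        emeasure \<nu> Q \<le> ennreal C * emeasure \<nu> E"
    and osc: "\<And>Q. Q \<in> cells \<Longrightarrow> (\<integral>\<^sup>+x\<in>Q. ennreal (norm (b x - avg Q b)) \<partial>lebesgue) \<le> ennreal B * emeasure \<nu> Q"
    and g: "g \<in> borel_measurable lebesgue"
    and kK: "k \<le> K"
  shows "(\<integral>\<^sup>+y\<in>cell k x. ennreal (norm (level_avg b K y - avg (cell k x) b)) * g y \<partial>lebesgue) \<le>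
     ennreal (2 ^ (DIM('a) + 1) * B * C) * (\<integral>\<^sup>+y\<in>cell k x. dyadic_max lebesgue g y \<partial>\<nu>)"
  using kK
proof (induction "nat (K - k)" arbitrary: k x rule: less_induct)
  case less
  define Q where "Q = cell k x"
  have Q: "Q \<in> cells" by (simp add: Q_def)
  have Qm [measurable]: "Q \<in> sets lebesgue" by (simp add: Q_def)
  note g[measurable]
  note s\<nu> = cell_measureD(1)[OF \<nu>]
  have Mm: "dyadic_max lebesgue g \<in> borel_measurable \<nu>"
    using measurable_dyadic_max s\<nu> by (simp cong: measurable_cong_sets)
  let ?D = "ennreal (2 ^ (DIM('a) + 1))"
  let ?M = "dyadic_max lebesgue g"
  show ?case
  proof (cases "k = K")
    case True
    have "(\<integral>\<^sup>+y\<in>cell k x. ennreal (norm (level_avg b K y - avg (cell k x) b)) * g y \<partial>lebesgue) = (\<integral>\<^sup>+(y::'a). 0 \<partial>lebesgue)"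
      using True by (intro nn_integral_cong) (auto simp: level_avg_def cell_eq_iff indicator_def)
    then show ?thesis by simp
  next
    case False
    then have kK: "k + 1 \<le> K" using less by simp
    define m where "m = emeasure lebesgue Q"
    have m: "0 < m" "m < top" using cell_pos[OF Q] cell_finite[OF Q] by (auto simp: m_def)
    define c where "c = avg Q b"
    define a where "a = ennreal B * emeasure \<nu> Q / m"
    have am: "a * m = ennreal B * emeasure \<nu> Q" unfolding a_def using m by (rule ennreal_divide_mult_cancel)
    have a: "0 < a" "a < top"
    proof -
      have "0 < a * m" "a * m < top" unfolding am using B cell_measureD(2,3)[OF \<nu> Q]
        by (auto simp: zero_less_iff_neq_zero ennreal_mult_less_top)
      then show "0 < a" "a < top" using m by (auto simp: zero_less_iff_neq_zero ennreal_mult_less_top)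
    qed
    have oscQ: "(\<integral>\<^sup>+x\<in>Q. ennreal (norm (b x - c)) \<partial>lebesgue) \<le> a * m"
      unfolding am c_def by (rule osc[OF Q])
    have bm [measurable]: "b \<in> borel_measurable lebesgue" using b by (rule loc_integrable_measurable)
    define P where "P j R \<longleftrightarrow> R \<subseteq> Q \<and> j \<le> K \<and> 2 * a * emeasure lebesgue R < (\<integral>\<^sup>+x\<in>R. ennreal (norm (b x - c)) \<partial>lebesgue)" for j R
    define S where "S = stopping_cells (k + 1) P"
    have S: "countable S" "disjoint S" "S \<subseteq> sets lebesgue" "S \<subseteq> cells"
      unfolding S_def using countable_stopping_cells disjoint_stopping_cells stopping_cells_subset cells_lebesgue by blast+
    have S\<nu>: "S \<subseteq> sets \<nu>" using S s\<nu> by simp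
    define U where "U = \<Union>S"
    have Um [measurable]: "U \<in> sets lebesgue" unfolding U_def using S by (intro sets.countable_Union) auto
    have UQ: "U \<subseteq> Q" unfolding U_def S_def Union_stopping_cells P_def by auto
    define E where "E = Q - U"
    have Em [measurable]: "E \<in> sets lebesgue" unfolding E_def by measurable
    \<comment> \<open>By Chebyshev's inequality the stopping cells fill at most half of \<open>Q\<close>.\<close>
    have "2 * a * emeasure lebesgue U = (\<integral>\<^sup>+x\<in>U. 2 * a \<partial>lebesgue)"
      using Um by (simp only: nn_integral_cmult_indicator)
    also have "\<dots> = (\<integral>\<^sup>+R. (\<integral>\<^sup>+x\<in>R. 2 * a \<partial>lebesgue) \<partial>count_space S)"
      unfolding U_def by (rule nn_integral_disjoint_Union[OF S(1-3)]) simp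
    also have "\<dots> \<le> (\<integral>\<^sup>+R. (\<integral>\<^sup>+x\<in>R. ennreal (norm (b x - c)) \<partial>lebesgue) \<partial>count_space S)"
    proof (rule nn_integral_mono)
      fix R assume "R \<in> space (count_space S)"
      then have "R \<in> S" by simp
      then have "R \<in> sets lebesgue" "2 * a * emeasure lebesgue R < (\<integral>\<^sup>+x\<in>R. ennreal (norm (b x - c)) \<partial>lebesgue)"
        using S by (auto simp: S_def stopping_cells_def P_def)
      then show "(\<integral>\<^sup>+x\<in>R. 2 * a \<partial>lebesgue) \<le> (\<integral>\<^sup>+x\<in>R. ennreal (norm (b x - c)) \<partial>lebesgue)"
        by (simp only: nn_integral_cmult_indicator)
    qed
    also have "\<dots> = (\<integral>\<^sup>+x\<in>U. ennreal (norm (b x - c)) \<partial>lebesgue)"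
      unfolding U_def by (rule nn_integral_disjoint_Union[OF S(1-3), symmetric]) measurable
    also have "\<dots> \<le> (\<integral>\<^sup>+x\<in>Q. ennreal (norm (b x - c)) \<partial>lebesgue)"
      using UQ by (intro nn_integral_mono) (auto simp: indicator_def)
    also have "\<dots> \<le> a * m" by (rule oscQ)
    finally have "a * (2 * emeasure lebesgue U) \<le> a * m" by (simp add: mult_ac)
    then have U2: "2 * emeasure lebesgue U \<le> m" using a by (subst (asm) ennreal_mult_le_mult_iff) auto
    have mUE: "m = emeasure lebesgue U + emeasure lebesgue E"
    proof -
      have "U \<union> E = Q" "U \<inter> E = {}" using UQ by (auto simp: E_def)
      then show ?thesis using plus_emeasure[OF Um Em] by (simp add: m_def)
    qed
    have "emeasure lebesgue U + emeasure lebesgue U \<le> emeasure lebesgue U + emeasure lebesgue E"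
      using U2 mUE by (simp add: mult_2)
    moreover have "emeasure lebesgue U < top" using mUE m by (metis ennreal_add_less_top)
    ultimately have "emeasure lebesgue U \<le> emeasure lebesgue E" by (auto simp: ennreal_add_left_cancel_le)
    then have "emeasure lebesgue Q \<le> 2 * emeasure lebesgue E"
      using mUE by (simp add: m_def mult_2 add_right_mono)
    then have \<nu>E: "emeasure \<nu> Q \<le> ennreal C * emeasure \<nu> E"
      using Em by (intro half Q) (auto simp: E_def)
    \<comment> \<open>Off the stopping cells the averages stay close to the average on \<open>Q\<close>; on a stopping cell the
      parent did not stop, so its own average is still under control.\<close>
    have not_stop: "ennreal (norm (avg (cell K y) b - c)) \<le> ?D * a" if y: "y \<in> E" for y
    proof -
      have cy: "cell K y \<subseteq> Q" using y kK cell_mono[of k K y] cell_eq[of y k x] by (auto simp: E_def Q_def)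
      have "\<not> P K (cell K y)"
        using y kK unfolding E_def U_def S_def Union_stopping_cells by auto
      then have "(\<integral>\<^sup>+x\<in>cell K y. ennreal (norm (b x - c)) \<partial>lebesgue) \<le> 2 * a * emeasure lebesgue (cell K y)"
        using cy by (simp add: P_def not_less)
      then have "ennreal (norm (avg (cell K y) b - c)) \<le> 2 * a" by (rule norm_avg_cell_le[OF b cell_in_cells])
      also have "2 * a \<le> ?D * a"
      proof (rule mult_right_mono)
        have "(2::real) \<le> 2 ^ (DIM('a) + 1)" by (simp add: one_le_power)
        then have "ennreal 2 \<le> ?D" by (rule ennreal_leI)
        then show "2 \<le> ?D" by simp
      qed simp
      finally show ?thesis .
    qed
    have stop: "(\<integral>\<^sup>+y\<in>R. ennreal (norm (level_avg b K y - c)) * g y \<partial>lebesgue) \<le>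
        ennreal (2 ^ (DIM('a) + 1) * B * C) * (\<integral>\<^sup>+y\<in>R. ?M y \<partial>\<nu>) + ?D * a * (\<integral>\<^sup>+y\<in>R. g y \<partial>lebesgue)"
      if R: "R \<in> S" for R
    proof -
      obtain j z where j: "R = cell j z" "k + 1 \<le> j" "P j (cell j z)"
         "\<And>i. k + 1 \<le> i \<Longrightarrow> i < j \<Longrightarrow> \<not> P i (cell i z)"
        using R unfolding S_def stopping_cells_def by blast
      have Rm [measurable]: "R \<in> sets lebesgue" using j by simp
      have jK: "j \<le> K" "z \<in> Q" using j cell_self[of z j] by (auto simp: P_def)
      have zk: "cell k z = Q" using jK cell_eq by (simp add: Q_def)
      have parent: "(\<integral>\<^sup>+x\<in>cell (j - 1) z. ennreal (norm (b x - c)) \<partial>lebesgue) \<le> 2 * a * emeasure lebesgue (cell (j - 1) z)"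
      proof (cases "j = k + 1")
        case True
        have "1 * (a * m) \<le> 2 * (a * m)" by (rule mult_right_mono) auto
        then show ?thesis using True zk oscQ by (simp add: m_def mult_ac)
      next
        case False
        then have "\<not> P (j - 1) (cell (j - 1) z)" using j by auto
        moreover have "cell (j - 1) z \<subseteq> Q" using zk j False cell_mono[of k "j - 1" z] by simp
        ultimately show ?thesis using jK by (simp add: P_def not_less)
      qed
      have "(\<integral>\<^sup>+x\<in>R. ennreal (norm (b x - c)) \<partial>lebesgue) \<le> (\<integral>\<^sup>+x\<in>cell (j - 1) z. ennreal (norm (b x - c)) \<partial>lebesgue)"
        using cell_mono[of "j - 1" j z] j by (intro nn_integral_mono) (auto simp: indicator_def)
      also have "\<dots> \<le> 2 * a * emeasure lebesgue (cell (j - 1) z)" by (rule parent)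
      also have "\<dots> = ?D * a * emeasure lebesgue R"
        by (simp add: emeasure_parent j ennreal_mult mult_ac)
      finally have Rc: "ennreal (norm (avg R b - c)) \<le> ?D * a"
        using j by (intro norm_avg_cell_le[OF b]) auto
      have "(\<integral>\<^sup>+y\<in>R. ennreal (norm (level_avg b K y - c)) * g y \<partial>lebesgue) \<le>
         (\<integral>\<^sup>+y. ennreal (norm (level_avg b K y - avg R b)) * g y * indicator R y + (?D * a) * (g y * indicator R y) \<partial>lebesgue)"
      proof (intro nn_integral_mono)
        fix y
        have "norm (level_avg b K y - c) \<le> norm (level_avg b K y - avg R b) + norm (avg R b - c)"
          using norm_triangle_ineq[of "level_avg b K y - avg R b" "avg R b - c"] by simp
        then have "ennreal (norm (level_avg b K y - c)) \<le> ennreal (norm (level_avg b K y - avg R b)) + ennreal (norm (avg R b - c))"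
          by (simp add: ennreal_leI flip: ennreal_plus)
        also have "\<dots> \<le> ennreal (norm (level_avg b K y - avg R b)) + ?D * a" using Rc by (rule add_left_mono)
        finally have "ennreal (norm (level_avg b K y - c)) * g y * indicator R y \<le>
           (ennreal (norm (level_avg b K y - avg R b)) + ?D * a) * g y * indicator R y"
          by (intro mult_right_mono) auto
        then show "ennreal (norm (level_avg b K y - c)) * g y * indicator R y \<le>
           ennreal (norm (level_avg b K y - avg R b)) * g y * indicator R y + (?D * a) * (g y * indicator R y)"
          by (simp add: distrib_right mult.assoc)
      qed
      also have "\<dots> = (\<integral>\<^sup>+y\<in>R. ennreal (norm (level_avg b K y - avg R b)) * g y \<partial>lebesgue) + (?D * a) * (\<integral>\<^sup>+y\<in>R. g y \<partial>lebesgue)"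
        by (subst nn_integral_add) (auto simp: nn_integral_cmult)
      also have "\<dots> \<le> ennreal (2 ^ (DIM('a) + 1) * B * C) * (\<integral>\<^sup>+y\<in>R. ?M y \<partial>\<nu>) + (?D * a) * (\<integral>\<^sup>+y\<in>R. g y \<partial>lebesgue)"
        unfolding j(1) using j jK less.hyps[of j z] by (intro add_right_mono) auto
      finally show ?thesis .
    qed
    \<comment> \<open>This is where the part \<open>E\<close> pays for \<open>Q\<close>: the mean of \<open>g\<close> on \<open>Q\<close> bounds the maximal function from
      below everywhere on \<open>E\<close>.\<close>
    have a_abs: "a * (\<integral>\<^sup>+y\<in>Q. g y \<partial>lebesgue) \<le> ennreal (B * C) * (\<integral>\<^sup>+y\<in>E. ?M y \<partial>\<nu>)"
    proof -
      have "a * (\<integral>\<^sup>+y\<in>Q. g y \<partial>lebesgue) = ennreal B * emeasure \<nu> Q * nn_mean lebesgue g Q"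
        using nn_mean_mult[OF cell_measure_lebesgue Q, of g] by (simp add: am[symmetric] m_def mult_ac)
      also have "\<dots> \<le> ennreal B * (ennreal C * emeasure \<nu> E) * nn_mean lebesgue g Q"
        by (intro mult_right_mono mult_left_mono \<nu>E) auto
      also have "\<dots> = ennreal (B * C) * (\<integral>\<^sup>+y\<in>E. nn_mean lebesgue g Q \<partial>\<nu>)"
      proof -
        have "(\<integral>\<^sup>+y\<in>E. nn_mean lebesgue g Q \<partial>\<nu>) = nn_mean lebesgue g Q * emeasure \<nu> E"
          using Em s\<nu> by (intro nn_integral_cmult_indicator) simp
        then show ?thesis using B C by (simp add: ennreal_mult mult_ac)
      qed
      also have "\<dots> \<le> ennreal (B * C) * (\<integral>\<^sup>+y\<in>E. ?M y \<partial>\<nu>)"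
        using Q by (intro mult_left_mono nn_integral_mono) (auto simp: indicator_def E_def intro: nn_mean_le_dyadic_max)
      finally show ?thesis .
    qed
    have splitQ: "(\<integral>\<^sup>+y\<in>Q. h y \<partial>\<rho>) = (\<integral>\<^sup>+y\<in>E. h y \<partial>\<rho>) + (\<integral>\<^sup>+y\<in>U. h y \<partial>\<rho>)"
      if "sets \<rho> = sets lebesgue" "h \<in> borel_measurable \<rho>" for h and \<rho> :: "'a measure"
    proof -
      have "(\<integral>\<^sup>+y\<in>Q. h y \<partial>\<rho>) = (\<integral>\<^sup>+y. h y * indicator E y + h y * indicator U y \<partial>\<rho>)"
        using UQ by (intro nn_integral_cong) (auto simp: E_def indicator_def)
      also have "\<dots> = (\<integral>\<^sup>+y\<in>E. h y \<partial>\<rho>) + (\<integral>\<^sup>+y\<in>U. h y \<partial>\<rho>)"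
        using that Em Um by (intro nn_integral_add) auto
      finally show ?thesis .
    qed
    let ?h = "\<lambda>y. ennreal (norm (level_avg b K y - c)) * g y"
    have "(\<integral>\<^sup>+y\<in>U. ?h y \<partial>lebesgue) = (\<integral>\<^sup>+R. (\<integral>\<^sup>+y\<in>R. ?h y \<partial>lebesgue) \<partial>count_space S)"
      unfolding U_def by (rule nn_integral_disjoint_Union[OF S(1-3)]) measurable
    also have "\<dots> \<le> (\<integral>\<^sup>+R. ennreal (2 ^ (DIM('a) + 1) * B * C) * (\<integral>\<^sup>+y\<in>R. ?M y \<partial>\<nu>) + ?D * a * (\<integral>\<^sup>+y\<in>R. g y \<partial>lebesgue) \<partial>count_space S)"
      using stop by (intro nn_integral_mono) simp
    also have "\<dots> = ennreal (2 ^ (DIM('a) + 1) * B * C) * (\<integral>\<^sup>+R. (\<integral>\<^sup>+y\<in>R. ?M y \<partial>\<nu>) \<partial>count_space S) +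
        ?D * a * (\<integral>\<^sup>+R. (\<integral>\<^sup>+y\<in>R. g y \<partial>lebesgue) \<partial>count_space S)"
      by (subst nn_integral_add) (auto simp: nn_integral_cmult)
    also have "(\<integral>\<^sup>+R. (\<integral>\<^sup>+y\<in>R. ?M y \<partial>\<nu>) \<partial>count_space S) = (\<integral>\<^sup>+y\<in>U. ?M y \<partial>\<nu>)"
      unfolding U_def by (rule nn_integral_disjoint_Union[OF S(1,2) S\<nu> Mm, symmetric])
    also have "(\<integral>\<^sup>+R. (\<integral>\<^sup>+y\<in>R. g y \<partial>lebesgue) \<partial>count_space S) = (\<integral>\<^sup>+y\<in>U. g y \<partial>lebesgue)"
      unfolding U_def by (rule nn_integral_disjoint_Union[OF S(1-3) g, symmetric])
    finally have hU: "(\<integral>\<^sup>+y\<in>U. ?h y \<partial>lebesgue) \<le> ennreal (2 ^ (DIM('a) + 1) * B * C) * (\<integral>\<^sup>+y\<in>U. ?M y \<partial>\<nu>) + ?D * a * (\<integral>\<^sup>+y\<in>U. g y \<partial>lebesgue)" .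
    have "(\<integral>\<^sup>+y\<in>E. ?h y \<partial>lebesgue) \<le> (\<integral>\<^sup>+y. (?D * a) * (g y * indicator E y) \<partial>lebesgue)"
      using not_stop by (intro nn_integral_mono) (auto simp: indicator_def level_avg_def intro!: mult_right_mono)
    also have "\<dots> = ?D * a * (\<integral>\<^sup>+y\<in>E. g y \<partial>lebesgue)" by (rule nn_integral_cmult) measurable
    finally have hE: "(\<integral>\<^sup>+y\<in>E. ?h y \<partial>lebesgue) \<le> ?D * a * (\<integral>\<^sup>+y\<in>E. g y \<partial>lebesgue)" .
    have "(\<integral>\<^sup>+y\<in>Q. ?h y \<partial>lebesgue) = (\<integral>\<^sup>+y\<in>E. ?h y \<partial>lebesgue) + (\<integral>\<^sup>+y\<in>U. ?h y \<partial>lebesgue)"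
      by (rule splitQ) auto
    also have "\<dots> \<le> ?D * a * (\<integral>\<^sup>+y\<in>E. g y \<partial>lebesgue) +
       (ennreal (2 ^ (DIM('a) + 1) * B * C) * (\<integral>\<^sup>+y\<in>U. ?M y \<partial>\<nu>) + ?D * a * (\<integral>\<^sup>+y\<in>U. g y \<partial>lebesgue))"
      by (rule add_mono[OF hE hU])
    also have "\<dots> = ?D * (a * (\<integral>\<^sup>+y\<in>Q. g y \<partial>lebesgue)) + ennreal (2 ^ (DIM('a) + 1) * B * C) * (\<integral>\<^sup>+y\<in>U. ?M y \<partial>\<nu>)"
      by (subst splitQ[of lebesgue g]) (auto simp: distrib_left mult_ac add_ac)
    also have "\<dots> \<le> ?D * (ennreal (B * C) * (\<integral>\<^sup>+y\<in>E. ?M y \<partial>\<nu>)) + ennreal (2 ^ (DIM('a) + 1) * B * C) * (\<integral>\<^sup>+y\<in>U. ?M y \<partial>\<nu>)"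
      by (intro add_right_mono mult_left_mono a_abs) simp
    also have "\<dots> = ennreal (2 ^ (DIM('a) + 1) * B * C) * ((\<integral>\<^sup>+y\<in>E. ?M y \<partial>\<nu>) + (\<integral>\<^sup>+y\<in>U. ?M y \<partial>\<nu>))"
    proof -
      have "?D * ennreal (B * C) = ennreal (2 ^ (DIM('a) + 1) * B * C)"
        using B C by (simp add: ennreal_mult'[symmetric] mult.assoc)
      then show ?thesis by (metis (no_types, lifting) distrib_left mult.assoc)
    qed
    also have "\<dots> = ennreal (2 ^ (DIM('a) + 1) * B * C) * (\<integral>\<^sup>+y\<in>Q. ?M y \<partial>\<nu>)"
      using splitQ[OF s\<nu> Mm] by simp
    finally show ?thesis unfolding c_def Q_def .
  qed
qed


lemma cell_dist: "z \<in> cell k y \<Longrightarrow> norm (z - y) \<le> real DIM('a) * side k"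
proof -
  assume z: "z \<in> cell k y"
  obtain a where a: "cell k y \<subseteq> cbox a (a + side k *\<^sub>R One)" using cell_cube by blast
  have zy: "z \<in> cbox a (a + side k *\<^sub>R One)" "y \<in> cbox a (a + side k *\<^sub>R One)" using a z cell_self by blast+
  have "norm (z - y) \<le> (\<Sum>i\<in>Basis. \<bar>(z - y) \<bullet> i\<bar>)" by (rule norm_le_l1)
  also have "\<dots> \<le> (\<Sum>i\<in>(Basis::'a set). side k)"
  proof (rule sum_mono)
    fix i :: 'a assume i: "i \<in> Basis"
    have "a \<bullet> i \<le> z \<bullet> i" "z \<bullet> i \<le> a \<bullet> i + side k" "a \<bullet> i \<le> y \<bullet> i" "y \<bullet> i \<le> a \<bullet> i + side k"
      using zy i by (auto simp: mem_box inner_simps)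
    then show "\<bar>(z - y) \<bullet> i\<bar> \<le> side k" by (simp add: inner_diff_left)
  qed
  also have "\<dots> = real DIM('a) * side k" by simp
  finally show ?thesis .
qed

lemma cell_eventually_inside:
  assumes "open U" "y \<in> U"
  shows "\<exists>K0. \<forall>K\<ge>K0. cell K y \<subseteq> U"
proof -
  obtain e where e: "0 < e" "ball y e \<subseteq> U" using assms open_contains_ball by blast
  obtain K0 where K0: "side K0 < e / real DIM('a)"
    using side_bracket[of "e / real DIM('a)"] e by auto
  have "cell K y \<subseteq> U" if "K0 \<le> K" for K
  proof -
    have "cell K y \<subseteq> ball y e"
    proof
      fix z assume "z \<in> cell K y"
      then have "z \<in> cell K0 y" using cell_mono that by blast
      then have "norm (z - y) < e" using cell_dist[of z K0 y] K0 by (simp add: field_simps)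
      then show "z \<in> ball y e" by (simp add: dist_norm norm_minus_commute)
    qed
    then show ?thesis using e by blast
  qed
  then show ?thesis by blast
qed

lemma borel_measurable_level_avg [measurable]: "level_avg b K \<in> borel_measurable lebesgue"
  unfolding level_avg_def[abs_def] by (rule measurable_cell_function)

definition step_function :: "int \<Rightarrow> ('a \<Rightarrow> 'b::{banach, second_countable_topology}) \<Rightarrow> bool"
  where "step_function K h \<longleftrightarrow> h \<in> borel_measurable lebesgue \<and> (\<forall>y. \<forall>z\<in>cell K y. h z = h y)"

text \<open>
  Dyadic step functions are dense in \<open>L^1\<close>. For the indicator of \<open>A\<close>, enclose \<open>A\<close> in an open set \<open>U\<close> of almost
  the same measure; the cells of generation \<open>K\<close> that lie inside \<open>U\<close> exhaust \<open>U\<close> as \<open>K\<close> grows.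
\<close>

lemma step_function_approx:
  fixes f :: "'a \<Rightarrow> 'b::{banach, second_countable_topology}"
  assumes f: "integrable lebesgue f" and Q: "Q \<in> cells" and e: "0 < e"
  shows "\<exists>K0. \<forall>K\<ge>K0. \<exists>h. step_function K h \<and> (\<integral>\<^sup>+y\<in>Q. ennreal (norm (f y - h y)) \<partial>lebesgue) \<le> ennreal e"
  using f e
proof (induction arbitrary: e rule: integrable_induct)
  case (base A c)
  have Qm: "Q \<in> sets lebesgue" using Q cells_lebesgue by simp
  define d where "d = e / (2 * (norm c + 1))"
  have d: "0 < d" using base by (simp add: d_def add_nonneg_pos)
  obtain U where U: "open U" "A \<subseteq> U" "U - A \<in> lmeasurable" "emeasure lebesgue (U - A) < ennreal d"
    using sets_lebesgue_outer_open[OF base(1) d] by blast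
  have Um: "U \<in> sets lebesgue" using U by auto
  define V where "V K = {y. cell K y \<subseteq> U}" for K
  have Vm: "V K \<in> sets lebesgue" for K
  proof -
    have "(\<lambda>y. (if cell K y \<subseteq> U then 1 else 0) :: ennreal) \<in> borel_measurable lebesgue"
      by (rule measurable_cell_function[of "\<lambda>R. if R \<subseteq> U then 1 else 0"])
    then have "(\<lambda>y. (if cell K y \<subseteq> U then 1 else 0) :: ennreal) -` {1} \<inter> space lebesgue \<in> sets lebesgue"
      by (rule measurable_sets) simp
    moreover have "(\<lambda>y. (if cell K y \<subseteq> U then 1 else 0) :: ennreal) -` {1} \<inter> space lebesgue = V K"
      by (auto simp: V_def split: if_splits)
    ultimately show ?thesis by simp
  qed
  have VU: "V K \<subseteq> U" for K using cell_self by (auto simp: V_def)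
  have Vmono: "V j \<subseteq> V K" if "j \<le> K" for j K using cell_mono[OF that] by (auto simp: V_def)
  define W where "W n = Q \<inter> U - V (int n)" for n
  have "(\<lambda>n. emeasure lebesgue (W n)) \<longlonglongrightarrow> emeasure lebesgue (\<Inter>n. W n)"
  proof (rule Lim_emeasure_decseq)
    show "range W \<subseteq> sets lebesgue" unfolding W_def using Qm Um Vm by auto
    show "decseq W" unfolding decseq_def W_def by (intro allI impI Diff_mono Vmono) auto
    show "emeasure lebesgue (W i) \<noteq> \<infinity>" for i
    proof -
      have "emeasure lebesgue (W i) \<le> emeasure lebesgue Q" unfolding W_def using Qm by (intro emeasure_mono) auto
      then show ?thesis using cell_finite[OF Q] by (auto simp: top_unique)
    qed
  qed
  moreover have "(\<Inter>n. W n) = {}"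
  proof (intro equals0I)
    fix y assume y: "y \<in> (\<Inter>n. W n)"
    then have "y \<in> W 0" by blast
    then have "y \<in> U" by (simp add: W_def)
    then obtain K0 where K0: "\<forall>K\<ge>K0. cell K y \<subseteq> U" using cell_eventually_inside U by blast
    have "y \<in> W (nat K0)" using y by blast
    then show False using K0 by (auto simp: W_def V_def)
  qed
  ultimately have "(\<lambda>n. emeasure lebesgue (W n)) \<longlonglongrightarrow> 0" by simp
  then have "eventually (\<lambda>n. emeasure lebesgue (W n) < ennreal d) sequentially"
    using d by (intro order_tendstoD) auto
  then obtain N where N: "emeasure lebesgue (W N) < ennreal d" by (auto simp: eventually_sequentially)
  show ?case
  proof (intro exI[of _ "int N"] allI impI)
    fix K assume K: "int N \<le> K"
    define h where "h y = indicator (V K) y *\<^sub>R c" for y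
    have "step_function K h"
      unfolding step_function_def h_def using Vm by (auto simp: V_def indicator_def cell_eq_iff)
    moreover have "(\<integral>\<^sup>+y\<in>Q. ennreal (norm (indicator A y *\<^sub>R c - h y)) \<partial>lebesgue) \<le> ennreal e"
    proof -
      have "(\<integral>\<^sup>+y\<in>Q. ennreal (norm (indicator A y *\<^sub>R c - h y)) \<partial>lebesgue) \<le>
         (\<integral>\<^sup>+y. ennreal (norm c) * indicator (U - A) y + ennreal (norm c) * indicator (W N) y \<partial>lebesgue)"
        using VU[of K] Vmono[OF K] U(2) by (intro nn_integral_mono) (auto simp: h_def indicator_def W_def)
      also have "\<dots> = ennreal (norm c) * emeasure lebesgue (U - A) + ennreal (norm c) * emeasure lebesgue (W N)"
      proof -
        have "U - A \<in> sets lebesgue" "W N \<in> sets lebesgue" using Um base(1) Qm Vm by (auto simp: W_def)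
        then show ?thesis by (subst nn_integral_add) (auto simp: nn_integral_cmult_indicator)
      qed
      also have "\<dots> \<le> ennreal (norm c) * ennreal d + ennreal (norm c) * ennreal d"
        using U(4) N by (intro add_mono mult_left_mono) auto
      also have "\<dots> = ennreal (2 * norm c * d)" using d by (simp flip: ennreal_mult' ennreal_plus)
      also have "\<dots> \<le> ennreal e"
      proof (rule ennreal_leI)
        have "2 * norm c * d \<le> 2 * (norm c + 1) * d" using d by (intro mult_right_mono) auto
        also have "\<dots> = e" unfolding d_def by (simp add: add_nonneg_eq_0_iff)
        finally show "2 * norm c * d \<le> e" .
      qed
      finally show ?thesis .
    qed
    ultimately show "\<exists>h. step_function K h \<and> (\<integral>\<^sup>+y\<in>Q. ennreal (norm (indicator A y *\<^sub>R c - h y)) \<partial>lebesgue) \<le> ennreal e"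
      by blast
  qed
next
  case (add f g)
  have Qm [measurable]: "Q \<in> sets lebesgue" using Q cells_lebesgue by simp
  have [measurable]: "f \<in> borel_measurable lebesgue" "g \<in> borel_measurable lebesgue" using add by auto
  obtain K1 where K1: "\<forall>K\<ge>K1. \<exists>h. step_function K h \<and> (\<integral>\<^sup>+y\<in>Q. ennreal (norm (f y - h y)) \<partial>lebesgue) \<le> ennreal (e / 2)"
    using add.IH(1)[of "e / 2"] add.prems by auto
  obtain K2 where K2: "\<forall>K\<ge>K2. \<exists>h. step_function K h \<and> (\<integral>\<^sup>+y\<in>Q. ennreal (norm (g y - h y)) \<partial>lebesgue) \<le> ennreal (e / 2)"
    using add.IH(2)[of "e / 2"] add.prems by auto
  show ?case
  proof (intro exI[of _ "max K1 K2"] allI impI)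
    fix K assume K: "max K1 K2 \<le> K"
    obtain h1 where h1: "step_function K h1" "(\<integral>\<^sup>+y\<in>Q. ennreal (norm (f y - h1 y)) \<partial>lebesgue) \<le> ennreal (e / 2)"
      using K1 K by auto
    obtain h2 where h2: "step_function K h2" "(\<integral>\<^sup>+y\<in>Q. ennreal (norm (g y - h2 y)) \<partial>lebesgue) \<le> ennreal (e / 2)"
      using K2 K by auto
    have [measurable]: "h1 \<in> borel_measurable lebesgue" "h2 \<in> borel_measurable lebesgue"
      using h1 h2 by (auto simp: step_function_def)
    have "(\<integral>\<^sup>+y\<in>Q. ennreal (norm ((f y + g y) - (h1 y + h2 y))) \<partial>lebesgue) \<le>
       (\<integral>\<^sup>+y. ennreal (norm (f y - h1 y)) * indicator Q y + ennreal (norm (g y - h2 y)) * indicator Q y \<partial>lebesgue)"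
    proof (intro nn_integral_mono)
      fix y
      have "norm ((f y + g y) - (h1 y + h2 y)) \<le> norm (f y - h1 y) + norm (g y - h2 y)"
        using norm_triangle_ineq[of "f y - h1 y" "g y - h2 y"] by (simp add: algebra_simps)
      then have "ennreal (norm ((f y + g y) - (h1 y + h2 y))) \<le> ennreal (norm (f y - h1 y)) + ennreal (norm (g y - h2 y))"
        by (simp add: ennreal_leI flip: ennreal_plus)
      then show "ennreal (norm ((f y + g y) - (h1 y + h2 y))) * indicator Q y \<le>
         ennreal (norm (f y - h1 y)) * indicator Q y + ennreal (norm (g y - h2 y)) * indicator Q y"
        by (auto simp: indicator_def)
    qed
    also have "\<dots> = (\<integral>\<^sup>+y\<in>Q. ennreal (norm (f y - h1 y)) \<partial>lebesgue) + (\<integral>\<^sup>+y\<in>Q. ennreal (norm (g y - h2 y)) \<partial>lebesgue)"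
      by (rule nn_integral_add) measurable
    also have "\<dots> \<le> ennreal (e / 2) + ennreal (e / 2)" using h1 h2 by (intro add_mono)
    also have "\<dots> = ennreal e" using add.prems by (simp flip: ennreal_plus)
    finally have "(\<integral>\<^sup>+y\<in>Q. ennreal (norm ((f y + g y) - (h1 y + h2 y))) \<partial>lebesgue) \<le> ennreal e" .
    moreover have "step_function K (\<lambda>y. h1 y + h2 y)"
      using h1(1) h2(1) unfolding step_function_def by auto
    ultimately show "\<exists>h. step_function K h \<and> (\<integral>\<^sup>+y\<in>Q. ennreal (norm (f y + g y - h y)) \<partial>lebesgue) \<le> ennreal e"
      by blast
  qed
next
  case (lim f s)
  have Qm [measurable]: "Q \<in> sets lebesgue" using Q cells_lebesgue by simp
  have [measurable]: "f \<in> borel_measurable lebesgue" "s i \<in> borel_measurable lebesgue" for i using lim by auto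
  have "(\<lambda>i. \<integral>\<^sup>+y. ennreal (norm (f y - s i y)) \<partial>lebesgue) \<longlonglongrightarrow> 0"
  proof (rule Bochner_Integration.nn_integral_dominated_convergence_norm[where w="\<lambda>x. 2 * norm (f x)"])
    have "integrable lebesgue (\<lambda>x. 2 * norm (f x))" using lim by auto
    then show "(\<integral>\<^sup>+x. ennreal (2 * norm (f x)) \<partial>lebesgue) < \<infinity>"
      using lim by (simp add: integrable_iff_bounded nn_integral_cmult ennreal_mult ennreal_mult_less_top)
  qed (use lim in auto)
  then have "eventually (\<lambda>i. (\<integral>\<^sup>+y. ennreal (norm (f y - s i y)) \<partial>lebesgue) < ennreal (e / 2)) sequentially"
    using lim.prems by (intro order_tendstoD) auto
  then obtain i where i: "(\<integral>\<^sup>+y. ennreal (norm (f y - s i y)) \<partial>lebesgue) < ennreal (e / 2)"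
    by (auto simp: eventually_sequentially)
  obtain K1 where K1: "\<forall>K\<ge>K1. \<exists>h. step_function K h \<and> (\<integral>\<^sup>+y\<in>Q. ennreal (norm (s i y - h y)) \<partial>lebesgue) \<le> ennreal (e / 2)"
    using lim.IH[of "e / 2" i] lim.prems by auto
  show ?case
  proof (intro exI[of _ K1] allI impI)
    fix K assume K: "K1 \<le> K"
    obtain h where h: "step_function K h" "(\<integral>\<^sup>+y\<in>Q. ennreal (norm (s i y - h y)) \<partial>lebesgue) \<le> ennreal (e / 2)"
      using K1 K by auto
    have [measurable]: "h \<in> borel_measurable lebesgue" using h by (auto simp: step_function_def)
    have "(\<integral>\<^sup>+y\<in>Q. ennreal (norm (f y - h y)) \<partial>lebesgue) \<le>
       (\<integral>\<^sup>+y. ennreal (norm (f y - s i y)) + ennreal (norm (s i y - h y)) * indicator Q y \<partial>lebesgue)"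
    proof (intro nn_integral_mono)
      fix y
      have "norm (f y - h y) \<le> norm (f y - s i y) + norm (s i y - h y)"
        using norm_triangle_ineq[of "f y - s i y" "s i y - h y"] by simp
      then have "ennreal (norm (f y - h y)) \<le> ennreal (norm (f y - s i y)) + ennreal (norm (s i y - h y))"
        by (simp add: ennreal_leI flip: ennreal_plus)
      then show "ennreal (norm (f y - h y)) * indicator Q y \<le> ennreal (norm (f y - s i y)) + ennreal (norm (s i y - h y)) * indicator Q y"
        by (auto simp: indicator_def)
    qed
    also have "\<dots> = (\<integral>\<^sup>+y. ennreal (norm (f y - s i y)) \<partial>lebesgue) + (\<integral>\<^sup>+y\<in>Q. ennreal (norm (s i y - h y)) \<partial>lebesgue)"
      by (rule nn_integral_add) measurable
    also have "\<dots> \<le> ennreal (e / 2) + ennreal (e / 2)" using i h by (intro add_mono) auto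
    also have "\<dots> = ennreal e" using lim.prems by (simp flip: ennreal_plus)
    finally show "\<exists>h. step_function K h \<and> (\<integral>\<^sup>+y\<in>Q. ennreal (norm (f y - h y)) \<partial>lebesgue) \<le> ennreal e"
      using h by blast
  qed
qed

lemma level_avg_contraction:
  fixes b h :: "'a \<Rightarrow> 'b::{banach, second_countable_topology}"
  assumes b: "loc_integrable b" and h: "step_function K h" and kK: "k \<le> K"
  shows "(\<integral>\<^sup>+y\<in>cell k x. ennreal (norm (level_avg b K y - h y)) \<partial>lebesgue) \<le>
    (\<integral>\<^sup>+y\<in>cell k x. ennreal (norm (b y - h y)) \<partial>lebesgue)"
proof -
  define \<F> where "\<F> = cell K ` cell k x"
  have \<F>: "countable \<F>" "\<F> \<subseteq> sets lebesgue"
    unfolding \<F>_def by (auto intro: countable_subset[OF _ countable_cells[of K]])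
  have dis: "disjoint \<F>"
    unfolding \<F>_def disjoint_def by (auto simp: cell_eq_iff)
  have U: "\<Union>\<F> = cell k x"
  proof
    show "\<Union>\<F> \<subseteq> cell k x"
      unfolding \<F>_def using kK cell_mono cell_eq by blast
    show "cell k x \<subseteq> \<Union>\<F>" unfolding \<F>_def using cell_self by blast
  qed
  have [measurable]: "b \<in> borel_measurable lebesgue" using b by (rule loc_integrable_measurable)
  have [measurable]: "h \<in> borel_measurable lebesgue" using h by (simp add: step_function_def)
  have const: "ennreal (norm (level_avg b K z - h z)) = ennreal (norm (avg (cell K y) b - h y))" if "z \<in> cell K y" for z y
    using that h cell_eq by (simp add: level_avg_def step_function_def)
  have m: "(\<lambda>y. ennreal (norm (level_avg b K y - h y))) \<in> borel_measurable lebesgue"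
  proof -
    define \<phi> where "\<phi> R = ennreal (norm (avg R b - h (SOME z. z \<in> R)))" for R
    have "ennreal (norm (level_avg b K y - h y)) = \<phi> (cell K y)" for y
    proof -
      have "(SOME z. z \<in> cell K y) \<in> cell K y" by (rule someI) (rule cell_self)
      then have "h (SOME z. z \<in> cell K y) = h y" using h by (simp add: step_function_def)
      then show ?thesis by (simp add: \<phi>_def level_avg_def)
    qed
    then show ?thesis using measurable_cell_function[of \<phi> K] by simp
  qed
  have "(\<integral>\<^sup>+y\<in>cell k x. ennreal (norm (level_avg b K y - h y)) \<partial>lebesgue) =
     (\<integral>\<^sup>+R. (\<integral>\<^sup>+y\<in>R. ennreal (norm (level_avg b K y - h y)) \<partial>lebesgue) \<partial>count_space \<F>)"
    unfolding U[symmetric] by (rule nn_integral_disjoint_Union[OF \<F>(1) dis \<F>(2) m])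
  also have "\<dots> \<le> (\<integral>\<^sup>+R. (\<integral>\<^sup>+y\<in>R. ennreal (norm (b y - h y)) \<partial>lebesgue) \<partial>count_space \<F>)"
  proof (rule nn_integral_mono)
    fix R assume "R \<in> space (count_space \<F>)"
    then obtain y where R: "R = cell K y" by (auto simp: \<F>_def)
    have "(\<integral>\<^sup>+z\<in>R. ennreal (norm (level_avg b K z - h z)) \<partial>lebesgue) = (\<integral>\<^sup>+z\<in>R. ennreal (norm (avg R b - h y)) \<partial>lebesgue)"
      using const[of _ y] by (intro nn_integral_cong) (auto simp: R indicator_def)
    also have "\<dots> = ennreal (norm (avg R b - h y)) * emeasure lebesgue R"
      using R by (intro nn_integral_cmult_indicator) simp
    also have "\<dots> \<le> (\<integral>\<^sup>+z\<in>R. ennreal (norm (b z - h y)) \<partial>lebesgue)"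
      using R by (intro norm_avg_cell_minus_le b) simp
    also have "\<dots> = (\<integral>\<^sup>+z\<in>R. ennreal (norm (b z - h z)) \<partial>lebesgue)"
      using h by (intro nn_integral_cong) (auto simp: R indicator_def step_function_def)
    finally show "(\<integral>\<^sup>+z\<in>R. ennreal (norm (level_avg b K z - h z)) \<partial>lebesgue) \<le> (\<integral>\<^sup>+z\<in>R. ennreal (norm (b z - h z)) \<partial>lebesgue)" .
  qed
  also have "\<dots> = (\<integral>\<^sup>+y\<in>cell k x. ennreal (norm (b y - h y)) \<partial>lebesgue)"
    unfolding U[symmetric] by (rule nn_integral_disjoint_Union[OF \<F>(1) dis \<F>(2), symmetric]) measurable
  finally show ?thesis .
qed

text \<open>
  Averaging fixes step functions and is a contraction of \<open>L^1\<close>, so the convergence is inherited from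
  \<open>step_function_approx\<close>.
\<close>

lemma level_avg_L1_approx:
  fixes b :: "'a \<Rightarrow> 'b::{banach, second_countable_topology}"
  assumes b: "loc_integrable b" and e: "0 < e"
  shows "\<exists>K\<ge>k. (\<integral>\<^sup>+y\<in>cell k x. ennreal (norm (b y - level_avg b K y)) \<partial>lebesgue) \<le> ennreal e"
proof -
  let ?Q = "cell k x"
  have Qm [measurable]: "?Q \<in> sets lebesgue" by simp
  have bm [measurable]: "b \<in> borel_measurable lebesgue" using b by (rule loc_integrable_measurable)
  have "integrable lebesgue (\<lambda>y. indicator ?Q y *\<^sub>R b y)"
    using set_integrable_cell[OF b, of ?Q] by (simp add: set_integrable_def)
  from step_function_approx[OF this cell_in_cells, of "e / 2" k x] e obtain K0 where
    K0: "\<forall>K\<ge>K0. \<exists>h. step_function K h \<and> (\<integral>\<^sup>+y\<in>?Q. ennreal (norm (indicator ?Q y *\<^sub>R b y - h y)) \<partial>lebesgue) \<le> ennreal (e / 2)"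
    by auto
  define K where "K = max K0 k"
  obtain h where h: "step_function K h" "(\<integral>\<^sup>+y\<in>?Q. ennreal (norm (indicator ?Q y *\<^sub>R b y - h y)) \<partial>lebesgue) \<le> ennreal (e / 2)"
    using K0[rule_format, of K] unfolding K_def by (meson max.cobounded1)
  have [measurable]: "h \<in> borel_measurable lebesgue" using h by (simp add: step_function_def)
  have bh: "(\<integral>\<^sup>+y\<in>?Q. ennreal (norm (b y - h y)) \<partial>lebesgue) \<le> ennreal (e / 2)"
  proof -
    have "(\<integral>\<^sup>+y\<in>?Q. ennreal (norm (b y - h y)) \<partial>lebesgue) = (\<integral>\<^sup>+y\<in>?Q. ennreal (norm (indicator ?Q y *\<^sub>R b y - h y)) \<partial>lebesgue)"
      by (intro nn_integral_cong) (auto simp: indicator_def)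
    then show ?thesis using h by simp
  qed
  have Ah: "(\<integral>\<^sup>+y\<in>?Q. ennreal (norm (level_avg b K y - h y)) \<partial>lebesgue) \<le> ennreal (e / 2)"
    using level_avg_contraction[OF b h(1), of k x] bh by (simp add: K_def)
  have "(\<integral>\<^sup>+y\<in>?Q. ennreal (norm (b y - level_avg b K y)) \<partial>lebesgue) \<le>
      (\<integral>\<^sup>+y. ennreal (norm (b y - h y)) * indicator ?Q y + ennreal (norm (level_avg b K y - h y)) * indicator ?Q y \<partial>lebesgue)"
  proof (intro nn_integral_mono)
    fix y
    have "norm (b y - level_avg b K y) \<le> norm (b y - h y) + norm (level_avg b K y - h y)"
      using norm_triangle_ineq4[of "b y - h y" "level_avg b K y - h y"] by simp
    then have "ennreal (norm (b y - level_avg b K y)) \<le> ennreal (norm (b y - h y)) + ennreal (norm (level_avg b K y - h y))"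
      by (simp add: ennreal_leI flip: ennreal_plus)
    then show "ennreal (norm (b y - level_avg b K y)) * indicator ?Q y \<le>
       ennreal (norm (b y - h y)) * indicator ?Q y + ennreal (norm (level_avg b K y - h y)) * indicator ?Q y"
      by (auto simp: indicator_def)
  qed
  also have "\<dots> = (\<integral>\<^sup>+y\<in>?Q. ennreal (norm (b y - h y)) \<partial>lebesgue) + (\<integral>\<^sup>+y\<in>?Q. ennreal (norm (level_avg b K y - h y)) \<partial>lebesgue)"
    by (rule nn_integral_add) measurable
  also have "\<dots> \<le> ennreal (e / 2) + ennreal (e / 2)" using bh Ah by (rule add_mono)
  also have "\<dots> = ennreal e" using e by (simp flip: ennreal_plus)
  finally show ?thesis by (intro exI[of _ K]) (auto simp: K_def)
qed

text \<open>
  The limit \<open>K \<rightarrow> \<infinity>\<close> of \<open>level_avg_oscillation\<close>. Convergence of the averages in \<open>L^1\<close> suffices when \<open>g\<close>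
  is bounded, and truncation with monotone convergence handles the general case.
\<close>

theorem bmo_maximal_domination:
  fixes b :: "'a \<Rightarrow> 'b::{banach, second_countable_topology}"
  assumes b: "loc_integrable b" and \<nu>: "cell_measure \<nu>" and B: "0 < B" and C: "0 \<le> C"
    and half: "\<And>Q E. Q \<in> cells \<Longrightarrow> E \<in> sets lebesgue \<Longrightarrow> E \<subseteq> Q \<Longrightarrow> emeasure lebesgue Q \<le> 2 * emeasure lebesgue E \<Longrightarrow>
        emeasure \<nu> Q \<le> ennreal C * emeasure \<nu> E"
    and osc: "\<And>Q. Q \<in> cells \<Longrightarrow> (\<integral>\<^sup>+x\<in>Q. ennreal (norm (b x - avg Q b)) \<partial>lebesgue) \<le> ennreal B * emeasure \<nu> Q"
    and g: "g \<in> borel_measurable lebesgue" and Q: "Q \<in> cells"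
  shows "(\<integral>\<^sup>+y\<in>Q. ennreal (norm (b y - avg Q b)) * g y \<partial>lebesgue) \<le>
     ennreal (2 ^ (DIM('a) + 1) * B * C) * (\<integral>\<^sup>+y\<in>Q. dyadic_max lebesgue g y \<partial>\<nu>)"
    (is "_ \<le> ?R")
proof -
  obtain k x where Qk: "Q = cell k x" using Q by (auto simp: cells_def)
  note g[measurable]
  have Qm [measurable]: "Q \<in> sets lebesgue" using Q cells_lebesgue by simp
  have bm [measurable]: "b \<in> borel_measurable lebesgue" using b by (rule loc_integrable_measurable)
  define gm where "gm n y = min (g y) (of_nat n)" for n y
  have gm [measurable]: "gm n \<in> borel_measurable lebesgue" for n unfolding gm_def by measurable
  have bounded_case: "(\<integral>\<^sup>+y\<in>Q. ennreal (norm (b y - avg Q b)) * gm n y \<partial>lebesgue) \<le> ?R" for n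
  proof (rule ennreal_le_epsilon)
    fix e :: real assume e: "0 < e"
    define d where "d = e / (real n + 1)"
    have d: "0 < d" using e by (simp add: d_def)
    obtain K where K: "k \<le> K" "(\<integral>\<^sup>+y\<in>Q. ennreal (norm (b y - level_avg b K y)) \<partial>lebesgue) \<le> ennreal d"
      using level_avg_L1_approx[OF b d, of k x] Qk by auto
    have "(\<integral>\<^sup>+y\<in>Q. ennreal (norm (b y - avg Q b)) * gm n y \<partial>lebesgue) \<le>
       (\<integral>\<^sup>+y. ennreal (norm (level_avg b K y - avg Q b)) * gm n y * indicator Q y +
          of_nat n * (ennreal (norm (b y - level_avg b K y)) * indicator Q y) \<partial>lebesgue)"
    proof (intro nn_integral_mono)
      fix y
      have "norm (b y - avg Q b) \<le> norm (level_avg b K y - avg Q b) + norm (b y - level_avg b K y)"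
        using norm_triangle_ineq[of "level_avg b K y - avg Q b" "b y - level_avg b K y"] by simp
      then have "ennreal (norm (b y - avg Q b)) \<le> ennreal (norm (level_avg b K y - avg Q b)) + ennreal (norm (b y - level_avg b K y))"
        by (simp add: ennreal_leI flip: ennreal_plus)
      then have "ennreal (norm (b y - avg Q b)) * gm n y \<le>
         (ennreal (norm (level_avg b K y - avg Q b)) + ennreal (norm (b y - level_avg b K y))) * gm n y"
        by (rule mult_right_mono) simp
      also have "\<dots> \<le> ennreal (norm (level_avg b K y - avg Q b)) * gm n y + ennreal (norm (b y - level_avg b K y)) * of_nat n"
        unfolding distrib_right by (intro add_left_mono mult_left_mono) (auto simp: gm_def)
      finally show "ennreal (norm (b y - avg Q b)) * gm n y * indicator Q y \<le> ennreal (norm (level_avg b K y - avg Q b)) * gm n y * indicator Q y +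
          of_nat n * (ennreal (norm (b y - level_avg b K y)) * indicator Q y)"
        by (auto simp: indicator_def mult.commute)
    qed
    also have "\<dots> = (\<integral>\<^sup>+y\<in>Q. ennreal (norm (level_avg b K y - avg Q b)) * gm n y \<partial>lebesgue) +
        of_nat n * (\<integral>\<^sup>+y\<in>Q. ennreal (norm (b y - level_avg b K y)) \<partial>lebesgue)"
      by (subst nn_integral_add) (auto simp: nn_integral_cmult)
    also have "\<dots> \<le> ?R + ennreal e"
    proof (rule add_mono)
      have "(\<integral>\<^sup>+y\<in>Q. ennreal (norm (level_avg b K y - avg Q b)) * gm n y \<partial>lebesgue) \<le>
          ennreal (2 ^ (DIM('a) + 1) * B * C) * (\<integral>\<^sup>+y\<in>Q. dyadic_max lebesgue (gm n) y \<partial>\<nu>)"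
        unfolding Qk by (intro level_avg_oscillation[OF b \<nu> B C half osc gm K(1)])
      also have "\<dots> \<le> ?R"
        by (intro mult_left_mono nn_integral_mono mult_right_mono dyadic_max_mono) (auto simp: gm_def)
      finally show "(\<integral>\<^sup>+y\<in>Q. ennreal (norm (level_avg b K y - avg Q b)) * gm n y \<partial>lebesgue) \<le> ?R" .
      have "of_nat n * (\<integral>\<^sup>+y\<in>Q. ennreal (norm (b y - level_avg b K y)) \<partial>lebesgue) \<le> of_nat n * ennreal d"
        by (intro mult_left_mono K) simp
      also have "\<dots> = ennreal (real n * d)"
        using d by (simp add: ennreal_of_nat_eq_real_of_nat ennreal_mult'[symmetric])
      also have "\<dots> \<le> ennreal e"
        using e by (intro ennreal_leI) (simp add: d_def field_simps)
      finally show "of_nat n * (\<integral>\<^sup>+y\<in>Q. ennreal (norm (b y - level_avg b K y)) \<partial>lebesgue) \<le> ennreal e" .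
    qed
    finally show "(\<integral>\<^sup>+y\<in>Q. ennreal (norm (b y - avg Q b)) * gm n y \<partial>lebesgue) \<le> ?R + ennreal e" .
  qed
  have "(SUP n. gm n y) = g y" for y
  proof (rule antisym)
    show "(SUP n. gm n y) \<le> g y" by (rule SUP_least) (simp add: gm_def)
    show "g y \<le> (SUP n. gm n y)"
    proof (rule dense_le)
      fix z assume z: "z < g y"
      then obtain n where n: "z < of_nat n" using ennreal_Ex_less_of_nat by (metis less_le_trans top_greatest)
      then have "z \<le> gm n y" using z by (simp add: gm_def less_imp_le)
      then show "z \<le> (SUP n. gm n y)" by (rule order_trans) (rule SUP_upper, simp)
    qed
  qed
  then have "(\<integral>\<^sup>+y\<in>Q. ennreal (norm (b y - avg Q b)) * g y \<partial>lebesgue) =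
      (\<integral>\<^sup>+y. (SUP n. ennreal (norm (b y - avg Q b)) * gm n y * indicator Q y) \<partial>lebesgue)"
    by (simp add: SUP_mult_left_ennreal[symmetric] SUP_mult_right_ennreal[symmetric])
  also have "\<dots> = (SUP n. (\<integral>\<^sup>+y\<in>Q. ennreal (norm (b y - avg Q b)) * gm n y \<partial>lebesgue))"
  proof (rule nn_integral_monotone_convergence_SUP)
    show "incseq (\<lambda>n y. ennreal (norm (b y - avg Q b)) * gm n y * indicator Q y)"
      unfolding incseq_def le_fun_def gm_def
      by (intro allI impI mult_right_mono mult_left_mono min.mono) auto
  qed measurable
  also have "\<dots> \<le> ?R" by (rule SUP_least) (rule bounded_case)
  finally show ?thesis .
qed

end

section \<open>Shifted grids and the Riesz kernel\<close>

text \<open>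
  In the coordinates \<open>T\<close> the grid is shifted by a third of the side, with alternating sign: since
  \<open>2 / 3 = 1 - 1 / 3\<close>, the end points of one generation are again end points of the next one.
\<close>

definition grid_offset :: "'a::euclidean_space set \<Rightarrow> int \<Rightarrow> 'a \<Rightarrow> real"
  where "grid_offset T k i = (if i \<in> T then (if even k then 1/3 else - 1/3) else 0)"

definition shifted_cell :: "'a::euclidean_space set \<Rightarrow> int \<Rightarrow> 'a \<Rightarrow> 'a set"
  where "shifted_cell T k x = {y. \<forall>i\<in>Basis.
    \<lfloor>y \<bullet> i / side k - grid_offset T k i\<rfloor> = \<lfloor>x \<bullet> i / side k - grid_offset T k i\<rfloor>}"

lemma floor_double_eq:
  fixes a c :: real
  assumes "\<lfloor>2 * a\<rfloor> = \<lfloor>2 * c\<rfloor>"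
  shows "\<lfloor>a\<rfloor> = \<lfloor>c\<rfloor>"
proof -
  have "2 * \<lfloor>a\<rfloor> \<le> \<lfloor>2 * a\<rfloor>" "\<lfloor>2 * a\<rfloor> \<le> 2 * \<lfloor>a\<rfloor> + 1" "2 * \<lfloor>c\<rfloor> \<le> \<lfloor>2 * c\<rfloor>" "\<lfloor>2 * c\<rfloor> \<le> 2 * \<lfloor>c\<rfloor> + 1"
    by linarith+
  then show ?thesis using assms by presburger
qed

theorem shifted_grid: "dyadic_grid (shifted_cell T)"
proof
  fix x y :: 'a and k :: int
  show "x \<in> shifted_cell T k x" by (simp add: shifted_cell_def)
  show "y \<in> shifted_cell T k x \<Longrightarrow> shifted_cell T k y = shifted_cell T k x"
    by (auto simp: shifted_cell_def)
  show "shifted_cell T (k + 1) x \<subseteq> shifted_cell T k x"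
  proof
    fix y assume y: "y \<in> shifted_cell T (k + 1) x"
    have "\<lfloor>y \<bullet> i / side k - grid_offset T k i\<rfloor> = \<lfloor>x \<bullet> i / side k - grid_offset T k i\<rfloor>" if i: "i \<in> Basis" for i
    proof (rule floor_double_eq)
      define j :: int where "j = (if i \<in> T then (if even k then 1 else - 1) else 0)"
      have *: "z / side (k + 1) - grid_offset T (k + 1) i = 2 * (z / side k - grid_offset T k i) + of_int j" for z
        unfolding side_Suc by (auto simp: grid_offset_def j_def field_simps)
      have "\<lfloor>y \<bullet> i / side (k + 1) - grid_offset T (k + 1) i\<rfloor> = \<lfloor>x \<bullet> i / side (k + 1) - grid_offset T (k + 1) i\<rfloor>"
        using y i unfolding shifted_cell_def by blast
      then show "\<lfloor>2 * (y \<bullet> i / side k - grid_offset T k i)\<rfloor> = \<lfloor>2 * (x \<bullet> i / side k - grid_offset T k i)\<rfloor>"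
        unfolding * floor_add_int[symmetric] by (rule add_right_imp_eq)
    qed
    then show "y \<in> shifted_cell T k x" by (simp add: shifted_cell_def)
  qed
  show "countable (range (shifted_cell T k))"
  proof (rule countable_subset)
    show "range (shifted_cell T k) \<subseteq> (\<lambda>m. {y. \<forall>i\<in>Basis. \<lfloor>y \<bullet> i / side k - grid_offset T k i\<rfloor> = m i}) ` (PiE Basis (\<lambda>_. UNIV))"
    proof
      fix Q assume "Q \<in> range (shifted_cell T k)"
      then obtain x where "Q = shifted_cell T k x" by auto
      define m where "m = restrict (\<lambda>i. \<lfloor>x \<bullet> i / side k - grid_offset T k i\<rfloor>) Basis"
      have "Q = {y. \<forall>i\<in>Basis. \<lfloor>y \<bullet> i / side k - grid_offset T k i\<rfloor> = m i}"
        unfolding \<open>Q = _\<close> shifted_cell_def m_def by auto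
      moreover have "m \<in> PiE Basis (\<lambda>_. UNIV)" by (simp add: m_def)
      ultimately show "Q \<in> (\<lambda>m. {y. \<forall>i\<in>Basis. \<lfloor>y \<bullet> i / side k - grid_offset T k i\<rfloor> = m i}) ` (PiE Basis (\<lambda>_. UNIV))"
        by blast
    qed
    show "countable ((\<lambda>m. {y. \<forall>i\<in>Basis. \<lfloor>y \<bullet> i / side k - grid_offset T k i\<rfloor> = m i}) ` (PiE Basis (\<lambda>_. UNIV :: int set)))"
      by (intro countable_image countable_PiE) auto
  qed
  define m where "m i = \<lfloor>x \<bullet> i / side k - grid_offset T k i\<rfloor>" for i
  define a where "a = (\<Sum>i\<in>Basis. (side k * (of_int (m i) + grid_offset T k i)) *\<^sub>R i)"
  have ai: "a \<bullet> i = side k * (of_int (m i) + grid_offset T k i)" if "i \<in> Basis" for i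
    unfolding a_def using that by simp
  have "\<lfloor>y \<bullet> i / side k - grid_offset T k i\<rfloor> = m i \<longleftrightarrow> a \<bullet> i \<le> y \<bullet> i \<and> y \<bullet> i < a \<bullet> i + side k" if "i \<in> Basis" for i y
  proof -
    have "\<lfloor>y \<bullet> i / side k - grid_offset T k i\<rfloor> = m i \<longleftrightarrow>
       of_int (m i) + grid_offset T k i \<le> y \<bullet> i / side k \<and> y \<bullet> i / side k < of_int (m i) + grid_offset T k i + 1"
      by (auto simp: floor_eq_iff)
    then show ?thesis unfolding ai[OF that] by (simp add: le_divide_eq divide_less_eq distrib_left mult_ac)
  qed
  then have "shifted_cell T k x = {y. \<forall>i\<in>Basis. a \<bullet> i \<le> y \<bullet> i \<and> y \<bullet> i < a \<bullet> i + side k}"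
    unfolding shifted_cell_def m_def by auto
  then show "\<exists>a. box a (a + side k *\<^sub>R One) \<subseteq> shifted_cell T k x \<and> shifted_cell T k x \<subseteq> cbox a (a + side k *\<^sub>R One)"
    by (intro exI[of _ a]) (auto simp: mem_box inner_simps less_imp_le)
qed

text \<open>
  In one coordinate, the end points of the shifted and of the unshifted intervals of generation \<open>k\<close> are at
  least \<open>side k / 3\<close> apart. If \<open>x\<close> and \<open>y\<close> are no farther apart than that and an end point of the unshifted
  grid separates them, then no end point of the shifted grid does. The set \<open>T\<close> collects the coordinates in which this happens.
\<close>

lemma shifted_cell_contains_pair:
  fixes x y :: "'a::euclidean_space"
  assumes "x \<noteq> y"
  shows "\<exists>T\<subseteq>Basis. \<exists>k. y \<in> shifted_cell T k x \<and> side k \<le> 6 * norm (x - y)"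
proof -
  define d where "d = norm (x - y)"
  have d: "0 < d" using assms by (simp add: d_def)
  obtain k where k: "side k < 6 * d" "6 * d \<le> 2 * side k" using side_bracket[of "6 * d"] d by auto
  define T where "T = {i \<in> Basis. \<lfloor>y \<bullet> i / side k\<rfloor> \<noteq> \<lfloor>x \<bullet> i / side k\<rfloor>}"
  have "\<lfloor>y \<bullet> i / side k - grid_offset T k i\<rfloor> = \<lfloor>x \<bullet> i / side k - grid_offset T k i\<rfloor>" if i: "i \<in> Basis" for i
  proof (cases "i \<in> T")
    case False
    then show ?thesis using i by (simp add: T_def grid_offset_def)
  next
    case True
    define X where "X = x \<bullet> i / side k"
    define Y where "Y = y \<bullet> i / side k"
    have "\<bar>x \<bullet> i - y \<bullet> i\<bar> \<le> d" using Basis_le_norm[OF i, of "x - y"] by (simp add: d_def inner_diff_left)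
    then have "\<bar>x \<bullet> i - y \<bullet> i\<bar> \<le> (1/3) * side k" using k by simp
    moreover have "X - Y = (x \<bullet> i - y \<bullet> i) / side k" by (simp add: X_def Y_def diff_divide_distrib)
    ultimately have XY: "\<bar>X - Y\<bar> \<le> 1/3" by (simp add: abs_divide divide_le_eq abs_of_pos)
    have ne: "\<lfloor>Y\<rfloor> \<noteq> \<lfloor>X\<rfloor>" using True by (simp add: T_def X_def Y_def)
    have key: "\<lfloor>V - 1/3\<rfloor> = \<lfloor>U - 1/3\<rfloor> \<and> \<lfloor>V + 1/3\<rfloor> = \<lfloor>U + 1/3\<rfloor>" if "U < V" "V - U \<le> 1/3" "\<lfloor>U\<rfloor> \<noteq> \<lfloor>V\<rfloor>" for U V :: real
    proof -
      define m where "m = \<lfloor>V\<rfloor>"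
      have "\<lfloor>U\<rfloor> \<le> \<lfloor>V\<rfloor>" using that(1) by (intro floor_mono) simp
      then have "\<lfloor>U\<rfloor> < m" using that(3) by (simp add: m_def)
      then have U: "U < of_int m" by (simp add: floor_less_iff)
      have V: "of_int m \<le> V" by (simp add: m_def)
      have "\<lfloor>V - 1/3\<rfloor> = m - 1" "\<lfloor>U - 1/3\<rfloor> = m - 1" "\<lfloor>V + 1/3\<rfloor> = m" "\<lfloor>U + 1/3\<rfloor> = m"
        using U V that by (intro floor_unique; simp)+
      then show ?thesis by simp
    qed
    have "\<lfloor>Y - 1/3\<rfloor> = \<lfloor>X - 1/3\<rfloor> \<and> \<lfloor>Y + 1/3\<rfloor> = \<lfloor>X + 1/3\<rfloor>"
    proof (cases "X < Y")
      case True
      then show ?thesis using key[of X Y] XY ne by auto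
    next
      case False
      then have "Y < X" using ne by (metis less_eq_real_def not_less)
      then show ?thesis using key[of Y X] XY ne by auto
    qed
    then show ?thesis using True unfolding X_def Y_def by (auto simp: grid_offset_def)
  qed
  then have "y \<in> shifted_cell T k x" by (simp add: shifted_cell_def)
  then show ?thesis using k by (intro exI[of _ T]) (auto simp: T_def d_def less_imp_le)
qed

lemma borel_measurable_nn_integral_countable:
  fixes f :: "'i \<Rightarrow> 'a \<Rightarrow> ennreal"
  assumes "countable I" "\<And>i. i \<in> I \<Longrightarrow> f i \<in> borel_measurable M"
  shows "(\<lambda>x. \<integral>\<^sup>+i. f i x \<partial>count_space I) \<in> borel_measurable M"
proof (cases "finite I")
  case True
  then show ?thesis using assms by (simp add: nn_integral_count_space_finite)
next
  case False
  have bij: "bij_betw (from_nat_into I) UNIV I" using assms False by (intro bij_betw_from_nat_into)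
  have "(\<integral>\<^sup>+i. f i x \<partial>count_space I) = (\<Sum>n. f (from_nat_into I n) x)" for x
    using nn_integral_bij_count_space[OF bij, of "\<lambda>i. f i x"] by (simp add: nn_integral_count_space_nat)
  moreover have "f (from_nat_into I n) \<in> borel_measurable M" for n
    using bij assms(2) by (auto simp: bij_betw_def)
  ultimately show ?thesis by simp
qed

context dyadic_grid
begin

lemma measure_cell: "measure lebesgue (cell k x) = side k ^ DIM('a)"
  by (simp add: measure_def emeasure_cell del: emeasure_completion)

lemma measure_cell_powr: "measure lebesgue (cell k x) powr (- (e / real DIM('a))) = side k powr (- e)"
  by (simp add: measure_cell powr_powr flip: powr_realpow)

definition cell_potential :: "real \<Rightarrow> ('a \<Rightarrow> ennreal) \<Rightarrow> 'a \<Rightarrow> ennreal"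
  where "cell_potential c h x = (\<integral>\<^sup>+Q. ennreal (measure lebesgue Q powr c) * (\<integral>\<^sup>+y\<in>Q. h y \<partial>lebesgue) * indicator Q x \<partial>count_space cells)"

text \<open>
  The cells of measure at most 1 contribute a function with finite integral, because \<open>c > -1\<close>; the larger ones
  a bounded function, because \<open>c < 0\<close>.
\<close>

lemma cell_potential_finite_AE:
  assumes c: "-1 < c" "c < 0" and h: "h \<in> borel_measurable lebesgue" "(\<integral>\<^sup>+y. h y \<partial>lebesgue) < top"
  shows "AE x in lebesgue. cell_potential c h x < top"
proof -
  note h(1)[measurable]
  let ?I = "\<integral>\<^sup>+y. h y \<partial>lebesgue"
  define \<Psi> where "\<Psi> Q = ennreal (measure lebesgue Q powr c) * (\<integral>\<^sup>+y\<in>Q. h y \<partial>lebesgue)" for Q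
  define S where "S Q \<longleftrightarrow> measure lebesgue Q \<le> 1" for Q :: "'a set"
  define small where "small x = (\<integral>\<^sup>+Q. (if S Q then \<Psi> Q else 0) * indicator Q x \<partial>count_space cells)" for x
  define large where "large x = (\<integral>\<^sup>+Q. (if S Q then 0 else \<Psi> Q) * indicator Q x \<partial>count_space cells)" for x
  define s where "s k = side k ^ DIM('a)" for k
  have spos: "0 < s k" for k by (simp add: s_def)
  have sSuc: "s (k + 1) \<le> (1/2) * s k" for k
  proof -
    have "(2::real) ^ 1 \<le> 2 ^ DIM('a)" by (intro power_increasing) (auto simp: DIM_ge_Suc0)
    then show ?thesis unfolding s_def side_Suc by (simp add: power_divide divide_simps)
  qed
  have geo: "(\<integral>\<^sup>+k. (if s k \<le> 1 then ennreal (s k powr \<gamma>) else 0) \<partial>count_space UNIV) < top" if "0 < \<gamma>" for \<gamma>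
  proof -
    have "(\<integral>\<^sup>+k. (if s k \<le> 1 then ennreal (s k powr \<gamma>) else 0) \<partial>count_space UNIV) \<le> ennreal (1 powr \<gamma> / (1 - (1/2) powr \<gamma>))"
      by (rule geometric_level_sum[of s "1/2" \<gamma> 1]) (use spos sSuc that in auto)
    then show ?thesis using ennreal_less_top le_less_trans by blast
  qed
  have eq: "cell_potential c h x = small x + large x" for x
    unfolding cell_potential_def small_def large_def
    by (subst nn_integral_add[symmetric]) (auto intro!: nn_integral_cong simp: \<Psi>_def)
  have small_m: "small \<in> borel_measurable lebesgue"
    unfolding small_def
    by (intro borel_measurable_nn_integral_countable countable_all_cells) (use cells_lebesgue in measurable)
  have "(\<integral>\<^sup>+x. small x \<partial>lebesgue) = (\<integral>\<^sup>+Q. (\<integral>\<^sup>+x. (if S Q then \<Psi> Q else 0) * indicator Q x \<partial>lebesgue) \<partial>count_space cells)"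
    unfolding small_def
    by (intro nn_integral_count_space_nn_integral countable_all_cells) (use cells_lebesgue in measurable)
  also have "\<dots> = (\<integral>\<^sup>+Q. (if S Q then ennreal (measure lebesgue Q powr (c + 1)) else 0) * (\<integral>\<^sup>+y\<in>Q. h y \<partial>lebesgue) \<partial>count_space cells)"
  proof (intro nn_integral_cong)
    fix Q assume "Q \<in> space (count_space cells)"
    then have Q: "Q \<in> cells" by simp
    have "(\<integral>\<^sup>+x. (if S Q then \<Psi> Q else 0) * indicator Q x \<partial>lebesgue) = (if S Q then \<Psi> Q else 0) * emeasure lebesgue Q"
      using cells_lebesgue[OF Q] by (rule nn_integral_cmult_indicator)
    moreover have "emeasure lebesgue Q = ennreal (measure lebesgue Q)" "0 < measure lebesgue Q"
      using Q by (auto simp: cells_def emeasure_cell measure_cell)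
    ultimately show "(\<integral>\<^sup>+x. (if S Q then \<Psi> Q else 0) * indicator Q x \<partial>lebesgue) =
       (if S Q then ennreal (measure lebesgue Q powr (c + 1)) else 0) * (\<integral>\<^sup>+y\<in>Q. h y \<partial>lebesgue)"
      by (simp add: \<Psi>_def powr_add ennreal_mult' mult_ac)
  qed
  also have "\<dots> = (\<integral>\<^sup>+x. h x * (\<integral>\<^sup>+k. (if S (cell k x) then ennreal (measure lebesgue (cell k x) powr (c + 1)) else 0) \<partial>count_space UNIV) \<partial>lebesgue)"
    by (rule sum_over_cells[OF refl h(1)])
  also have "\<dots> = (\<integral>\<^sup>+k. (if s k \<le> 1 then ennreal (s k powr (c + 1)) else 0) \<partial>count_space UNIV) * ?I"
    unfolding S_def measure_cell s_def[symmetric] by (subst nn_integral_multc) (auto simp: mult.commute)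
  also have "\<dots> < top"
    using geo[of "c + 1"] c h(2) by (simp add: ennreal_mult_less_top)
  finally have "(\<integral>\<^sup>+x. small x \<partial>lebesgue) \<noteq> \<infinity>" by simp
  then have small_fin: "AE x in lebesgue. small x \<noteq> \<infinity>"
    using small_m by (intro nn_integral_PInf_AE)
  have large_fin: "large x < top" for x
  proof -
    \<comment> \<open>Reversing the order of the generations turns the large cells into a geometric series of the kind
      already summed.\<close>
    have s_neg: "s (- k) = 1 / s k" for k
      by (simp add: s_def side_def powr_minus power_inverse divide_inverse flip: power_inverse)
    have "large x = (\<integral>\<^sup>+k. (if s k \<le> 1 then 0 else \<Psi> (cell k x)) \<partial>count_space UNIV)"
      unfolding large_def sum_over_cells_at by (simp add: S_def measure_cell s_def)
    also have "\<dots> \<le> (\<integral>\<^sup>+k. ?I * (if s k \<le> 1 then 0 else ennreal (s k powr c)) \<partial>count_space UNIV)"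
    proof (rule nn_integral_mono)
      fix k
      have "(\<integral>\<^sup>+y\<in>cell k x. h y \<partial>lebesgue) \<le> ?I" by (intro nn_integral_mono) (auto simp: indicator_def)
      then have "\<Psi> (cell k x) \<le> ennreal (s k powr c) * ?I"
        unfolding \<Psi>_def measure_cell s_def[symmetric] by (rule mult_left_mono) simp
      then show "(if s k \<le> 1 then 0 else \<Psi> (cell k x)) \<le> ?I * (if s k \<le> 1 then 0 else ennreal (s k powr c))"
        by (simp add: mult.commute)
    qed
    also have "\<dots> = ?I * (\<integral>\<^sup>+k. (if s k \<le> 1 then 0 else ennreal (s k powr c)) \<partial>count_space UNIV)"
      by (rule nn_integral_cmult) simp
    also have "(\<integral>\<^sup>+k. (if s k \<le> 1 then 0 else ennreal (s k powr c)) \<partial>count_space UNIV) =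
        (\<integral>\<^sup>+k. (if s (- k) \<le> 1 then 0 else ennreal (s (- k) powr c)) \<partial>count_space UNIV)"
      by (rule nn_integral_bij_count_space[symmetric, of uminus UNIV UNIV "\<lambda>k. if s k \<le> 1 then 0 else ennreal (s k powr c)"])
         (auto simp: bij_betw_def inj_on_def intro!: surjI[of uminus uminus])
    also have "?I * (\<integral>\<^sup>+k. (if s (- k) \<le> 1 then 0 else ennreal (s (- k) powr c)) \<partial>count_space UNIV) \<le>
        ?I * (\<integral>\<^sup>+k. (if s k \<le> 1 then ennreal (s k powr (- c)) else 0) \<partial>count_space UNIV)"
    proof (intro mult_left_mono nn_integral_mono)
      fix k
      have "(1 / s k) powr c = s k powr (- c)" using spos[of k] by (simp add: powr_divide powr_minus_divide)
      then show "(if s (- k) \<le> 1 then 0 else ennreal (s (- k) powr c)) \<le> (if s k \<le> 1 then ennreal (s k powr (- c)) else 0)"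
        unfolding s_neg using spos[of k] by (auto simp: divide_le_eq)
    qed simp
    also have "\<dots> < top" using geo[of "- c"] c h(2) by (simp add: ennreal_mult_less_top)
    finally show ?thesis .
  qed
  from small_fin show ?thesis
    by eventually_elim (use large_fin in \<open>simp add: eq less_top[symmetric]\<close>)
qed

end

text \<open>
  The single cell of comparable size that contains both \<open>x\<close> and \<open>y\<close> already bounds the kernel.
\<close>

theorem kernel_le_cell_sum:
  fixes x :: "'a::euclidean_space"
  assumes e: "0 < e" and h: "h \<in> borel_measurable lebesgue"
  shows "(\<integral>\<^sup>+y. h y * ennreal (norm (x - y) powr (- e)) \<partial>lebesgue) \<le>
    ennreal (6 powr e) * (\<Sum>T\<in>Pow Basis. (\<integral>\<^sup>+Q. ennreal (measure lebesgue Q powr (- (e / real DIM('a)))) *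
       (\<integral>\<^sup>+y\<in>Q. h y \<partial>lebesgue) * indicator Q x \<partial>count_space (dyadic_grid.cells (shifted_cell T))))"
proof -
  note h[measurable]
  define c where "c = - (e / real DIM('a))"
  define D where "D T = dyadic_grid.cells (shifted_cell T)" for T :: "'a set"
  have D: "countable (D T)" "Q \<in> D T \<Longrightarrow> Q \<in> sets lebesgue" for T Q
  proof -
    interpret dyadic_grid "shifted_cell T" by (rule shifted_grid)
    show "countable (D T)" "Q \<in> D T \<Longrightarrow> Q \<in> sets lebesgue" by (auto simp: D_def cells_lebesgue)
  qed
  have kernel: "ennreal (norm (x - y) powr (- e)) \<le>
     ennreal (6 powr e) * (\<Sum>T\<in>Pow Basis. (\<integral>\<^sup>+Q. ennreal (measure lebesgue Q powr c) * (indicator Q x * indicator Q y) \<partial>count_space (D T)))" for y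
  proof (cases "x = y")
    case False
    then obtain T k where T: "T \<subseteq> Basis" "y \<in> shifted_cell T k x" "side k \<le> 6 * norm (x - y)"
      using shifted_cell_contains_pair by blast
    interpret dyadic_grid "shifted_cell T" by (rule shifted_grid)
    let ?Q = "shifted_cell T k x"
    have "norm (x - y) powr (- e) \<le> 6 powr e * side k powr (- e)"
    proof -
      have "(6 * norm (x - y)) powr (- e) \<le> side k powr (- e)"
        using T(3) e by (intro powr_mono2') auto
      then have "6 powr e * (6 * norm (x - y)) powr (- e) \<le> 6 powr e * side k powr (- e)"
        by (intro mult_left_mono) auto
      moreover have "6 powr e * (6 * norm (x - y)) powr (- e) = norm (x - y) powr (- e)"
        by (simp add: powr_mult powr_minus)
      ultimately show ?thesis by simp
    qed
    then have "ennreal (norm (x - y) powr (- e)) \<le> ennreal (6 powr e * measure lebesgue ?Q powr c)"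
      unfolding c_def measure_cell_powr by (rule ennreal_leI)
    also have "\<dots> = ennreal (6 powr e) * (ennreal (measure lebesgue ?Q powr c) * (indicator ?Q x * indicator ?Q y))"
      using T by (simp add: ennreal_mult)
    also have "\<dots> \<le> ennreal (6 powr e) * (\<integral>\<^sup>+Q. ennreal (measure lebesgue Q powr c) * (indicator Q x * indicator Q y) \<partial>count_space (D T))"
      by (intro mult_left_mono nn_integral_ge_point) (auto simp: D_def)
    also have "\<dots> \<le> ennreal (6 powr e) * (\<Sum>T\<in>Pow Basis. (\<integral>\<^sup>+Q. ennreal (measure lebesgue Q powr c) * (indicator Q x * indicator Q y) \<partial>count_space (D T)))"
      using T(1) by (intro mult_left_mono member_le_sum[of T "Pow Basis" "\<lambda>T. \<integral>\<^sup>+Q. ennreal (measure lebesgue Q powr c) * (indicator Q x * indicator Q y) \<partial>count_space (D T)"]) auto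
    finally show ?thesis .
  qed simp
  have m: "(\<lambda>y. ennreal (measure lebesgue Q powr c) * (indicator Q x * (h y * indicator Q y))) \<in> borel_measurable lebesgue" if "Q \<in> D T" for Q T
  proof -
    have [measurable]: "Q \<in> sets lebesgue" using D that by blast
    show ?thesis by measurable
  qed
  have "(\<integral>\<^sup>+y. h y * ennreal (norm (x - y) powr (- e)) \<partial>lebesgue) \<le>
    (\<integral>\<^sup>+y. ennreal (6 powr e) * (\<Sum>T\<in>Pow Basis. (\<integral>\<^sup>+Q. ennreal (measure lebesgue Q powr c) * (indicator Q x * (h y * indicator Q y)) \<partial>count_space (D T))) \<partial>lebesgue)"
  proof (rule nn_integral_mono)
    fix y
    have "h y * ennreal (norm (x - y) powr (- e)) \<le> h y * (ennreal (6 powr e) * (\<Sum>T\<in>Pow Basis. (\<integral>\<^sup>+Q. ennreal (measure lebesgue Q powr c) * (indicator Q x * indicator Q y) \<partial>count_space (D T))))"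
      by (intro mult_left_mono kernel) simp
    also have "\<dots> = ennreal (6 powr e) * (\<Sum>T\<in>Pow Basis. (\<integral>\<^sup>+Q. h y * (ennreal (measure lebesgue Q powr c) * (indicator Q x * indicator Q y)) \<partial>count_space (D T)))"
      by (simp add: nn_integral_cmult sum_distrib_left mult_ac)
    also have "\<dots> = ennreal (6 powr e) * (\<Sum>T\<in>Pow Basis. (\<integral>\<^sup>+Q. ennreal (measure lebesgue Q powr c) * (indicator Q x * (h y * indicator Q y)) \<partial>count_space (D T)))"
      by (simp only: mult_ac)
    finally show "h y * ennreal (norm (x - y) powr (- e)) \<le> ennreal (6 powr e) * (\<Sum>T\<in>Pow Basis. (\<integral>\<^sup>+Q. ennreal (measure lebesgue Q powr c) * (indicator Q x * (h y * indicator Q y)) \<partial>count_space (D T)))" .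
  qed
  also have "\<dots> = ennreal (6 powr e) * (\<Sum>T\<in>Pow Basis. (\<integral>\<^sup>+y. (\<integral>\<^sup>+Q. ennreal (measure lebesgue Q powr c) * (indicator Q x * (h y * indicator Q y)) \<partial>count_space (D T)) \<partial>lebesgue))"
    using m D by (subst nn_integral_cmult; (subst nn_integral_sum)?) (auto intro!: borel_measurable_sum borel_measurable_nn_integral_countable)
  also have "\<dots> = ennreal (6 powr e) * (\<Sum>T\<in>Pow Basis. (\<integral>\<^sup>+Q. (\<integral>\<^sup>+y. ennreal (measure lebesgue Q powr c) * (indicator Q x * (h y * indicator Q y)) \<partial>lebesgue) \<partial>count_space (D T)))"
    using m D by (intro arg_cong2[where f="(*)"] refl sum.cong nn_integral_count_space_nn_integral) auto
  also have "\<dots> = ennreal (6 powr e) * (\<Sum>T\<in>Pow Basis. (\<integral>\<^sup>+Q. ennreal (measure lebesgue Q powr c) * (\<integral>\<^sup>+y\<in>Q. h y \<partial>lebesgue) * indicator Q x \<partial>count_space (D T)))"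
  proof (intro arg_cong2[where f="(*)"] refl sum.cong nn_integral_cong)
    fix T Q assume "Q \<in> space (count_space (D T))"
    then have [measurable]: "Q \<in> sets lebesgue" using D by simp
    have "(\<integral>\<^sup>+y. ennreal (measure lebesgue Q powr c) * (indicator Q x * (h y * indicator Q y)) \<partial>lebesgue) =
       ennreal (measure lebesgue Q powr c) * (indicator Q x * (\<integral>\<^sup>+y\<in>Q. h y \<partial>lebesgue))"
      by (subst nn_integral_cmult, measurable, subst nn_integral_cmult, measurable)
    then show "(\<integral>\<^sup>+y. ennreal (measure lebesgue Q powr c) * (indicator Q x * (h y * indicator Q y)) \<partial>lebesgue) =
       ennreal (measure lebesgue Q powr c) * (\<integral>\<^sup>+y\<in>Q. h y \<partial>lebesgue) * indicator Q x"
      by (simp add: mult_ac)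
  qed
  finally show ?thesis unfolding D_def c_def .
qed

lemma riesz_integrand_measurable [measurable]:
  "(\<lambda>y. norm (x - y) powr r) \<in> borel_measurable (lebesgue :: 'a::euclidean_space measure)"
  by (rule measurable_completion) measurable

theorem riesz_potential_converges_AE:
  fixes f :: "'a::euclidean_space \<Rightarrow> complex"
  assumes \<alpha>: "0 < \<alpha>" "\<alpha> < real DIM('a)" and f: "integrable lebesgue f"
  shows "AE x in lebesgue. integrable lebesgue (\<lambda>y. f y /\<^sub>R norm (x - y) powr (real DIM('a) - \<alpha>))"
proof -
  define e where "e = real DIM('a) - \<alpha>"
  have e: "0 < e" "- 1 < - (e / real DIM('a))" "- (e / real DIM('a)) < 0" using \<alpha> by (auto simp: e_def field_simps)
  have [measurable]: "f \<in> borel_measurable lebesgue" using f by simp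
  define h where "h y = ennreal (cmod (f y))" for y
  have hm [measurable]: "h \<in> borel_measurable lebesgue" unfolding h_def by measurable
  have hI: "(\<integral>\<^sup>+y. h y \<partial>lebesgue) < top" using f by (simp add: h_def integrable_iff_bounded)
  have "AE x in lebesgue. \<forall>T\<in>Pow (Basis :: 'a set). (\<integral>\<^sup>+Q. ennreal (measure lebesgue Q powr (- (e / real DIM('a)))) *
       (\<integral>\<^sup>+y\<in>Q. h y \<partial>lebesgue) * indicator Q x \<partial>count_space (dyadic_grid.cells (shifted_cell T))) < top"
  proof (rule AE_finite_allI)
    fix T :: "'a set"
    interpret dyadic_grid "shifted_cell T" by (rule shifted_grid)
    show "AE x in lebesgue. (\<integral>\<^sup>+Q. ennreal (measure lebesgue Q powr (- (e / real DIM('a)))) *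
       (\<integral>\<^sup>+y\<in>Q. h y \<partial>lebesgue) * indicator Q x \<partial>count_space cells) < top"
      using cell_potential_finite_AE[OF e(2,3) hm hI] unfolding cell_potential_def .
  qed simp
  then show ?thesis
  proof eventually_elim
    case (elim x)
    have "(\<Sum>T\<in>Pow Basis. (\<integral>\<^sup>+Q. ennreal (measure lebesgue Q powr (- (e / real DIM('a)))) *
       (\<integral>\<^sup>+y\<in>Q. h y \<partial>lebesgue) * indicator Q x \<partial>count_space (dyadic_grid.cells (shifted_cell T)))) < top"
      using elim by (simp add: less_top[symmetric])
    then have "ennreal (6 powr e) * (\<Sum>T\<in>Pow Basis. (\<integral>\<^sup>+Q. ennreal (measure lebesgue Q powr (- (e / real DIM('a)))) *
       (\<integral>\<^sup>+y\<in>Q. h y \<partial>lebesgue) * indicator Q x \<partial>count_space (dyadic_grid.cells (shifted_cell T)))) < top"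
      by (simp add: ennreal_mult_less_top)
    then have "(\<integral>\<^sup>+y. h y * ennreal (norm (x - y) powr (- e)) \<partial>lebesgue) < top"
      using kernel_le_cell_sum[OF e(1) hm, of x] by (rule le_less_trans[rotated])
    moreover have "(\<integral>\<^sup>+y. ennreal (norm (f y /\<^sub>R norm (x - y) powr e)) \<partial>lebesgue) = (\<integral>\<^sup>+y. h y * ennreal (norm (x - y) powr (- e)) \<partial>lebesgue)"
      by (intro nn_integral_cong) (simp add: h_def powr_minus ennreal_mult'[symmetric] mult.commute)
    ultimately show ?case
      unfolding e_def[symmetric] by (intro integrableI_bounded) auto
  qed
qed

section \<open>Weights of class \<open>A\<^sub>p\<^sub>q\<close>\<close>

lemma cube_measure:
  assumes "Q \<in> cubes"
  shows "Q \<in> sets lebesgue" "\<exists>m>0. emeasure lebesgue Q = ennreal m"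
proof -
  obtain a l where Q: "Q = cbox a (a + l *\<^sub>R One)" "0 < l" using assms by (auto simp: cubes_def)
  show "Q \<in> sets lebesgue" using Q by simp
  have "emeasure lebesgue Q = ennreal (l ^ DIM('a))"
    unfolding Q(1) using Q(2) by (simp add: emeasure_lborel_cbox_eq inner_simps less_imp_le)
  then show "\<exists>m>0. emeasure lebesgue Q = ennreal m" using Q(2) by (intro exI[of _ "l ^ DIM('a)"]) simp
qed

lemma nn_avg_scale:
  assumes "emeasure lebesgue Q = ennreal m" "0 < m"
  shows "nn_avg Q g = ennreal (1 / m) * (\<integral>\<^sup>+x\<in>Q. ennreal (g x) \<partial>lebesgue)"
  unfolding nn_avg_def assms(1) divide_ennreal_def using assms(2)
  by (simp add: inverse_ennreal mult.commute divide_inverse)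

lemma nn_avg_cong_AE:
  assumes "AE x in lebesgue. f x = g x"
  shows "nn_avg Q f = nn_avg Q g"
proof -
  have "(\<integral>\<^sup>+x\<in>Q. ennreal (f x) \<partial>lebesgue) = (\<integral>\<^sup>+x\<in>Q. ennreal (g x) \<partial>lebesgue)"
    using assms by (intro nn_integral_cong_AE) (auto elim: eventually_mono)
  then show ?thesis by (simp add: nn_avg_def)
qed

lemma nn_avg_Hoelder:
  fixes u v :: "'a::euclidean_space \<Rightarrow> real"
  assumes Q: "Q \<in> cubes" and p: "1 < p" "1 / p + 1 / p' = 1"
    and [measurable]: "u \<in> borel_measurable lebesgue" "v \<in> borel_measurable lebesgue"
  shows "nn_avg Q (\<lambda>x. u x powr r * v x powr s) \<le>
    ennpowr (nn_avg Q (\<lambda>x. u x powr (r * p))) (1 / p) * ennpowr (nn_avg Q (\<lambda>x. v x powr (s * p'))) (1 / p')"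
proof -
  have Qm [measurable]: "Q \<in> sets lebesgue" using cube_measure[OF Q] by simp
  obtain m where m: "0 < m" "emeasure lebesgue Q = ennreal m" using cube_measure[OF Q] by blast
  note sc = nn_avg_scale[OF m(2,1)]
  have p': "0 < 1 / p'" "0 < 1 / p"
  proof -
    have "1 / p' = 1 - 1 / p" "0 < 1 - 1 / p" using p by auto
    then show "0 < 1 / p'" "0 < 1 / p" using p(1) by auto
  qed
  have "(\<integral>\<^sup>+x\<in>Q. ennreal (u x powr r) * ennreal (v x powr s) \<partial>lebesgue) \<le>
     ennpowr (\<integral>\<^sup>+x\<in>Q. ennpowr (ennreal (u x powr r)) p \<partial>lebesgue) (1 / p) *
     ennpowr (\<integral>\<^sup>+x\<in>Q. ennpowr (ennreal (v x powr s)) p' \<partial>lebesgue) (1 / p')"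
    by (intro nn_set_integral_Hoelder p) measurable
  then have "(\<integral>\<^sup>+x\<in>Q. ennreal (u x powr r * v x powr s) \<partial>lebesgue) \<le>
     ennpowr (\<integral>\<^sup>+x\<in>Q. ennreal (u x powr (r * p)) \<partial>lebesgue) (1 / p) *
     ennpowr (\<integral>\<^sup>+x\<in>Q. ennreal (v x powr (s * p')) \<partial>lebesgue) (1 / p')"
    by (simp add: ennpowr_ennreal powr_powr ennreal_mult)
  then have "ennreal (1 / m) * (\<integral>\<^sup>+x\<in>Q. ennreal (u x powr r * v x powr s) \<partial>lebesgue) \<le>
     ennreal (1 / m) * (ennpowr (\<integral>\<^sup>+x\<in>Q. ennreal (u x powr (r * p)) \<partial>lebesgue) (1 / p) *
     ennpowr (\<integral>\<^sup>+x\<in>Q. ennreal (v x powr (s * p')) \<partial>lebesgue) (1 / p'))"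
    by (rule mult_left_mono) simp
  note scaled = this
  have m1: "ennreal (1 / m) = ennpowr (ennreal (1 / m)) (1 / p) * ennpowr (ennreal (1 / m)) (1 / p')"
    using ennpowr_add[OF p'(2,1), of "ennreal (1 / m)"] p(2) by simp
  have regroup: "e = e1 * e2 \<Longrightarrow> e * (A * B) = (e1 * A) * (e2 * B)" for e e1 e2 A B :: ennreal
    by (simp only: mult_ac)
  show ?thesis
    using scaled unfolding sc ennpowr_mult[OF p'(1)] ennpowr_mult[OF p'(2)] regroup[OF m1] .
qed

lemma nn_avg_power_mean:
  fixes w :: "'a::euclidean_space \<Rightarrow> real"
  assumes Q: "Q \<in> cubes" and r: "0 < r" "r < s" and [measurable]: "w \<in> borel_measurable lebesgue"
  shows "ennpowr (nn_avg Q (\<lambda>x. w x powr (\<sigma> * r))) (1 / r) \<le> ennpowr (nn_avg Q (\<lambda>x. w x powr (\<sigma> * s))) (1 / s)"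
proof -
  define p where "p = s / r"
  define p' where "p' = s / (s - r)"
  have p: "1 < p" "1 / p + 1 / p' = 1" "0 < p'" using r by (auto simp: p_def p'_def field_simps)
  obtain m where m: "0 < m" "emeasure lebesgue Q = ennreal m" using cube_measure[OF Q] by blast
  have one: "nn_avg Q (\<lambda>x. 1 powr (1 * p')) = 1"
    using m cube_measure(1)[OF Q] unfolding nn_avg_scale[OF m(2,1)] by (simp flip: ennreal_mult')
  have "nn_avg Q (\<lambda>x. w x powr (\<sigma> * r) * 1 powr 1) \<le>
     ennpowr (nn_avg Q (\<lambda>x. w x powr (\<sigma> * r * p))) (1 / p) * ennpowr (nn_avg Q (\<lambda>x. 1 powr (1 * p'))) (1 / p')"
    by (rule nn_avg_Hoelder[OF Q p(1,2)]) auto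
  moreover have "\<sigma> * r * p = \<sigma> * s" "1 / p = r * (1 / s)" using r by (auto simp: p_def)
  ultimately have "nn_avg Q (\<lambda>x. w x powr (\<sigma> * r)) \<le> ennpowr (nn_avg Q (\<lambda>x. w x powr (\<sigma> * s))) (r * (1 / s))"
    unfolding one by simp
  then have "ennpowr (nn_avg Q (\<lambda>x. w x powr (\<sigma> * r))) (1 / r) \<le> ennpowr (ennpowr (nn_avg Q (\<lambda>x. w x powr (\<sigma> * s))) (r * (1 / s))) (1 / r)"
    using r by (intro ennpowr_mono) auto
  then show ?thesis using r by (simp add: ennpowr_ennpowr)
qed

text \<open>
  The bound \<open>K\<close> on the weight constant is kept at least 1, so that the shrinking factors derived from it lie
  strictly between 0 and 1.
\<close>

locale Apq_weight =
  fixes p q K :: real and w :: "'a::euclidean_space \<Rightarrow> real"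
  assumes p: "1 < p" "p < q" and K: "1 \<le> K"
    and weight: "weight w" and const: "Apq_const p q w \<le> ennreal K"
begin

lemma measurable [measurable]: "w \<in> borel_measurable lebesgue"
  using weight by (intro loc_integrable_measurable) (simp add: weight_def)

lemma pos: "AE x in lebesgue. 0 < w x"
  using weight by (simp add: weight_def)

lemma conj_exponents:
  "1 < p / (p - 1)" "1 < q / (q - 1)" "q / (q - 1) < p / (p - 1)"
  "1 / p + 1 / (p / (p - 1)) = 1" "1 / q + 1 / (q / (q - 1)) = 1"
  using p by (auto simp: field_simps)

text \<open>
  The \<open>A\<^sub>p\<^sub>q\<close> condition in homogeneous form; by the power mean inequality either factor may be replaced by a mean
  of lower order. The Muckenhoupt conditions for \<open>w powr p\<close>, for \<open>w powr (- q')\<close> and for \<open>\<nu>\<close> follow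
  from it in this way.
\<close>

lemma normalized:
  assumes Q: "Q \<in> cubes"
  shows "ennpowr (nn_avg Q (\<lambda>x. w x powr q)) (1 / q) *
    ennpowr (nn_avg Q (\<lambda>x. w x powr (- (p / (p - 1))))) (1 / (p / (p - 1))) \<le> ennreal (K powr (1 / q))"
proof -
  have "nn_avg Q (\<lambda>x. w x powr q) * ennpowr (nn_avg Q (\<lambda>x. w x powr (- hoelder_conj p))) (q / hoelder_conj p) \<le> ennreal K"
    using const Q unfolding Apq_const_def by (meson SUP_le_iff)
  then have "ennpowr (nn_avg Q (\<lambda>x. w x powr q) * ennpowr (nn_avg Q (\<lambda>x. w x powr (- hoelder_conj p))) (q / hoelder_conj p)) (1 / q)
     \<le> ennpowr (ennreal K) (1 / q)"
    using p by (intro ennpowr_mono) auto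
  then show ?thesis
    using p K conj_exponents(1) by (simp add: ennpowr_mult ennpowr_ennpowr ennpowr_ennreal hoelder_conj_def)
qed

lemma power_q_muckenhoupt: "muckenhoupt (1 + q * (p - 1) / p) K (\<lambda>x. w x powr q)"
proof -
  have e: "1 + q * (p - 1) / p - 1 = q / hoelder_conj p" "q * (- 1 / (q / hoelder_conj p)) = - hoelder_conj p"
    using p by (auto simp: hoelder_conj_def)
  show ?thesis
    unfolding muckenhoupt_def powr_powr e
  proof (intro conjI ballI)
    show "AE x in lebesgue. 0 < w x powr q" using pos by eventually_elim auto
    fix Q :: "'a set" assume "Q \<in> cubes"
    then show "nn_avg Q (\<lambda>x. w x powr q) * ennpowr (nn_avg Q (\<lambda>x. w x powr (- hoelder_conj p))) (q / hoelder_conj p) \<le> ennreal K"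
      using const unfolding Apq_const_def by (meson SUP_le_iff)
  qed measurable
qed

lemma power_p_muckenhoupt: "muckenhoupt p (K powr (p / q)) (\<lambda>x. w x powr p)"
proof -
  have e: "p * (- 1 / (p - 1)) = - (p / (p - 1))" "1 / (p / (p - 1)) * p = p - 1" using p by (auto simp: field_simps)
  have "nn_avg Q (\<lambda>x. w x powr p) * ennpowr (nn_avg Q (\<lambda>x. w x powr (- (p / (p - 1))))) (p - 1) \<le> ennreal (K powr (p / q))"
    if Q: "Q \<in> cubes" for Q
  proof -
    have "ennpowr (nn_avg Q (\<lambda>x. w x powr (1 * p))) (1 / p) \<le> ennpowr (nn_avg Q (\<lambda>x. w x powr (1 * q))) (1 / q)"
      using p by (intro nn_avg_power_mean Q) auto
    then have "ennpowr (nn_avg Q (\<lambda>x. w x powr p)) (1 / p) * ennpowr (nn_avg Q (\<lambda>x. w x powr (- (p / (p - 1))))) (1 / (p / (p - 1))) \<le>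
       ennreal (K powr (1 / q))"
      using normalized[OF Q] by (simp only: mult_1) (erule order_trans[rotated], rule mult_right_mono, auto)
    then have "ennpowr (ennpowr (nn_avg Q (\<lambda>x. w x powr p)) (1 / p) * ennpowr (nn_avg Q (\<lambda>x. w x powr (- (p / (p - 1))))) (1 / (p / (p - 1)))) p \<le>
       ennpowr (ennreal (K powr (1 / q))) p"
      using p by (intro ennpowr_mono) auto
    then show ?thesis
      using p conj_exponents(1) by (simp add: ennpowr_mult ennpowr_ennpowr ennpowr_ennreal powr_powr e(2)[simplified])
  qed
  then show ?thesis
    unfolding muckenhoupt_def powr_powr e(1) using pos by (auto elim: eventually_mono)
qed

lemma dual_power_muckenhoupt:
  "muckenhoupt (q / (q - 1)) (K powr (q / (q - 1) / q)) (\<lambda>x. w x powr (- (q / (q - 1))))"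
proof -
  define q' where "q' = q / (q - 1)"
  define p' where "p' = p / (p - 1)"
  have q': "1 < q'" "q' - 1 = q' / q" "0 < q'" using p by (auto simp: q'_def field_simps)
  have e: "- q' * (- 1 / (q' - 1)) = q" unfolding q'(2) using q' p by simp
  have p': "q' < p'" "1 < p'" using conj_exponents by (auto simp: q'_def p'_def)
  have "nn_avg Q (\<lambda>x. w x powr (- q')) * ennpowr (nn_avg Q (\<lambda>x. w x powr q)) (q' - 1) \<le> ennreal (K powr (q' / q))"
    if Q: "Q \<in> cubes" for Q
  proof -
    have "ennpowr (nn_avg Q (\<lambda>x. w x powr (-1 * q'))) (1 / q') \<le> ennpowr (nn_avg Q (\<lambda>x. w x powr (-1 * p'))) (1 / p')"
      using q' p' by (intro nn_avg_power_mean Q) auto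
    then have "ennpowr (nn_avg Q (\<lambda>x. w x powr q)) (1 / q) * ennpowr (nn_avg Q (\<lambda>x. w x powr (- q'))) (1 / q') \<le>
       ennpowr (nn_avg Q (\<lambda>x. w x powr q)) (1 / q) * ennpowr (nn_avg Q (\<lambda>x. w x powr (- p'))) (1 / p')"
      by (intro mult_left_mono) auto
    also have "\<dots> \<le> ennreal (K powr (1 / q))" using normalized[OF Q] by (simp add: p'_def)
    finally have "ennpowr (ennpowr (nn_avg Q (\<lambda>x. w x powr q)) (1 / q) * ennpowr (nn_avg Q (\<lambda>x. w x powr (- q'))) (1 / q')) q' \<le>
       ennpowr (ennreal (K powr (1 / q))) q'"
      using q' by (intro ennpowr_mono) auto
    then show ?thesis unfolding q'(2)
      using q' p by (simp add: ennpowr_mult ennpowr_ennpowr ennpowr_ennreal powr_powr mult.commute)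
  qed
  then show ?thesis
    unfolding muckenhoupt_def q'_def[symmetric] powr_powr e using pos by (auto elim: eventually_mono)
qed

end

text \<open>
  The Bloom weight \<open>\<nu>\<close> couples the two weights. It is an \<open>A\<^sub>2\<close> weight because both averages \<open>\<langle>\<nu>\<rangle>\<close> and
  \<open>\<langle>1 / \<nu>\<rangle>\<close> split by Hoelder's inequality into the factors of \<open>normalized\<close>.
\<close>

locale bloom_weights = mu: Apq_weight p q Km \<mu> + lam: Apq_weight p q Kl lam
  for p q Km Kl :: real and \<mu> lam :: "'a::euclidean_space \<Rightarrow> real"
begin

definition \<nu> :: "'a \<Rightarrow> real"
  where "\<nu> x = \<mu> x * inverse (lam x)"

lemma \<nu>_measurable [measurable]: "\<nu> \<in> borel_measurable lebesgue"
  unfolding \<nu>_def by measurable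

lemma \<nu>_pos: "AE x in lebesgue. 0 < \<nu> x"
  using mu.pos lam.pos by eventually_elim (simp add: \<nu>_def)

lemma ratio_average:
  assumes Q: "Q \<in> cubes"
    and "u \<in> borel_measurable lebesgue" "v \<in> borel_measurable lebesgue"
  shows "nn_avg Q (\<lambda>x. u x powr 1 * v x powr (-1)) \<le>
    ennpowr (nn_avg Q (\<lambda>x. u x powr q)) (1 / q) * ennpowr (nn_avg Q (\<lambda>x. v x powr (- (p / (p - 1))))) (1 / (p / (p - 1)))"
proof -
  have "nn_avg Q (\<lambda>x. u x powr 1 * v x powr (-1)) \<le>
     ennpowr (nn_avg Q (\<lambda>x. u x powr (1 * q))) (1 / q) * ennpowr (nn_avg Q (\<lambda>x. v x powr (- 1 * (q / (q - 1))))) (1 / (q / (q - 1)))"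
    using mu.p mu.conj_exponents assms by (intro nn_avg_Hoelder) auto
  also have "ennpowr (nn_avg Q (\<lambda>x. v x powr (- 1 * (q / (q - 1))))) (1 / (q / (q - 1))) \<le>
     ennpowr (nn_avg Q (\<lambda>x. v x powr (- 1 * (p / (p - 1))))) (1 / (p / (p - 1)))"
    using mu.conj_exponents assms by (intro nn_avg_power_mean) auto
  finally show ?thesis by (simp add: mult_left_mono)
qed

lemma \<nu>_average:
  assumes Q: "Q \<in> cubes"
  shows "nn_avg Q \<nu> \<le> ennpowr (nn_avg Q (\<lambda>x. \<mu> x powr q)) (1 / q) * ennpowr (nn_avg Q (\<lambda>x. lam x powr (- (p / (p - 1))))) (1 / (p / (p - 1)))"
proof -
  have "nn_avg Q \<nu> = nn_avg Q (\<lambda>x. \<mu> x powr 1 * lam x powr (-1))"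
    using mu.pos lam.pos by (intro nn_avg_cong_AE, eventually_elim) (auto simp: \<nu>_def powr_minus)
  then show ?thesis using ratio_average[OF Q mu.measurable lam.measurable] by simp
qed

lemma \<nu>_inverse_average:
  assumes Q: "Q \<in> cubes"
  shows "nn_avg Q (\<lambda>x. \<nu> x powr (-1)) \<le> ennpowr (nn_avg Q (\<lambda>x. lam x powr q)) (1 / q) * ennpowr (nn_avg Q (\<lambda>x. \<mu> x powr (- (p / (p - 1))))) (1 / (p / (p - 1)))"
proof -
  have "nn_avg Q (\<lambda>x. \<nu> x powr (-1)) = nn_avg Q (\<lambda>x. lam x powr 1 * \<mu> x powr (-1))"
    using mu.pos lam.pos by (intro nn_avg_cong_AE, eventually_elim) (auto simp: \<nu>_def powr_minus)
  then show ?thesis using ratio_average[OF Q lam.measurable mu.measurable] by simp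
qed

lemma \<nu>_muckenhoupt: "muckenhoupt 2 ((Km * Kl) powr (1 / q)) \<nu>"
proof -
  have "nn_avg Q \<nu> * nn_avg Q (\<lambda>x. \<nu> x powr (-1)) \<le> ennreal ((Km * Kl) powr (1 / q))" if Q: "Q \<in> cubes" for Q
  proof -
    have "nn_avg Q \<nu> * nn_avg Q (\<lambda>x. \<nu> x powr (-1)) \<le>
      (ennpowr (nn_avg Q (\<lambda>x. \<mu> x powr q)) (1 / q) * ennpowr (nn_avg Q (\<lambda>x. lam x powr (- (p / (p - 1))))) (1 / (p / (p - 1)))) *
      (ennpowr (nn_avg Q (\<lambda>x. lam x powr q)) (1 / q) * ennpowr (nn_avg Q (\<lambda>x. \<mu> x powr (- (p / (p - 1))))) (1 / (p / (p - 1))))"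
      by (intro mult_mono \<nu>_average \<nu>_inverse_average Q) auto
    also have "\<dots> = (ennpowr (nn_avg Q (\<lambda>x. \<mu> x powr q)) (1 / q) * ennpowr (nn_avg Q (\<lambda>x. \<mu> x powr (- (p / (p - 1))))) (1 / (p / (p - 1)))) *
       (ennpowr (nn_avg Q (\<lambda>x. lam x powr q)) (1 / q) * ennpowr (nn_avg Q (\<lambda>x. lam x powr (- (p / (p - 1))))) (1 / (p / (p - 1))))"
      by (simp only: mult_ac)
    also have "\<dots> \<le> ennreal (Km powr (1 / q)) * ennreal (Kl powr (1 / q))"
      by (intro mult_mono mu.normalized lam.normalized Q) auto
    also have "\<dots> = ennreal ((Km * Kl) powr (1 / q))" using mu.K lam.K by (simp add: powr_mult ennreal_mult)
    finally show ?thesis .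
  qed
  then show ?thesis unfolding muckenhoupt_def using \<nu>_pos by (auto elim: eventually_mono)
qed

text \<open>
  The opposite of the Hoelder estimate \<open>\<nu>_average\<close>: start from \<open>1 \<le> \<langle>\<nu>\<rangle> \<langle>1 / \<nu>\<rangle>\<close> and bound
  \<open>\<langle>1 / \<nu>\<rangle>\<close> by the two dual factors, which the \<open>A\<^sub>p\<^sub>q\<close> conditions cancel.
\<close>

lemma product_average_le_\<nu>:
  assumes Q: "Q \<in> cubes"
  shows "ennpowr (nn_avg Q (\<lambda>x. \<mu> x powr p)) (1 / p) * ennpowr (nn_avg Q (\<lambda>x. lam x powr (- (q / (q - 1))))) (1 / (q / (q - 1))) \<le>
    ennreal ((Km * Kl) powr (1 / q)) * nn_avg Q \<nu>"
proof -
  let ?p' = "p / (p - 1)"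
  let ?am = "ennpowr (nn_avg Q (\<lambda>x. \<mu> x powr q)) (1 / q)" and ?bm = "ennpowr (nn_avg Q (\<lambda>x. \<mu> x powr (- ?p'))) (1 / ?p')"
  let ?al = "ennpowr (nn_avg Q (\<lambda>x. lam x powr q)) (1 / q)" and ?bl = "ennpowr (nn_avg Q (\<lambda>x. lam x powr (- ?p'))) (1 / ?p')"
  obtain m where m: "0 < m" "emeasure lebesgue Q = ennreal m" using cube_measure[OF Q] by blast
  have "1 = nn_avg Q (\<lambda>x. 1)"
    using m cube_measure(1)[OF Q] unfolding nn_avg_scale[OF m(2,1)] by (simp flip: ennreal_mult')
  also have "\<dots> = nn_avg Q (\<lambda>x. \<nu> x powr (1/2) * \<nu> x powr (-1/2))"
    using \<nu>_pos by (intro nn_avg_cong_AE, eventually_elim) (simp flip: powr_add)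
  also have "\<dots> \<le> ennpowr (nn_avg Q (\<lambda>x. \<nu> x powr ((1/2) * 2))) (1 / 2) * ennpowr (nn_avg Q (\<lambda>x. \<nu> x powr ((-1/2) * 2))) (1 / 2)"
    by (intro nn_avg_Hoelder Q) auto
  finally have "1 \<le> ennpowr (ennpowr (nn_avg Q (\<lambda>x. \<nu> x powr 1)) (1 / 2) * ennpowr (nn_avg Q (\<lambda>x. \<nu> x powr (-1))) (1 / 2)) 2"
    using ennpowr_mono[of 1 _ 2] by simp
  also have "\<dots> = nn_avg Q (\<lambda>x. \<nu> x powr 1) * nn_avg Q (\<lambda>x. \<nu> x powr (-1))"
    by (simp add: ennpowr_mult ennpowr_ennpowr)
  also have "nn_avg Q (\<lambda>x. \<nu> x powr 1) = nn_avg Q \<nu>"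
    using \<nu>_pos by (intro nn_avg_cong_AE, eventually_elim) simp
  also have "nn_avg Q \<nu> * nn_avg Q (\<lambda>x. \<nu> x powr (-1)) \<le> nn_avg Q \<nu> * (?al * ?bm)"
    by (intro mult_left_mono \<nu>_inverse_average Q) simp
  finally have one: "1 \<le> nn_avg Q \<nu> * (?al * ?bm)" .
  have "ennpowr (nn_avg Q (\<lambda>x. \<mu> x powr (1 * p))) (1 / p) \<le> ennpowr (nn_avg Q (\<lambda>x. \<mu> x powr (1 * q))) (1 / q)"
    using mu.p by (intro nn_avg_power_mean Q) auto
  moreover have "ennpowr (nn_avg Q (\<lambda>x. lam x powr (-1 * (q / (q - 1))))) (1 / (q / (q - 1))) \<le> ennpowr (nn_avg Q (\<lambda>x. lam x powr (-1 * ?p'))) (1 / ?p')"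
    using mu.conj_exponents by (intro nn_avg_power_mean Q) auto
  ultimately have "ennpowr (nn_avg Q (\<lambda>x. \<mu> x powr p)) (1 / p) * ennpowr (nn_avg Q (\<lambda>x. lam x powr (- (q / (q - 1))))) (1 / (q / (q - 1))) \<le> ?am * ?bl"
    by (intro mult_mono) auto
  also have "\<dots> \<le> (?am * ?bl) * (nn_avg Q \<nu> * (?al * ?bm))"
    using mult_left_mono[OF one, of "?am * ?bl"] by simp
  also have "\<dots> = (?am * ?bm) * (?al * ?bl) * nn_avg Q \<nu>" by (simp only: mult_ac)
  also have "\<dots> \<le> ennreal (Km powr (1 / q)) * ennreal (Kl powr (1 / q)) * nn_avg Q \<nu>"
    by (intro mult_mono mu.normalized lam.normalized Q) auto
  also have "\<dots> = ennreal ((Km * Kl) powr (1 / q)) * nn_avg Q \<nu>" using mu.K lam.K by (simp add: powr_mult ennreal_mult)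
  finally show ?thesis .
qed

end

section \<open>The upper bound\<close>

text \<open>
  The constant of \<open>dyadic_max_weighted\<close>.
\<close>

definition max_const :: "real \<Rightarrow> real \<Rightarrow> real"
  where "max_const p K = K powr (p / (p - 1)) * doob_const (p / (p - 1)) * doob_const p"

text \<open>
  The first factor is the constant of \<open>bmo_maximal_domination\<close> for the \<open>A\<^sub>2\<close> weight \<open>\<nu>\<close>; the two summands
  belong to the two bilinear forms of \<open>osc_potential_bilinear_bound\<close>.
\<close>

definition bloom_const :: "real \<Rightarrow> real \<Rightarrow> nat \<Rightarrow> real \<Rightarrow> real \<Rightarrow> real"
  where "bloom_const p q n Km Kl = 2 ^ (n + 1) * ((Km * Kl) powr (1 / q) * 2 powr 2) *
    (frac_form_const p q Kl * max_const p (Km powr (p / q)) powr (1 / p) +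
     frac_form_const p q Km * max_const (q / (q - 1)) (Kl powr (q / (q - 1) / q)) powr (1 / (q / (q - 1))))"

lemma frac_form_const_nonneg: "0 \<le> frac_form_const p q K"
  by (simp add: frac_form_const_def Let_def)

lemma bloom_const_nonneg: "0 \<le> bloom_const p q n Km Kl"
  unfolding bloom_const_def by (intro mult_nonneg_nonneg add_nonneg_nonneg frac_form_const_nonneg) auto

context dyadic_grid
begin

lemma avg_cell_eq_cube:
  fixes b :: "'a \<Rightarrow> 'b::{banach, second_countable_topology}"
  assumes b: "loc_integrable b" and Q: "Q \<in> cells"
  shows "\<exists>R\<in>cubes. avg R b = avg Q b \<and> (\<forall>f. (\<integral>\<^sup>+x\<in>R. f x \<partial>lebesgue) = (\<integral>\<^sup>+x\<in>Q. f x \<partial>lebesgue))"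
proof -
  obtain k x where Qk: "Q = cell k x" using Q by (auto simp: cells_def)
  obtain R where R: "R \<in> cubes" "Q \<subseteq> R" "R - Q \<in> null_sets lebesgue" using cell_closed_cube Qk by blast
  have m [measurable]: "R \<in> sets lebesgue" "Q \<in> sets lebesgue" using cube_measure[OF R(1)] Q cells_lebesgue by auto
  have [measurable]: "b \<in> borel_measurable lebesgue" using b by (rule loc_integrable_measurable)
  have QR: "Q - R \<in> null_sets lebesgue" using R(2) by (simp add: Diff_eq_empty_iff[THEN iffD2])
  have *: "(\<integral>\<^sup>+x\<in>R. f x \<partial>lebesgue) = (\<integral>\<^sup>+x\<in>Q. f x \<partial>lebesgue)" for f
    using R m QR by (intro nn_set_integral_cong_set_AE)
  have "emeasure lebesgue R = emeasure lebesgue Q" using *[of "\<lambda>_. 1"] m by simp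
  then have "measure lebesgue R = measure lebesgue Q" unfolding measure_def by (rule arg_cong)
  moreover have "(LINT x:R|lebesgue. b x) = (LINT x:Q|lebesgue. b x)"
    unfolding set_lebesgue_integral_def
  proof (rule integral_cong_AE)
    have "AE x in lebesgue. x \<notin> R - Q" using R(3) by (rule AE_not_in)
    then show "AE x in lebesgue. indicat_real R x *\<^sub>R b x = indicat_real Q x *\<^sub>R b x"
      by eventually_elim (use R(2) in \<open>auto simp: indicator_def\<close>)
  qed measurable
  ultimately have "avg R b = avg Q b" by (simp add: avg_def)
  then show ?thesis using R(1) * by blast
qed

text \<open>
  The dyadic majorant of the commutator, with the oscillation falling once on \<open>x\<close> and once on \<open>y\<close>. Unlike the
  integral of \<open>\<bar>b x - b y\<bar>\<close> it is visibly measurable in \<open>x\<close>.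
\<close>

definition osc_potential :: "real \<Rightarrow> ('a \<Rightarrow> complex) \<Rightarrow> ('a \<Rightarrow> ennreal) \<Rightarrow> 'a \<Rightarrow> ennreal"
  where "osc_potential c b f x = (\<integral>\<^sup>+Q. ennreal (measure lebesgue Q powr c) *
     (ennreal (cmod (b x - avg Q b)) * (\<integral>\<^sup>+y\<in>Q. f y \<partial>lebesgue) +
      (\<integral>\<^sup>+y\<in>Q. ennreal (cmod (b y - avg Q b)) * f y \<partial>lebesgue)) * indicator Q x \<partial>count_space cells)"

lemma borel_measurable_osc_potential:
  assumes [measurable]: "b \<in> borel_measurable lebesgue" "f \<in> borel_measurable lebesgue"
  shows "osc_potential c b f \<in> borel_measurable lebesgue"
  unfolding osc_potential_def[abs_def]
proof (intro borel_measurable_nn_integral_countable countable_all_cells)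
  fix Q assume "Q \<in> cells"
  then have [measurable]: "Q \<in> sets lebesgue" by (rule cells_lebesgue)
  show "(\<lambda>x. ennreal (measure lebesgue Q powr c) *
     (ennreal (cmod (b x - avg Q b)) * (\<integral>\<^sup>+y\<in>Q. f y \<partial>lebesgue) +
      (\<integral>\<^sup>+y\<in>Q. ennreal (cmod (b y - avg Q b)) * f y \<partial>lebesgue)) * indicator Q x) \<in> borel_measurable lebesgue"
    by measurable
qed

lemma pair_difference_le_osc_potential:
  assumes [measurable]: "b \<in> borel_measurable lebesgue" "f \<in> borel_measurable lebesgue"
  shows "(\<integral>\<^sup>+Q. ennreal (measure lebesgue Q powr c) * (\<integral>\<^sup>+y\<in>Q. ennreal (cmod (b x - b y)) * f y \<partial>lebesgue) * indicator Q x \<partial>count_space cells)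
    \<le> osc_potential c b f x"
  unfolding osc_potential_def
proof (intro nn_integral_mono mult_right_mono mult_left_mono)
  fix Q assume "Q \<in> space (count_space cells)"
  then have [measurable]: "Q \<in> sets lebesgue" using cells_lebesgue by simp
  have "(\<integral>\<^sup>+y\<in>Q. ennreal (cmod (b x - b y)) * f y \<partial>lebesgue) \<le>
    (\<integral>\<^sup>+y. ennreal (cmod (b x - avg Q b)) * (f y * indicator Q y) + ennreal (cmod (b y - avg Q b)) * f y * indicator Q y \<partial>lebesgue)"
  proof (intro nn_integral_mono)
    fix y
    have "cmod (b x - b y) \<le> cmod (b x - avg Q b) + cmod (b y - avg Q b)"
      using norm_triangle_ineq4[of "b x - avg Q b" "b y - avg Q b"] by simp
    then have "ennreal (cmod (b x - b y)) \<le> ennreal (cmod (b x - avg Q b)) + ennreal (cmod (b y - avg Q b))"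
      by (simp add: ennreal_leI flip: ennreal_plus)
    then have "ennreal (cmod (b x - b y)) * (f y * indicator Q y) \<le> (ennreal (cmod (b x - avg Q b)) + ennreal (cmod (b y - avg Q b))) * (f y * indicator Q y)"
      by (rule mult_right_mono) simp
    then show "ennreal (cmod (b x - b y)) * f y * indicator Q y \<le>
       ennreal (cmod (b x - avg Q b)) * (f y * indicator Q y) + ennreal (cmod (b y - avg Q b)) * f y * indicator Q y"
      by (simp add: distrib_right mult.assoc)
  qed
  also have "\<dots> = ennreal (cmod (b x - avg Q b)) * (\<integral>\<^sup>+y\<in>Q. f y \<partial>lebesgue) + (\<integral>\<^sup>+y\<in>Q. ennreal (cmod (b y - avg Q b)) * f y \<partial>lebesgue)"
    by (subst nn_integral_add) (auto simp: nn_integral_cmult)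
  finally show "(\<integral>\<^sup>+y\<in>Q. ennreal (cmod (b x - b y)) * f y \<partial>lebesgue) \<le>
    ennreal (cmod (b x - avg Q b)) * (\<integral>\<^sup>+y\<in>Q. f y \<partial>lebesgue) + (\<integral>\<^sup>+y\<in>Q. ennreal (cmod (b y - avg Q b)) * f y \<partial>lebesgue)" .
qed auto

lemma osc_potential_pairing:
  assumes [measurable]: "b \<in> borel_measurable lebesgue" "f \<in> borel_measurable lebesgue" "g \<in> borel_measurable lebesgue"
  shows "(\<integral>\<^sup>+x. osc_potential c b f x * g x \<partial>lebesgue) =
    (\<integral>\<^sup>+Q. ennreal (measure lebesgue Q powr c) *
      ((\<integral>\<^sup>+x\<in>Q. ennreal (cmod (b x - avg Q b)) * g x \<partial>lebesgue) * (\<integral>\<^sup>+y\<in>Q. f y \<partial>lebesgue) +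
       (\<integral>\<^sup>+y\<in>Q. ennreal (cmod (b y - avg Q b)) * f y \<partial>lebesgue) * (\<integral>\<^sup>+x\<in>Q. g x \<partial>lebesgue)) \<partial>count_space cells)"
proof -
  let ?t = "\<lambda>Q x. ennreal (measure lebesgue Q powr c) *
     (ennreal (cmod (b x - avg Q b)) * (\<integral>\<^sup>+y\<in>Q. f y \<partial>lebesgue) +
      (\<integral>\<^sup>+y\<in>Q. ennreal (cmod (b y - avg Q b)) * f y \<partial>lebesgue)) * indicator Q x"
  have tm: "(\<lambda>x. ?t Q x * g x) \<in> borel_measurable lebesgue" if "Q \<in> cells" for Q
  proof -
    have [measurable]: "Q \<in> sets lebesgue" using that by (rule cells_lebesgue)
    show ?thesis by measurable
  qed
  have "(\<integral>\<^sup>+x. osc_potential c b f x * g x \<partial>lebesgue) = (\<integral>\<^sup>+x. (\<integral>\<^sup>+Q. ?t Q x * g x \<partial>count_space cells) \<partial>lebesgue)"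
    unfolding osc_potential_def by (subst nn_integral_multc) auto
  also have "\<dots> = (\<integral>\<^sup>+Q. (\<integral>\<^sup>+x. ?t Q x * g x \<partial>lebesgue) \<partial>count_space cells)"
    by (rule nn_integral_count_space_nn_integral[OF countable_all_cells tm])
  also have "\<dots> = (\<integral>\<^sup>+Q. ennreal (measure lebesgue Q powr c) *
      ((\<integral>\<^sup>+x\<in>Q. ennreal (cmod (b x - avg Q b)) * g x \<partial>lebesgue) * (\<integral>\<^sup>+y\<in>Q. f y \<partial>lebesgue) +
       (\<integral>\<^sup>+y\<in>Q. ennreal (cmod (b y - avg Q b)) * f y \<partial>lebesgue) * (\<integral>\<^sup>+x\<in>Q. g x \<partial>lebesgue)) \<partial>count_space cells)"
  proof (intro nn_integral_cong)
    fix Q assume "Q \<in> space (count_space cells)"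
    then have [measurable]: "Q \<in> sets lebesgue" using cells_lebesgue by simp
    define A where "A = (\<integral>\<^sup>+y\<in>Q. f y \<partial>lebesgue)"
    define D where "D = (\<integral>\<^sup>+y\<in>Q. ennreal (cmod (b y - avg Q b)) * f y \<partial>lebesgue)"
    define k where "k = ennreal (measure lebesgue Q powr c)"
    have "(\<integral>\<^sup>+x. k * (ennreal (cmod (b x - avg Q b)) * A + D) * indicator Q x * g x \<partial>lebesgue) =
       (\<integral>\<^sup>+x. k * ((ennreal (cmod (b x - avg Q b)) * g x * indicator Q x) * A + D * (g x * indicator Q x)) \<partial>lebesgue)"
      by (intro nn_integral_cong) (simp add: distrib_left distrib_right mult_ac)
    also have "\<dots> = k * ((\<integral>\<^sup>+x\<in>Q. ennreal (cmod (b x - avg Q b)) * g x \<partial>lebesgue) * A + D * (\<integral>\<^sup>+x\<in>Q. g x \<partial>lebesgue))"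
      by (subst nn_integral_cmult, measurable, subst nn_integral_add, measurable)
         (simp add: nn_integral_cmult nn_integral_multc)
    finally show "(\<integral>\<^sup>+x. ?t Q x * g x \<partial>lebesgue) = ennreal (measure lebesgue Q powr c) *
      ((\<integral>\<^sup>+x\<in>Q. ennreal (cmod (b x - avg Q b)) * g x \<partial>lebesgue) * (\<integral>\<^sup>+y\<in>Q. f y \<partial>lebesgue) +
       (\<integral>\<^sup>+y\<in>Q. ennreal (cmod (b y - avg Q b)) * f y \<partial>lebesgue) * (\<integral>\<^sup>+x\<in>Q. g x \<partial>lebesgue))"
      unfolding A_def D_def k_def .
  qed
  finally show ?thesis .
qed

text \<open>
  When the oscillation falls on \<open>f\<close>, the form is bounded with the weight \<open>lam\<close>, and \<open>\<nu> * lam = \<mu>\<close> returns the norm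
  of the maximal function of \<open>f\<close> in \<open>L^p(\<mu>^p)\<close>. When it falls on \<open>g\<close>, the weight \<open>\<mu>\<close> is used, and \<open>\<nu> / \<mu> = 1 / lam\<close>
  returns the dual norm of \<open>g\<close>.
\<close>

theorem osc_potential_bilinear_bound:
  fixes \<mu> lam :: "'a \<Rightarrow> real"
  assumes bw: "bloom_weights p q Km Kl \<mu> lam" and b: "loc_integrable b" and B: "0 < B"
    and osc: "\<And>Q. Q \<in> cubes \<Longrightarrow> (\<integral>\<^sup>+x\<in>Q. ennreal (cmod (b x - avg Q b)) \<partial>lebesgue) \<le>
      ennreal B * (\<integral>\<^sup>+x\<in>Q. ennreal (\<mu> x * inverse (lam x)) \<partial>lebesgue)"
    and f [measurable]: "f \<in> borel_measurable lebesgue" and g [measurable]: "g \<in> borel_measurable lebesgue"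
  shows "(\<integral>\<^sup>+x. osc_potential (1 / p - 1 / q - 1) b f x * g x \<partial>lebesgue) \<le> ennreal (bloom_const p q DIM('a) Km Kl * B) *
    (ennpowr (\<integral>\<^sup>+x. ennpowr (f x) p * ennreal (\<mu> x powr p) \<partial>lebesgue) (1 / p) *
     ennpowr (\<integral>\<^sup>+x. ennpowr (g x) (q / (q - 1)) * ennreal (lam x powr (- (q / (q - 1)))) \<partial>lebesgue) (1 / (q / (q - 1))))"
proof -
  interpret W: bloom_weights p q Km Kl \<mu> lam by (rule bw)
  note pq = W.mu.p
  define q' where "q' = q / (q - 1)"
  have q': "1 < q'" using W.mu.conj_exponents by (simp add: q'_def)
  define c where "c = 1 / p - 1 / q - 1"
  define K3 where "K3 = (Km * Kl) powr (1 / q)"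
  have K3: "1 \<le> K3"
  proof -
    have "1 * 1 \<le> Km * Kl" using W.mu.K W.lam.K by (intro mult_mono) auto
    then show ?thesis unfolding K3_def using pq by (intro ge_one_powr_ge_zero) auto
  qed
  have m2: "muckenhoupt 2 K3 W.\<nu>" using W.\<nu>_muckenhoupt by (simp add: K3_def)
  have cv: "cell_measure (weighted W.\<nu>)" using muckenhoupt_measures(1)[OF m2] by simp
  define D where "D = 2 ^ (DIM('a) + 1) * B * (K3 * 2 powr 2)"
  have D: "0 \<le> D" using B K3 by (simp add: D_def)
  note [measurable] = loc_integrable_measurable[OF b]
  have dom: "(\<integral>\<^sup>+y\<in>Q. ennreal (cmod (b y - avg Q b)) * h y \<partial>lebesgue) \<le> ennreal D * (\<integral>\<^sup>+y\<in>Q. dyadic_max lebesgue h y * ennreal (W.\<nu> y) \<partial>lebesgue)"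
    if h: "h \<in> borel_measurable lebesgue" and Q: "Q \<in> cells" for h Q
  proof -
    have "(\<integral>\<^sup>+y\<in>Q. ennreal (cmod (b y - avg Q b)) * h y \<partial>lebesgue) \<le> ennreal (2 ^ (DIM('a) + 1) * B * (K3 * 2 powr 2)) * (\<integral>\<^sup>+y\<in>Q. dyadic_max lebesgue h y \<partial>weighted W.\<nu>)"
    proof (rule bmo_maximal_domination[OF b cv B _ _ _ h Q])
      show "0 \<le> K3 * 2 powr 2" using K3 by simp
      show "emeasure (weighted W.\<nu>) R \<le> ennreal (K3 * 2 powr 2) * emeasure (weighted W.\<nu>) E"
        if "R \<in> cells" "E \<in> sets lebesgue" "E \<subseteq> R" "emeasure lebesgue R \<le> 2 * emeasure lebesgue E" for R E
        using K3 that by (intro muckenhoupt_half[OF m2]) auto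
      show "(\<integral>\<^sup>+x\<in>R. ennreal (cmod (b x - avg R b)) \<partial>lebesgue) \<le> ennreal B * emeasure (weighted W.\<nu>) R" if R: "R \<in> cells" for R
      proof -
        obtain S where S: "S \<in> cubes" "avg S b = avg R b" "\<And>f. (\<integral>\<^sup>+x\<in>S. f x \<partial>lebesgue) = (\<integral>\<^sup>+x\<in>R. f x \<partial>lebesgue)"
          using avg_cell_eq_cube[OF b R] by blast
        show ?thesis using osc[OF S(1)] S(2,3) cells_lebesgue[OF R] by (simp add: emeasure_weighted W.\<nu>_def)
      qed
    qed
    also have "(\<integral>\<^sup>+y\<in>Q. dyadic_max lebesgue h y \<partial>weighted W.\<nu>) = (\<integral>\<^sup>+y\<in>Q. dyadic_max lebesgue h y * ennreal (W.\<nu> y) \<partial>lebesgue)"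
      using cells_lebesgue[OF Q] by (intro nn_set_integral_weighted) auto
    finally show ?thesis unfolding D_def .
  qed
  let ?Mf = "\<lambda>y. dyadic_max lebesgue f y * ennreal (W.\<nu> y)" and ?Mg = "\<lambda>y. dyadic_max lebesgue g y * ennreal (W.\<nu> y)"
  let ?F = "ennpowr (\<integral>\<^sup>+x. ennpowr (f x) p * ennreal (\<mu> x powr p) \<partial>lebesgue) (1 / p)"
  let ?G = "ennpowr (\<integral>\<^sup>+x. ennpowr (g x) q' * ennreal (lam x powr (- q')) \<partial>lebesgue) (1 / q')"
  have termF: "frac_form c ?Mf g \<le> ennreal (frac_form_const p q Kl * max_const p (Km powr (p / q)) powr (1 / p)) * (?F * ?G)"
  proof -
    have "frac_form c ?Mf g \<le> ennreal (frac_form_const p q Kl) *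
      (ennpowr (\<integral>\<^sup>+x. ennpowr (?Mf x) p * ennreal (lam x powr p) \<partial>lebesgue) (1 / p) * ?G)"
      unfolding c_def q'_def using pq W.lam.K W.lam.pos W.lam.power_q_muckenhoupt by (intro frac_form_bound) auto
    also have "(\<integral>\<^sup>+x. ennpowr (?Mf x) p * ennreal (lam x powr p) \<partial>lebesgue) = (\<integral>\<^sup>+x. ennpowr (dyadic_max lebesgue f x) p * ennreal (\<mu> x powr p) \<partial>lebesgue)"
      using W.mu.pos W.lam.pos
    proof (intro nn_integral_cong_AE, eventually_elim)
      case (elim x)
      have "(W.\<nu> x) powr p * lam x powr p = \<mu> x powr p"
        using elim by (simp add: W.\<nu>_def powr_mult[symmetric] mult.assoc)
      then have "ennreal ((W.\<nu> x) powr p) * ennreal (lam x powr p) = ennreal (\<mu> x powr p)"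
        by (simp add: ennreal_mult'[symmetric])
      moreover have "0 \<le> W.\<nu> x" using elim by (simp add: W.\<nu>_def)
      ultimately show ?case using pq by (simp add: ennpowr_mult ennpowr_ennreal mult.assoc)
    qed
    finally have le: "frac_form c ?Mf g \<le> ennreal (frac_form_const p q Kl) *
      (ennpowr (\<integral>\<^sup>+x. ennpowr (dyadic_max lebesgue f x) p * ennreal (\<mu> x powr p) \<partial>lebesgue) (1 / p) * ?G)" .
    have "ennpowr (\<integral>\<^sup>+x. ennpowr (dyadic_max lebesgue f x) p * ennreal (\<mu> x powr p) \<partial>lebesgue) (1 / p) \<le>
        ennpowr (ennreal (max_const p (Km powr (p / q))) * (\<integral>\<^sup>+x. ennpowr (f x) p * ennreal (\<mu> x powr p) \<partial>lebesgue)) (1 / p)"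
      unfolding max_const_def using pq W.mu.power_p_muckenhoupt f
      by (intro ennpowr_mono dyadic_max_weighted) auto
    also have "\<dots> = ennreal (max_const p (Km powr (p / q)) powr (1 / p)) * ?F"
      using pq doob_const_pos[of p] doob_const_pos[OF W.mu.conj_exponents(1)]
      by (simp add: ennpowr_mult ennpowr_ennreal max_const_def)
    finally have M: "ennpowr (\<integral>\<^sup>+x. ennpowr (dyadic_max lebesgue f x) p * ennreal (\<mu> x powr p) \<partial>lebesgue) (1 / p) \<le>
      ennreal (max_const p (Km powr (p / q)) powr (1 / p)) * ?F" .
    note le
    also have "ennreal (frac_form_const p q Kl) *
        (ennpowr (\<integral>\<^sup>+x. ennpowr (dyadic_max lebesgue f x) p * ennreal (\<mu> x powr p) \<partial>lebesgue) (1 / p) * ?G) \<le>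
      ennreal (frac_form_const p q Kl) * ((ennreal (max_const p (Km powr (p / q)) powr (1 / p)) * ?F) * ?G)"
      by (intro mult_left_mono mult_right_mono M) auto
    finally show ?thesis by (simp add: ennreal_mult frac_form_const_nonneg mult.assoc)
  qed
  have termG: "frac_form c f ?Mg \<le> ennreal (frac_form_const p q Km * max_const q' (Kl powr (q' / q)) powr (1 / q')) * (?F * ?G)"
  proof -
    have "frac_form c f ?Mg \<le> ennreal (frac_form_const p q Km) *
      (?F * ennpowr (\<integral>\<^sup>+x. ennpowr (?Mg x) q' * ennreal (\<mu> x powr (- q')) \<partial>lebesgue) (1 / q'))"
      unfolding c_def q'_def using pq W.mu.K W.mu.pos W.mu.power_q_muckenhoupt by (intro frac_form_bound) auto
    also have "(\<integral>\<^sup>+x. ennpowr (?Mg x) q' * ennreal (\<mu> x powr (- q')) \<partial>lebesgue) = (\<integral>\<^sup>+x. ennpowr (dyadic_max lebesgue g x) q' * ennreal (lam x powr (- q')) \<partial>lebesgue)"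
      using W.mu.pos W.lam.pos
    proof (intro nn_integral_cong_AE, eventually_elim)
      case (elim x)
      have "(W.\<nu> x) powr q' * \<mu> x powr (- q') = lam x powr (- q')"
        using elim by (simp add: W.\<nu>_def powr_mult powr_minus inverse_powr)
      then have "ennreal ((W.\<nu> x) powr q') * ennreal (\<mu> x powr (- q')) = ennreal (lam x powr (- q'))"
        by (simp add: ennreal_mult'[symmetric])
      moreover have "0 \<le> W.\<nu> x" using elim by (simp add: W.\<nu>_def)
      ultimately show ?case using q' by (simp add: ennpowr_mult ennpowr_ennreal mult.assoc)
    qed
    finally have le: "frac_form c f ?Mg \<le> ennreal (frac_form_const p q Km) *
      (?F * ennpowr (\<integral>\<^sup>+x. ennpowr (dyadic_max lebesgue g x) q' * ennreal (lam x powr (- q')) \<partial>lebesgue) (1 / q'))" .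
    have "ennpowr (\<integral>\<^sup>+x. ennpowr (dyadic_max lebesgue g x) q' * ennreal (lam x powr (- q')) \<partial>lebesgue) (1 / q') \<le>
        ennpowr (ennreal (max_const q' (Kl powr (q' / q))) * (\<integral>\<^sup>+x. ennpowr (g x) q' * ennreal (lam x powr (- q')) \<partial>lebesgue)) (1 / q')"
      unfolding max_const_def using q' W.lam.dual_power_muckenhoupt[folded q'_def] g
      by (intro ennpowr_mono dyadic_max_weighted) auto
    also have "\<dots> = ennreal (max_const q' (Kl powr (q' / q)) powr (1 / q')) * ?G"
    proof -
      have "1 < q' / (q' - 1)" using q' by (simp add: field_simps)
      then show ?thesis using q' doob_const_pos[of q'] doob_const_pos[of "q' / (q' - 1)"]
        by (simp add: ennpowr_mult ennpowr_ennreal max_const_def)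
    qed
    finally have M: "ennpowr (\<integral>\<^sup>+x. ennpowr (dyadic_max lebesgue g x) q' * ennreal (lam x powr (- q')) \<partial>lebesgue) (1 / q') \<le>
      ennreal (max_const q' (Kl powr (q' / q)) powr (1 / q')) * ?G" .
    note le
    also have "ennreal (frac_form_const p q Km) *
        (?F * ennpowr (\<integral>\<^sup>+x. ennpowr (dyadic_max lebesgue g x) q' * ennreal (lam x powr (- q')) \<partial>lebesgue) (1 / q')) \<le>
      ennreal (frac_form_const p q Km) * (?F * (ennreal (max_const q' (Kl powr (q' / q)) powr (1 / q')) * ?G))"
      by (intro mult_left_mono M) auto
    finally show ?thesis by (simp add: ennreal_mult frac_form_const_nonneg mult_ac)
  qed
  have "(\<integral>\<^sup>+x. osc_potential c b f x * g x \<partial>lebesgue) \<le>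
    (\<integral>\<^sup>+Q. ennreal D * (ennreal (measure lebesgue Q powr c) * ((\<integral>\<^sup>+y\<in>Q. f y \<partial>lebesgue) * (\<integral>\<^sup>+y\<in>Q. ?Mg y \<partial>lebesgue))) +
       ennreal D * (ennreal (measure lebesgue Q powr c) * ((\<integral>\<^sup>+y\<in>Q. ?Mf y \<partial>lebesgue) * (\<integral>\<^sup>+y\<in>Q. g y \<partial>lebesgue))) \<partial>count_space cells)"
  proof (subst osc_potential_pairing, measurable, intro nn_integral_mono)
    fix Q assume "Q \<in> space (count_space cells)"
    then have Q: "Q \<in> cells" by simp
    have "ennreal (measure lebesgue Q powr c) *
      ((\<integral>\<^sup>+x\<in>Q. ennreal (cmod (b x - avg Q b)) * g x \<partial>lebesgue) * (\<integral>\<^sup>+y\<in>Q. f y \<partial>lebesgue) +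
       (\<integral>\<^sup>+y\<in>Q. ennreal (cmod (b y - avg Q b)) * f y \<partial>lebesgue) * (\<integral>\<^sup>+x\<in>Q. g x \<partial>lebesgue)) \<le>
      ennreal (measure lebesgue Q powr c) *
      ((ennreal D * (\<integral>\<^sup>+y\<in>Q. ?Mg y \<partial>lebesgue)) * (\<integral>\<^sup>+y\<in>Q. f y \<partial>lebesgue) +
       (ennreal D * (\<integral>\<^sup>+y\<in>Q. ?Mf y \<partial>lebesgue)) * (\<integral>\<^sup>+x\<in>Q. g x \<partial>lebesgue))"
      by (intro mult_left_mono add_mono mult_right_mono dom f g Q) auto
    also have "\<dots> = ennreal D * (ennreal (measure lebesgue Q powr c) * ((\<integral>\<^sup>+y\<in>Q. f y \<partial>lebesgue) * (\<integral>\<^sup>+y\<in>Q. ?Mg y \<partial>lebesgue))) +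
       ennreal D * (ennreal (measure lebesgue Q powr c) * ((\<integral>\<^sup>+y\<in>Q. ?Mf y \<partial>lebesgue) * (\<integral>\<^sup>+y\<in>Q. g y \<partial>lebesgue)))"
      by (simp only: distrib_left mult_ac)
    finally show "ennreal (measure lebesgue Q powr c) *
      ((\<integral>\<^sup>+x\<in>Q. ennreal (cmod (b x - avg Q b)) * g x \<partial>lebesgue) * (\<integral>\<^sup>+y\<in>Q. f y \<partial>lebesgue) +
       (\<integral>\<^sup>+y\<in>Q. ennreal (cmod (b y - avg Q b)) * f y \<partial>lebesgue) * (\<integral>\<^sup>+x\<in>Q. g x \<partial>lebesgue)) \<le>
       ennreal D * (ennreal (measure lebesgue Q powr c) * ((\<integral>\<^sup>+y\<in>Q. f y \<partial>lebesgue) * (\<integral>\<^sup>+y\<in>Q. ?Mg y \<partial>lebesgue))) +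
       ennreal D * (ennreal (measure lebesgue Q powr c) * ((\<integral>\<^sup>+y\<in>Q. ?Mf y \<partial>lebesgue) * (\<integral>\<^sup>+y\<in>Q. g y \<partial>lebesgue)))" .
  qed
  also have "\<dots> = ennreal D * (frac_form c f ?Mg + frac_form c ?Mf g)"
    unfolding frac_form_def by (subst nn_integral_add) (auto simp: nn_integral_cmult distrib_left)
  also have "\<dots> \<le> ennreal D * (ennreal (frac_form_const p q Km * max_const q' (Kl powr (q' / q)) powr (1 / q')) * (?F * ?G) +
      ennreal (frac_form_const p q Kl * max_const p (Km powr (p / q)) powr (1 / p)) * (?F * ?G))"
    by (intro mult_left_mono add_mono termF termG) simp
  also have "ennreal D * (ennreal (frac_form_const p q Km * max_const q' (Kl powr (q' / q)) powr (1 / q')) * (?F * ?G) +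
      ennreal (frac_form_const p q Kl * max_const p (Km powr (p / q)) powr (1 / p)) * (?F * ?G)) =
      ennreal (bloom_const p q DIM('a) Km Kl * B) * (?F * ?G)"
  proof -
    have "bloom_const p q DIM('a) Km Kl * B = D * (frac_form_const p q Km * max_const q' (Kl powr (q' / q)) powr (1 / q') +
      frac_form_const p q Kl * max_const p (Km powr (p / q)) powr (1 / p))"
      unfolding bloom_const_def D_def K3_def q'_def by (simp add: mult_ac add.commute)
    then show ?thesis
      using D by (simp add: ennreal_mult frac_form_const_nonneg distrib_right distrib_left mult_ac)
  qed
  finally show ?thesis unfolding c_def q'_def .
qed

end

text \<open>
  Testing against \<open>g = h^{q-1} lam^q\<close> is optimal. The truncations \<open>hk\<close> have finite norm, so that the norm can be
  cancelled on both sides.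
\<close>

theorem weighted_norm_le_by_duality:
  fixes lam :: "'a::euclidean_space \<Rightarrow> real"
  assumes q: "1 < q" and [measurable]: "h \<in> borel_measurable lebesgue" "lam \<in> borel_measurable lebesgue"
    and pos: "AE x in lebesgue. 0 < lam x"
    and fin: "\<And>k::nat. (\<integral>\<^sup>+x\<in>cball 0 (real k). ennreal (lam x powr q) \<partial>lebesgue) < top"
    and dual: "\<And>g. g \<in> borel_measurable lebesgue \<Longrightarrow> (\<integral>\<^sup>+x. h x * g x \<partial>lebesgue) \<le>
       C * ennpowr (\<integral>\<^sup>+x. ennpowr (g x) (q / (q - 1)) * ennreal (lam x powr (- (q / (q - 1)))) \<partial>lebesgue) (1 / (q / (q - 1)))"
  shows "ennpowr (\<integral>\<^sup>+x. ennpowr (h x) q * ennreal (lam x powr q) \<partial>lebesgue) (1 / q) \<le> C"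
proof -
  define q' where "q' = q / (q - 1)"
  have q': "1 < q'" "0 < q'" "1 / q + 1 / q' = 1" "(q - 1) * q' = q" using q by (auto simp: q'_def field_simps)
  define hk where "hk k x = min (h x) (of_nat k) * indicator (cball 0 (real k)) x" for k x
  have [measurable]: "cball (0 :: 'a) (real k) \<in> sets lebesgue" for k by simp
  have [measurable]: "hk k \<in> borel_measurable lebesgue" for k unfolding hk_def by measurable
  define I where "I k = (\<integral>\<^sup>+x. ennpowr (hk k x) q * ennreal (lam x powr q) \<partial>lebesgue)" for k
  have bound: "I k \<le> ennpowr C q" for k
  proof -
    have Ifin: "I k < top"
    proof -
      have "I k \<le> (\<integral>\<^sup>+x. ennpowr (of_nat k) q * (ennreal (lam x powr q) * indicator (cball 0 (real k)) x) \<partial>lebesgue)"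
        unfolding I_def using q by (intro nn_integral_mono) (auto simp: hk_def indicator_def intro!: mult_right_mono ennpowr_mono)
      also have "\<dots> = ennpowr (of_nat k) q * (\<integral>\<^sup>+x\<in>cball 0 (real k). ennreal (lam x powr q) \<partial>lebesgue)"
        by (rule nn_integral_cmult) measurable
      also have "\<dots> < top"
        using fin[of k] by (simp add: ennreal_mult_eq_top_iff less_top[symmetric])
      finally show ?thesis .
    qed
    define g where "g x = ennpowr (hk k x) (q - 1) * ennreal (lam x powr q)" for x
    have gm [measurable]: "g \<in> borel_measurable lebesgue" unfolding g_def by measurable
    have "I k \<le> (\<integral>\<^sup>+x. h x * g x \<partial>lebesgue)"
      unfolding I_def
    proof (intro nn_integral_mono)
      fix x
      have "ennpowr (hk k x) q = hk k x * ennpowr (hk k x) (q - 1)"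
        using ennpowr_add[of 1 "q - 1" "hk k x"] q by simp
      also have "\<dots> \<le> h x * ennpowr (hk k x) (q - 1)"
        by (intro mult_right_mono) (auto simp: hk_def indicator_def)
      finally show "ennpowr (hk k x) q * ennreal (lam x powr q) \<le> h x * g x"
        unfolding g_def mult.assoc[symmetric] by (rule mult_right_mono) simp
    qed
    also have "\<dots> \<le> C * ennpowr (\<integral>\<^sup>+x. ennpowr (g x) q' * ennreal (lam x powr (- q')) \<partial>lebesgue) (1 / q')"
      unfolding q'_def by (rule dual[OF gm])
    also have "(\<integral>\<^sup>+x. ennpowr (g x) q' * ennreal (lam x powr (- q')) \<partial>lebesgue) = I k"
      unfolding I_def using pos
    proof (intro nn_integral_cong_AE, eventually_elim)
      case (elim x)
      have "q' * (q - 1) = q" using q'(4) by (simp add: mult.commute)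
      then have "q * q' + - q' = q" by (simp add: algebra_simps)
      then have "lam x powr (q * q') * lam x powr (- q') = lam x powr q"
        unfolding powr_add[symmetric] by simp
      then have "ennreal (lam x powr (q * q')) * ennreal (lam x powr (- q')) = ennreal (lam x powr q)"
        by (simp add: ennreal_mult'[symmetric])
      then show ?case using q q' by (simp add: g_def ennpowr_mult ennpowr_ennpowr ennpowr_ennreal powr_powr mult.assoc)
    qed
    finally have le: "I k \<le> C * ennpowr (I k) (1 / q')" .
    have "ennpowr (I k) (1 / q) \<le> C"
    proof (cases "I k = 0")
      case False
      have "ennpowr (I k) (1 / q') * ennpowr (I k) (1 / q) = I k"
        using ennpowr_add[of "1 / q'" "1 / q" "I k"] q q' by (simp add: add.commute)
      then have "ennpowr (I k) (1 / q') * ennpowr (I k) (1 / q) \<le> ennpowr (I k) (1 / q') * C"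
        using le by (simp add: mult.commute)
      then show ?thesis using False Ifin
        by (subst (asm) ennreal_mult_le_mult_iff) (auto simp: less_top[symmetric])
    qed simp
    then have "ennpowr (ennpowr (I k) (1 / q)) q \<le> ennpowr C q" using q by (intro ennpowr_mono) auto
    then show ?thesis using q by (simp add: ennpowr_ennpowr)
  qed
  have SUPh: "(SUP k. hk k x) = h x" for x
  proof (rule antisym)
    show "(SUP k. hk k x) \<le> h x" by (rule SUP_least) (auto simp: hk_def indicator_def)
    show "h x \<le> (SUP k. hk k x)"
    proof (rule dense_le)
      fix z assume z: "z < h x"
      then obtain n where n: "z < of_nat n" using ennreal_Ex_less_of_nat by (metis less_le_trans top_greatest)
      obtain N :: nat where N: "norm x \<le> real N" using real_arch_simple by blast
      define k where "k = max n N"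
      have "of_nat n \<le> (of_nat k :: ennreal)" by (simp add: k_def)
      then have "z \<le> min (h x) (of_nat k)" using z n by (simp add: less_imp_le order_trans[OF less_imp_le[OF n]])
      moreover have "norm x \<le> real k" using N by (simp add: k_def)
      ultimately have "z \<le> hk k x" by (simp add: hk_def)
      then show "z \<le> (SUP k. hk k x)" by (rule order_trans) (rule SUP_upper, simp)
    qed
  qed
  have inc: "hk j x \<le> hk k x" if "j \<le> k" for j k x
  proof -
    have "of_nat j \<le> (of_nat k :: ennreal)" using that by simp
    then have "min (h x) (of_nat j) \<le> min (h x) (of_nat k)" by (rule min.mono[OF order_refl])
    then show ?thesis using that by (auto simp: hk_def indicator_def)
  qed
  have "(\<integral>\<^sup>+x. ennpowr (h x) q * ennreal (lam x powr q) \<partial>lebesgue) =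
     (\<integral>\<^sup>+x. (SUP k. ennpowr (hk k x) q * ennreal (lam x powr q)) \<partial>lebesgue)"
    using q by (simp add: SUPh[symmetric] ennpowr_SUP SUP_mult_right_ennreal)
  also have "\<dots> = (SUP k. I k)"
    unfolding I_def
  proof (rule nn_integral_monotone_convergence_SUP)
    show "incseq (\<lambda>k x. ennpowr (hk k x) q * ennreal (lam x powr q))"
      unfolding incseq_def le_fun_def using q by (intro allI impI mult_right_mono ennpowr_mono inc) auto
  qed measurable
  also have "\<dots> \<le> ennpowr C q" by (rule SUP_least) (rule bound)
  finally have "ennpowr (\<integral>\<^sup>+x. ennpowr (h x) q * ennreal (lam x powr q) \<partial>lebesgue) (1 / q) \<le> ennpowr (ennpowr C q) (1 / q)"
    using q by (intro ennpowr_mono) auto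
  then show ?thesis using q by (simp add: ennpowr_ennpowr)
qed

lemma test_function_integrable:
  assumes "f \<in> test_functions"
  shows "integrable lebesgue f"
proof -
  define S where "S = closure {x. f x \<noteq> 0}"
  obtain M where M: "\<And>x. cmod (f x) \<le> M"
    using assms unfolding test_functions_def bounded_iff by auto
  have S: "compact S" using assms by (simp add: test_functions_def S_def)
  have "f x = 0" if "x \<notin> S" for x using that closure_subset[of "{x. f x \<noteq> 0}"] by (auto simp: S_def)
  then show ?thesis using M assms S lmeasurable_compact[OF S]
    by (intro integrableI_bounded_set[of S _ _ M]) (auto simp: test_functions_def fmeasurable_def)
qed

lemma loc_integrable_mult_test_function:
  assumes b: "loc_integrable b" and f: "f \<in> test_functions"
  shows "integrable lebesgue (\<lambda>y. b y * f y)"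
proof -
  define S where "S = closure {x. f x \<noteq> 0}"
  obtain M where M: "\<And>x. cmod (f x) \<le> M"
    using f unfolding test_functions_def bounded_iff by auto
  have S: "compact S" using f by (simp add: test_functions_def S_def)
  have f0: "f x = 0" if "x \<notin> S" for x using that closure_subset[of "{x. f x \<noteq> 0}"] by (auto simp: S_def)
  have "integrable lebesgue (\<lambda>y. indicator S y *\<^sub>R b y)"
    using b S by (simp add: loc_integrable_def set_integrable_def)
  then have "integrable lebesgue (\<lambda>y. M * norm (indicator S y *\<^sub>R b y))"
    by (intro integrable_mult_right integrable_norm)
  then show ?thesis
  proof (rule Bochner_Integration.integrable_bound)
    show "(\<lambda>y. b y * f y) \<in> borel_measurable lebesgue"
      using loc_integrable_measurable[OF b] f by (auto simp: test_functions_def)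
    show "AE y in lebesgue. norm (b y * f y) \<le> norm (M * norm (indicator S y *\<^sub>R b y))"
    proof (intro AE_I2)
      fix y
      have "0 \<le> M" using M[of y] norm_ge_zero order_trans by blast
      then show "norm (b y * f y) \<le> norm (M * norm (indicator S y *\<^sub>R b y))"
        using mult_left_mono[OF M[of y], of "cmod (b y)"] f0[of y]
        by (auto simp: indicator_def norm_mult mult.commute[of M])
    qed
  qed
qed

text \<open>
  Only at points where both potentials converge absolutely can the two integrals be combined.
\<close>

lemma commutator_riesz_AE:
  fixes b :: "'a::euclidean_space \<Rightarrow> complex"
  assumes \<alpha>: "0 < \<alpha>" "\<alpha> < real DIM('a)" and b: "loc_integrable b" and f: "f \<in> test_functions"
  shows "AE x in lebesgue. integrable lebesgue (\<lambda>y. (b x - b y) * f y /\<^sub>R norm (x - y) powr (real DIM('a) - \<alpha>)) \<and>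
    commutator b (riesz_potential \<alpha>) f x = (LINT y|lebesgue. (b x - b y) * f y /\<^sub>R norm (x - y) powr (real DIM('a) - \<alpha>))"
  using riesz_potential_converges_AE[OF \<alpha> test_function_integrable[OF f]]
    riesz_potential_converges_AE[OF \<alpha> loc_integrable_mult_test_function[OF b f]]
proof eventually_elim
  case (elim x)
  let ?k = "\<lambda>y. norm (x - y) powr (real DIM('a) - \<alpha>)"
  have eq: "(b x - b y) * f y /\<^sub>R ?k y = b x * (f y /\<^sub>R ?k y) - (b y * f y) /\<^sub>R ?k y" for y
    by (simp add: left_diff_distrib scaleR_diff_right)
  have i: "integrable lebesgue (\<lambda>y. b x * (f y /\<^sub>R ?k y))" using elim(1) by (rule integrable_mult_right)
  have "integrable lebesgue (\<lambda>y. b x * (f y /\<^sub>R ?k y) - (b y * f y) /\<^sub>R ?k y)"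
    using i elim(2) by (rule Bochner_Integration.integrable_diff)
  then show ?case
    unfolding eq commutator_def riesz_potential_def Bochner_Integration.integral_diff[OF i elim(2)]
      integral_mult_right_zero by (rule conjI) (rule refl)
qed

lemma muckenhoupt_cube_finite:
  assumes w: "muckenhoupt s K w" and s: "1 < s" and Q: "Q \<in> cubes"
  shows "0 < (\<integral>\<^sup>+x\<in>Q. ennreal (w x) \<partial>lebesgue)" "(\<integral>\<^sup>+x\<in>Q. ennreal (w x) \<partial>lebesgue) < top"
proof -
  let ?v = "\<lambda>x. w x powr (- 1 / (s - 1))"
  have wm [measurable]: "w \<in> borel_measurable lebesgue" and wp: "AE x in lebesgue. 0 < w x"
    using w by (auto simp: muckenhoupt_def)
  have vp: "AE x in lebesgue. 0 < ?v x" using wp by eventually_elim auto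
  obtain m where m: "0 < m" "emeasure lebesgue Q = ennreal m" using cube_measure[OF Q] by blast
  have Qm: "Q \<in> sets lebesgue" using cube_measure[OF Q] by simp
  have Qp: "0 < emeasure lebesgue Q" using m by simp
  show "0 < (\<integral>\<^sup>+x\<in>Q. ennreal (w x) \<partial>lebesgue)" by (rule nn_set_integral_pos[OF wm wp Qm Qp])
  have v: "0 < (\<integral>\<^sup>+x\<in>Q. ennreal (?v x) \<partial>lebesgue)" by (rule nn_set_integral_pos[OF _ vp Qm Qp]) measurable
  have "nn_avg Q w * ennpowr (nn_avg Q ?v) (s - 1) \<le> ennreal K"
    using w Q by (simp add: muckenhoupt_def)
  then have "nn_avg Q w * ennpowr (nn_avg Q ?v) (s - 1) \<noteq> top" by (auto simp: top_unique)
  moreover have "nn_avg Q ?v \<noteq> 0" using v m unfolding nn_avg_scale[OF m(2,1)] by simp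
  ultimately have "nn_avg Q w \<noteq> top" by (auto simp: ennreal_mult_eq_top_iff)
  then show "(\<integral>\<^sup>+x\<in>Q. ennreal (w x) \<partial>lebesgue) < top"
    using m unfolding nn_avg_scale[OF m(2,1)] less_top[symmetric] by (auto simp: ennreal_mult_eq_top_iff)
qed

lemma cball_subset_cube: "\<exists>Q\<in>cubes. cball 0 r \<subseteq> (Q :: 'a::euclidean_space set)"
proof -
  define s where "s = \<bar>r\<bar> + 1"
  let ?Q = "cbox (- s *\<^sub>R One) (- s *\<^sub>R One + (2 * s) *\<^sub>R One) :: 'a set"
  have "?Q \<in> cubes" unfolding cubes_def s_def by (auto intro!: exI[of _ "- s *\<^sub>R One"] exI[of _ "2 * s"] simp: s_def)
  moreover have "cball 0 r \<subseteq> ?Q"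
  proof
    fix x :: 'a assume "x \<in> cball 0 r"
    then have "norm x \<le> s" by (simp add: s_def)
    then have "\<bar>x \<bullet> i\<bar> \<le> s" if "i \<in> Basis" for i using Basis_le_norm[OF that, of x] by linarith
    then show "x \<in> ?Q" by (auto simp: mem_box inner_simps abs_le_iff minus_le_iff)
  qed
  ultimately show ?thesis by blast
qed

text \<open>
  The commutator is at most \<open>H\<close>, a multiple of the sum of the dyadic majorants over the \<open>2 ^ DIM('a)\<close> shifted grids,
  and the norm of \<open>H\<close> is found by duality.
\<close>

theorem commutator_norm_upper_bound:
  fixes \<mu> lam :: "'a::euclidean_space \<Rightarrow> real"
  assumes \<alpha>: "0 < \<alpha>" "\<alpha> < real DIM('a)" "\<alpha> / real DIM('a) + 1 / q = 1 / p"
    and bw: "bloom_weights p q Km Kl \<mu> lam" and b: "loc_integrable b" and B: "0 < B"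
    and osc: "\<And>Q. Q \<in> cubes \<Longrightarrow> (\<integral>\<^sup>+x\<in>Q. ennreal (cmod (b x - avg Q b)) \<partial>lebesgue) \<le>
      ennreal B * (\<integral>\<^sup>+x\<in>Q. ennreal (\<mu> x * inverse (lam x)) \<partial>lebesgue)"
  shows "op_norm p (\<lambda>x. \<mu> x powr p) q (\<lambda>x. lam x powr q) (commutator b (riesz_potential \<alpha>)) \<le>
    ennreal (6 powr (real DIM('a) - \<alpha>) * 2 ^ DIM('a) * bloom_const p q DIM('a) Km Kl * B)"
  unfolding op_norm_def
proof (rule SUP_least)
  fix f assume "f \<in> {f \<in> test_functions. Lp_norm p (\<lambda>x. \<mu> x powr p) f \<le> 1}"
  then have f: "f \<in> test_functions" and f1: "Lp_norm p (\<lambda>x. \<mu> x powr p) f \<le> 1" by auto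
  interpret W: bloom_weights p q Km Kl \<mu> lam by (rule bw)
  note pq = W.mu.p
  define e where "e = real DIM('a) - \<alpha>"
  have e: "0 < e" using \<alpha> by (simp add: e_def)
  define c where "c = 1 / p - 1 / q - 1"
  have c: "c = - (e / real DIM('a))" using \<alpha>(3) by (simp add: c_def e_def diff_divide_distrib flip: \<alpha>(3))
  define q' where "q' = q / (q - 1)"
  note bm [measurable] = loc_integrable_measurable[OF b]
  have fm [measurable]: "f \<in> borel_measurable lebesgue" using f by (simp add: test_functions_def)
  define h where "h y = ennreal (cmod (f y))" for y
  have hm [measurable]: "h \<in> borel_measurable lebesgue" unfolding h_def by measurable
  define O1 where "O1 T = dyadic_grid.osc_potential (shifted_cell T) c b h" for T
  define H where "H x = ennreal (6 powr e) * (\<Sum>T\<in>Pow Basis. O1 T x)" for x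
  have Om [measurable]: "O1 T \<in> borel_measurable lebesgue" for T
    unfolding O1_def by (intro dyadic_grid.borel_measurable_osc_potential shifted_grid) auto
  have Hm [measurable]: "H \<in> borel_measurable lebesgue" unfolding H_def by measurable
  have point: "AE x in lebesgue. ennreal (cmod (commutator b (riesz_potential \<alpha>) f x)) \<le> H x"
    using commutator_riesz_AE[OF \<alpha>(1,2) b f]
  proof eventually_elim
    case (elim x)
    let ?g = "\<lambda>y. ennreal (cmod (b x - b y)) * h y"
    have i: "integrable lebesgue (\<lambda>y. (b x - b y) * f y /\<^sub>R norm (x - y) powr e)"
      and eq: "commutator b (riesz_potential \<alpha>) f x = (LINT y|lebesgue. (b x - b y) * f y /\<^sub>R norm (x - y) powr e)"
      using elim unfolding e_def by blast+
    have "ennreal (cmod (commutator b (riesz_potential \<alpha>) f x)) \<le>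
       (\<integral>\<^sup>+y. ennreal (cmod ((b x - b y) * f y /\<^sub>R norm (x - y) powr e)) \<partial>lebesgue)"
      unfolding eq by (rule integral_norm_bound_ennreal[OF i])
    also have "\<dots> = (\<integral>\<^sup>+y. ?g y * ennreal (norm (x - y) powr (- e)) \<partial>lebesgue)"
      by (intro nn_integral_cong) (simp add: h_def norm_mult powr_minus ennreal_mult'[symmetric] mult.commute mult.left_commute)
    also have "\<dots> \<le> ennreal (6 powr e) * (\<Sum>T\<in>Pow Basis. (\<integral>\<^sup>+Q. ennreal (measure lebesgue Q powr (- (e / real DIM('a)))) *
       (\<integral>\<^sup>+y\<in>Q. ?g y \<partial>lebesgue) * indicator Q x \<partial>count_space (dyadic_grid.cells (shifted_cell T))))"
      by (rule kernel_le_cell_sum[OF e]) measurable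
    also have "\<dots> \<le> H x"
      unfolding H_def O1_def c[symmetric]
      by (intro mult_left_mono sum_mono dyadic_grid.pair_difference_le_osc_potential shifted_grid) auto
    finally show ?case .
  qed
  define Bd where "Bd = bloom_const p q DIM('a) Km Kl * B"
  have Bd: "0 \<le> Bd" using B bloom_const_nonneg by (simp add: Bd_def)
  have F1: "ennpowr (\<integral>\<^sup>+x. ennpowr (h x) p * ennreal (\<mu> x powr p) \<partial>lebesgue) (1 / p) \<le> 1"
    using f1 unfolding Lp_norm_def h_def by (simp add: ennpowr_ennreal ennreal_mult)
  let ?N = "\<lambda>g. ennpowr (\<integral>\<^sup>+x. ennpowr (g x) q' * ennreal (lam x powr (- q')) \<partial>lebesgue) (1 / q')"
  have pair: "(\<integral>\<^sup>+x. H x * g x \<partial>lebesgue) \<le> ennreal (6 powr e * 2 ^ DIM('a) * Bd) * ?N g"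
    if g [measurable]: "g \<in> borel_measurable lebesgue" for g
  proof -
    have one: "(\<integral>\<^sup>+x. O1 T x * g x \<partial>lebesgue) \<le> ennreal Bd * ?N g" for T
    proof -
      have "(\<integral>\<^sup>+x. O1 T x * g x \<partial>lebesgue) \<le> ennreal Bd * (ennpowr (\<integral>\<^sup>+x. ennpowr (h x) p * ennreal (\<mu> x powr p) \<partial>lebesgue) (1 / p) * ?N g)"
        unfolding O1_def c_def Bd_def q'_def
        by (rule dyadic_grid.osc_potential_bilinear_bound[OF shifted_grid bw b B osc hm g])
      also have "\<dots> \<le> ennreal Bd * (1 * ?N g)" by (intro mult_left_mono mult_right_mono F1) auto
      finally show ?thesis by simp
    qed
    have "(\<integral>\<^sup>+x. H x * g x \<partial>lebesgue) = (\<integral>\<^sup>+x. ennreal (6 powr e) * (\<Sum>T\<in>Pow Basis. O1 T x * g x) \<partial>lebesgue)"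
      by (simp add: H_def sum_distrib_right mult.assoc)
    also have "\<dots> = ennreal (6 powr e) * (\<Sum>T\<in>Pow Basis. (\<integral>\<^sup>+x. O1 T x * g x \<partial>lebesgue))"
      by (subst nn_integral_cmult, measurable, subst nn_integral_sum) auto
    also have "\<dots> \<le> ennreal (6 powr e) * (\<Sum>T\<in>Pow (Basis :: 'a set). ennreal Bd * ?N g)"
      by (intro mult_left_mono sum_mono one) simp
    also have "\<dots> = ennreal (6 powr e * 2 ^ DIM('a) * Bd) * ?N g"
      using Bd by (simp add: card_Pow ennreal_mult ennreal_power[symmetric] mult_ac)
    finally show ?thesis .
  qed
  have "Lp_norm q (\<lambda>x. lam x powr q) (commutator b (riesz_potential \<alpha>) f) \<le>
     ennpowr (\<integral>\<^sup>+x. ennpowr (H x) q * ennreal (lam x powr q) \<partial>lebesgue) (1 / q)"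
    unfolding Lp_norm_def
  proof (intro ennpowr_mono nn_integral_mono_AE)
    show "AE x in lebesgue. ennreal (cmod (commutator b (riesz_potential \<alpha>) f x) powr q * lam x powr q) \<le> ennpowr (H x) q * ennreal (lam x powr q)"
      using point
    proof eventually_elim
      case (elim x)
      have "ennpowr (ennreal (cmod (commutator b (riesz_potential \<alpha>) f x))) q \<le> ennpowr (H x) q"
        using elim pq by (intro ennpowr_mono) auto
      then show ?case by (simp add: ennpowr_ennreal ennreal_mult mult_right_mono)
    qed
  qed (use pq in auto)
  also have "\<dots> \<le> ennreal (6 powr e * 2 ^ DIM('a) * Bd)"
  proof (rule weighted_norm_le_by_duality)
    fix k :: nat
    obtain Q where Q: "Q \<in> cubes" "cball 0 (real k) \<subseteq> (Q :: 'a set)" using cball_subset_cube by blast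
    have "(\<integral>\<^sup>+x\<in>cball 0 (real k). ennreal (lam x powr q) \<partial>lebesgue) \<le> (\<integral>\<^sup>+x\<in>Q. ennreal (lam x powr q) \<partial>lebesgue)"
      using Q(2) by (intro nn_integral_mono) (auto simp: indicator_def)
    also have "\<dots> < top"
      using muckenhoupt_cube_finite(2)[OF W.lam.power_q_muckenhoupt _ Q(1)] pq by simp
    finally show "(\<integral>\<^sup>+x\<in>cball 0 (real k). ennreal (lam x powr q) \<partial>lebesgue) < top" .
  qed (use pq W.lam.pos pair in \<open>auto simp: q'_def\<close>)
  finally show "Lp_norm q (\<lambda>x. lam x powr q) (commutator b (riesz_potential \<alpha>) f) \<le>
      ennreal (6 powr (real DIM('a) - \<alpha>) * 2 ^ DIM('a) * bloom_const p q DIM('a) Km Kl * B)"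
    by (simp add: Bd_def e_def mult.assoc)
qed

section \<open>The lower bound\<close>

text \<open>
  The supremum of the levels \<open>t\<close> for which \<open>{\<phi> < t}\<close> fills at most half of \<open>Q\<close>. Continuity of the measure
  from below gives one inequality, continuity from above the other.
\<close>

lemma median_exists:
  fixes \<phi> :: "'a::euclidean_space \<Rightarrow> real"
  assumes [measurable]: "\<phi> \<in> borel_measurable lebesgue" and Q [measurable]: "Q \<in> lmeasurable" and pos: "0 < measure lebesgue Q"
  shows "\<exists>m. measure lebesgue Q \<le> 2 * measure lebesgue {x\<in>Q. \<phi> x \<le> m} \<and> measure lebesgue Q \<le> 2 * measure lebesgue {x\<in>Q. m \<le> \<phi> x}"
proof -
  have Qs [measurable]: "Q \<in> sets lebesgue" using Q by auto
  let ?\<mu> = "measure lebesgue"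
  have Lm: "{x\<in>Q. P (\<phi> x)} \<in> lmeasurable" if "{x. P (\<phi> x)} \<in> sets lebesgue" for P
  proof -
    have "{x\<in>Q. P (\<phi> x)} = Q \<inter> {x. P (\<phi> x)}" by auto
    then show ?thesis using Q that by (simp add: fmeasurable_Int_fmeasurable)
  qed
  have lt: "{x\<in>Q. \<phi> x < t} \<in> lmeasurable" and le: "{x\<in>Q. \<phi> x \<le> t} \<in> lmeasurable" and ge: "{x\<in>Q. t \<le> \<phi> x} \<in> lmeasurable" for t
  proof -
    have "{x \<in> space lebesgue. \<phi> x < t} \<in> sets lebesgue" "{x \<in> space lebesgue. \<phi> x \<le> t} \<in> sets lebesgue"
      "{x \<in> space lebesgue. t \<le> \<phi> x} \<in> sets lebesgue" by measurable
    then show "{x\<in>Q. \<phi> x < t} \<in> lmeasurable" "{x\<in>Q. \<phi> x \<le> t} \<in> lmeasurable" "{x\<in>Q. t \<le> \<phi> x} \<in> lmeasurable"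
      using Lm[of "\<lambda>v. v < t"] Lm[of "\<lambda>v. v \<le> t"] Lm[of "\<lambda>v. t \<le> v"] by simp_all
  qed
  define G where "G t = ?\<mu> {x\<in>Q. \<phi> x < t}" for t
  have Gmono: "G s \<le> G t" if "s \<le> t" for s t
    unfolding G_def using that lt by (intro measure_mono_fmeasurable) auto
  have up: "(\<lambda>n. G (s n)) \<longlonglongrightarrow> ?\<mu> {x\<in>Q. \<phi> x < t}" if s: "incseq s" "\<And>n. s n \<le> t" "\<And>x. x < t \<Longrightarrow> \<exists>n. x < s n" for s :: "nat \<Rightarrow> real" and t
  proof -
    have "(\<Union>n. {x\<in>Q. \<phi> x < s n}) = {x\<in>Q. \<phi> x < t}" using s(2,3) by (auto intro: less_le_trans)
    moreover have "(\<lambda>n. ?\<mu> {x\<in>Q. \<phi> x < s n}) \<longlonglongrightarrow> ?\<mu> (\<Union>n. {x\<in>Q. \<phi> x < s n})"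
    proof (rule Lim_measure_incseq)
      show "range (\<lambda>n. {x\<in>Q. \<phi> x < s n}) \<subseteq> sets lebesgue" using lt by auto
      show "incseq (\<lambda>n. {x\<in>Q. \<phi> x < s n})" using s(1) by (auto simp: incseq_def intro: less_le_trans)
      show "emeasure lebesgue (\<Union>n. {x\<in>Q. \<phi> x < s n}) \<noteq> \<infinity>"
        unfolding calculation using lt[of t] by (auto simp: fmeasurable_def)
    qed
    ultimately show ?thesis by (simp add: G_def)
  qed
  have down: "(\<lambda>n. G (s n)) \<longlonglongrightarrow> ?\<mu> (\<Inter>n. {x\<in>Q. \<phi> x < s n})" if s: "decseq s" for s :: "nat \<Rightarrow> real"
    unfolding G_def
  proof (rule Lim_measure_decseq)
    show "range (\<lambda>n. {x\<in>Q. \<phi> x < s n}) \<subseteq> sets lebesgue" using lt by auto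
    show "decseq (\<lambda>n. {x\<in>Q. \<phi> x < s n})" using s by (auto simp: decseq_def intro: less_le_trans)
    show "emeasure lebesgue {x\<in>Q. \<phi> x < s i} \<noteq> \<infinity>" for i using lt[of "s i"] by (auto simp: fmeasurable_def)
  qed
  define A where "A = {t. 2 * G t \<le> ?\<mu> Q}"
  have ne: "A \<noteq> {}"
  proof -
    have "(\<lambda>n. G (- real n)) \<longlonglongrightarrow> ?\<mu> (\<Inter>n. {x\<in>Q. \<phi> x < - real n})"
      by (rule down) (auto simp: decseq_def)
    moreover have "(\<Inter>n. {x\<in>Q. \<phi> x < - real n}) = {}"
    proof -
      have "\<exists>n. \<not> \<phi> x < - real n" for x using real_arch_simple[of "- \<phi> x"] by (auto simp: not_less minus_le_iff)
      then show ?thesis by auto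
    qed
    ultimately have "(\<lambda>n. G (- real n)) \<longlonglongrightarrow> 0" by simp
    then have "eventually (\<lambda>n. G (- real n) < ?\<mu> Q / 2) sequentially" using pos by (intro order_tendstoD) auto
    then obtain n where "G (- real n) < ?\<mu> Q / 2" by (auto simp: eventually_sequentially)
    then have "- real n \<in> A" by (simp add: A_def)
    then show ?thesis by blast
  qed
  have "\<exists>N::nat. \<forall>t\<in>A. t \<le> real N"
  proof -
    have "(\<lambda>n. ?\<mu> {x\<in>Q. \<phi> x < real n}) \<longlonglongrightarrow> ?\<mu> (\<Union>n. {x\<in>Q. \<phi> x < real n})"
    proof (rule Lim_measure_incseq)
      show "range (\<lambda>n. {x\<in>Q. \<phi> x < real n}) \<subseteq> sets lebesgue" using lt by auto
      show "incseq (\<lambda>n. {x\<in>Q. \<phi> x < real n})" by (auto simp: incseq_def)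
      have "(\<Union>n. {x\<in>Q. \<phi> x < real n}) \<subseteq> Q" by auto
      then have "emeasure lebesgue (\<Union>n. {x\<in>Q. \<phi> x < real n}) \<le> emeasure lebesgue Q" by (intro emeasure_mono) auto
      then show "emeasure lebesgue (\<Union>n. {x\<in>Q. \<phi> x < real n}) \<noteq> \<infinity>"
        using Q by (auto simp: fmeasurable_def top_unique simp del: emeasure_completion)
    qed
    moreover have "(\<Union>n. {x\<in>Q. \<phi> x < real n}) = Q" using reals_Archimedean2 by auto
    ultimately have "(\<lambda>n. G (real n)) \<longlonglongrightarrow> ?\<mu> Q" by (simp add: G_def)
    then have "eventually (\<lambda>n. ?\<mu> Q / 2 < G (real n)) sequentially" using pos by (intro order_tendstoD) auto
    then obtain n where n: "?\<mu> Q / 2 < G (real n)" by (auto simp: eventually_sequentially)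
    have "t \<le> real n" if "t \<in> A" for t
    proof (rule ccontr)
      assume "\<not> t \<le> real n"
      then have "G (real n) \<le> G t" by (intro Gmono) simp
      then show False using that n by (simp add: A_def)
    qed
    then show ?thesis by blast
  qed
  then have bdd: "bdd_above A" by (auto simp: bdd_above_def)
  define m where "m = Sup A"
  have below: "t \<in> A" if "t < m" for t
  proof -
    have "\<exists>s\<in>A. t < s" using that unfolding m_def less_cSup_iff[OF ne bdd] .
    then obtain s where s: "s \<in> A" "t < s" by blast
    then have "2 * G t \<le> 2 * G s" using Gmono[of t s] by simp
    then show ?thesis using s by (simp add: A_def)
  qed
  have above: "t \<notin> A" if "m < t" for t
    using that cSup_upper[of t A] bdd unfolding m_def by auto
  have "2 * ?\<mu> {x\<in>Q. \<phi> x < m} \<le> ?\<mu> Q"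
  proof -
    have "(\<lambda>n. G (m - 1 / real (Suc n))) \<longlonglongrightarrow> ?\<mu> {x\<in>Q. \<phi> x < m}"
    proof (rule up)
      show "incseq (\<lambda>n. m - 1 / real (Suc n))" by (auto simp: incseq_def frac_le)
      fix x assume "x < m"
      then obtain n where "inverse (real (Suc n)) < m - x" using reals_Archimedean[of "m - x"] by auto
      then show "\<exists>n. x < m - 1 / real (Suc n)" by (intro exI[of _ n]) (simp add: inverse_eq_divide)
    qed auto
    moreover have "G (m - 1 / real (Suc n)) \<le> ?\<mu> Q / 2" for n using below[of "m - 1 / real (Suc n)"] by (simp add: A_def)
    ultimately have "?\<mu> {x\<in>Q. \<phi> x < m} \<le> ?\<mu> Q / 2" by (intro LIMSEQ_le_const2) auto
    then show ?thesis by simp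
  qed
  moreover have "?\<mu> Q = ?\<mu> {x\<in>Q. \<phi> x < m} + ?\<mu> {x\<in>Q. m \<le> \<phi> x}"
  proof -
    have "Q = {x\<in>Q. \<phi> x < m} \<union> {x\<in>Q. m \<le> \<phi> x}" by auto
    moreover have "?\<mu> ({x\<in>Q. \<phi> x < m} \<union> {x\<in>Q. m \<le> \<phi> x}) = ?\<mu> {x\<in>Q. \<phi> x < m} + ?\<mu> {x\<in>Q. m \<le> \<phi> x}"
      using lt[of m] ge[of m] by (intro measure_Union) (auto simp: fmeasurable_def)
    ultimately show ?thesis by simp
  qed
  moreover have "?\<mu> Q \<le> 2 * ?\<mu> {x\<in>Q. \<phi> x \<le> m}"
  proof -
    have "(\<lambda>n. G (m + 1 / real (Suc n))) \<longlonglongrightarrow> ?\<mu> (\<Inter>n. {x\<in>Q. \<phi> x < m + 1 / real (Suc n)})"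
      by (rule down) (auto simp: decseq_def frac_le)
    moreover have "(\<Inter>n. {x\<in>Q. \<phi> x < m + 1 / real (Suc n)}) = {x\<in>Q. \<phi> x \<le> m}"
    proof (intro antisym subsetI)
      fix x assume x: "x \<in> (\<Inter>n. {x\<in>Q. \<phi> x < m + 1 / real (Suc n)})"
      have "\<phi> x \<le> m"
      proof (rule ccontr)
        assume "\<not> \<phi> x \<le> m"
        then obtain n where "inverse (real (Suc n)) < \<phi> x - m" using reals_Archimedean[of "\<phi> x - m"] by auto
        then show False using x by (auto simp: inverse_eq_divide dest!: spec[of _ n])
      qed
      then show "x \<in> {x\<in>Q. \<phi> x \<le> m}" using x by auto
    qed (auto intro: le_less_trans)
    ultimately have "(\<lambda>n. G (m + 1 / real (Suc n))) \<longlonglongrightarrow> ?\<mu> {x\<in>Q. \<phi> x \<le> m}" by simp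
    moreover have "?\<mu> Q / 2 \<le> G (m + 1 / real (Suc n))" for n using above[of "m + 1 / real (Suc n)"] by (simp add: A_def)
    ultimately have "?\<mu> Q / 2 \<le> ?\<mu> {x\<in>Q. \<phi> x \<le> m}" by (intro LIMSEQ_le_const) auto
    then show ?thesis by simp
  qed
  ultimately show ?thesis by (intro exI[of _ m]) auto
qed

lemma indicator_test_function:
  assumes "F \<in> sets lebesgue" "bounded F"
  shows "(\<lambda>y. complex_of_real a * indicator F y) \<in> test_functions"
proof -
  note assms(1)[measurable]
  have "{y. complex_of_real a * indicator F y \<noteq> 0} \<subseteq> F" by (auto simp: indicator_def)
  then have "bounded {y. complex_of_real a * indicator F y \<noteq> 0}" using assms(2) bounded_subset by blast
  moreover have "bounded (range (\<lambda>y. complex_of_real a * indicator F y))"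
    unfolding bounded_iff by (intro exI[of _ "\<bar>a\<bar>"]) (auto simp: indicator_def)
  moreover have "(\<lambda>y. complex_of_real a * indicator F y) \<in> borel_measurable lebesgue" by measurable
  ultimately show ?thesis by (simp add: test_functions_def)
qed

text \<open>
  If \<open>x\<close> lies above the level \<open>m\<close> and all of \<open>F\<close> below it, then \<open>Re (\<theta> * (b x - b y))\<close> is at least
  \<open>Re (\<theta> * b x) - m\<close> for \<open>y\<close> in \<open>F\<close>, and the positive kernel is bounded below on the cube. The unimodular factor
  \<open>\<theta>\<close> allows one statement to serve \<open>\<plusminus> Re b\<close> and \<open>\<plusminus> Im b\<close>.
\<close>

lemma commutator_indicator_lower_AE:
  fixes b :: "'a::euclidean_space \<Rightarrow> complex"
  assumes \<alpha>: "0 < \<alpha>" "\<alpha> < real DIM('a)" and b: "loc_integrable b"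
    and Q: "Q = cbox z (z + l *\<^sub>R One)" "0 < l" and F: "F \<in> sets lebesgue" "F \<subseteq> Q" and a: "0 \<le> a"
    and \<theta>: "cmod \<theta> = 1" and Fm: "\<And>y. y \<in> F \<Longrightarrow> Re (\<theta> * b y) \<le> m"
  shows "AE x in lebesgue. x \<in> Q \<longrightarrow> m \<le> Re (\<theta> * b x) \<longrightarrow>
    (Re (\<theta> * b x) - m) * (a * (real DIM('a) * l) powr (- (real DIM('a) - \<alpha>)) * measure lebesgue F) \<le>
    cmod (commutator b (riesz_potential \<alpha>) (\<lambda>y. complex_of_real a * indicator F y) x)"
proof -
  define e where "e = real DIM('a) - \<alpha>"
  have e: "0 < e" using \<alpha> by (simp add: e_def)
  define \<kappa> where "\<kappa> = (real DIM('a) * l) powr (- e)"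
  define f where "f y = complex_of_real a * indicator F y" for y
  have Flm: "F \<in> lmeasurable"
    using F Q(1) by (intro bounded_set_imp_lmeasurable) (auto intro: bounded_subset[OF bounded_cbox])
  have f: "f \<in> test_functions" unfolding f_def[abs_def]
    using F Q(1) by (intro indicator_test_function) (auto intro: bounded_subset[OF bounded_cbox])
  show ?thesis
    using commutator_riesz_AE[OF \<alpha> b f]
  proof eventually_elim
    case (elim x)
    define G where "G y = (b x - b y) * f y /\<^sub>R norm (x - y) powr e" for y
    have G: "integrable lebesgue G" and cG: "commutator b (riesz_potential \<alpha>) f x = (LINT y|lebesgue. G y)"
      using elim unfolding G_def e_def by blast+
    show ?case
    proof (intro impI)
      assume x: "x \<in> Q" "m \<le> Re (\<theta> * b x)"
      define d where "d = Re (\<theta> * b x) - m"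
      have d: "0 \<le> d" using x by (simp add: d_def)
      have near: "d * a * \<kappa> * indicator F y \<le> Re (\<theta> * G y)" if "y \<noteq> x" for y
      proof (cases "y \<in> F")
        case True
        have y: "y \<in> Q" using True F by blast
        have "norm (x - y) \<le> (\<Sum>i\<in>Basis. \<bar>(x - y) \<bullet> i\<bar>)" by (rule norm_le_l1)
        also have "\<dots> \<le> (\<Sum>i\<in>(Basis::'a set). l)"
        proof (rule sum_mono)
          fix i :: 'a assume i: "i \<in> Basis"
          have "z \<bullet> i \<le> x \<bullet> i" "x \<bullet> i \<le> z \<bullet> i + l" "z \<bullet> i \<le> y \<bullet> i" "y \<bullet> i \<le> z \<bullet> i + l"
            using x(1) y i unfolding Q(1) by (auto simp: mem_box inner_simps)
          then show "\<bar>(x - y) \<bullet> i\<bar> \<le> l" by (simp add: inner_diff_left)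
        qed
        finally have "norm (x - y) \<le> real DIM('a) * l" by simp
        then have \<kappa>: "\<kappa> \<le> norm (x - y) powr (- e)"
          unfolding \<kappa>_def using that e by (intro powr_mono2') auto
        have k0: "0 \<le> \<kappa>" by (simp add: \<kappa>_def)
        have "Re (\<theta> * G y) = (Re (\<theta> * b x) - Re (\<theta> * b y)) * a * norm (x - y) powr (- e)"
        proof -
          have "\<theta> * G y = (a * norm (x - y) powr (- e)) *\<^sub>R (\<theta> * b x - \<theta> * b y)"
            using True by (simp add: G_def f_def powr_minus scaleR_conv_of_real algebra_simps)
          then show ?thesis by simp
        qed
        moreover have "d * a * \<kappa> \<le> (Re (\<theta> * b x) - Re (\<theta> * b y)) * a * norm (x - y) powr (- e)"
          using Fm[OF True] a d \<kappa> k0 by (intro mult_mono mult_right_mono) (auto simp: d_def)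
        ultimately show ?thesis using True by simp
      next
        case False
        then show ?thesis by (simp add: G_def f_def)
      qed
      have Gr: "integrable lebesgue (\<lambda>y. Re (\<theta> * G y))"
        using G by (intro integrable_Re integrable_mult_right)
      have "d * a * \<kappa> * measure lebesgue F = (LINT y|lebesgue. d * a * \<kappa> * indicator F y)"
        using F by simp
      also have "\<dots> \<le> (LINT y|lebesgue. Re (\<theta> * G y))"
      proof (rule integral_mono_AE[OF _ Gr])
        show "integrable lebesgue (\<lambda>y. d * a * \<kappa> * indicator F y)"
          using Flm by (intro integrable_mult_right) (auto simp: fmeasurable_def)
        have "AE y in lebesgue. y \<notin> {x}" by (rule AE_not_in) simp
        then show "AE y in lebesgue. d * a * \<kappa> * indicator F y \<le> Re (\<theta> * G y)"
          by eventually_elim (use near in auto)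
      qed
      also have "\<dots> = Re (\<theta> * (LINT y|lebesgue. G y))"
        using G by (subst integral_Re) (auto simp del: times_complex.sel)
      also have "\<dots> \<le> cmod (\<theta> * (LINT y|lebesgue. G y))" by (rule complex_Re_le_cmod)
      also have "\<dots> = cmod (commutator b (riesz_potential \<alpha>) f x)" using \<theta> cG by (simp add: norm_mult)
      finally show "(Re (\<theta> * b x) - m) * (a * (real DIM('a) * l) powr (- (real DIM('a) - \<alpha>)) * measure lebesgue F) \<le>
        cmod (commutator b (riesz_potential \<alpha>) (\<lambda>y. complex_of_real a * indicator F y) x)"
        unfolding d_def \<kappa>_def e_def f_def[abs_def] by (simp only: mult_ac)
    qed
  qed
qed

definition lower_const :: "real \<Rightarrow> real \<Rightarrow> nat \<Rightarrow> real \<Rightarrow> real \<Rightarrow> real"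
  where "lower_const \<alpha> q n Km Kl = 2 * real n powr (real n - \<alpha>) * (Km * Kl) powr (1 / q)"

text \<open>
  The commutator is tested on the indicator of \<open>F\<close>, normalised in \<open>L^p(\<mu>^p)\<close>. Hoelder's inequality brings in the dual
  norm of the indicator of \<open>Q\<close> in \<open>L^q(lam^q)\<close>, and \<open>product_average_le_\<nu>\<close> compares the product of the two norms of
  indicators with \<open>\<nu>(Q)\<close>.
\<close>

lemma one_sided_oscillation_bound:
  fixes \<mu> lam :: "'a::euclidean_space \<Rightarrow> real" and b :: "'a \<Rightarrow> complex"
  assumes \<alpha>: "0 < \<alpha>" "\<alpha> < real DIM('a)" "\<alpha> / real DIM('a) + 1 / q = 1 / p"
    and bw: "bloom_weights p q Km Kl \<mu> lam" and b: "loc_integrable b"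
    and Q: "Q \<in> cubes" and F: "F \<in> sets lebesgue" "F \<subseteq> Q" "measure lebesgue Q \<le> 2 * measure lebesgue F"
    and \<theta>: "cmod \<theta> = 1" and Fm: "\<And>y. y \<in> F \<Longrightarrow> Re (\<theta> * b y) \<le> m"
  shows "(\<integral>\<^sup>+x\<in>Q. ennreal (Re (\<theta> * b x) - m) \<partial>lebesgue) \<le>
    ennreal (lower_const \<alpha> q DIM('a) Km Kl) *
    op_norm p (\<lambda>x. \<mu> x powr p) q (\<lambda>x. lam x powr q) (commutator b (riesz_potential \<alpha>)) *
    (\<integral>\<^sup>+x\<in>Q. ennreal (\<mu> x * inverse (lam x)) \<partial>lebesgue)"
proof -
  interpret W: bloom_weights p q Km Kl \<mu> lam by (rule bw)
  note pq = W.mu.p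
  define N where "N = op_norm p (\<lambda>x. \<mu> x powr p) q (\<lambda>x. lam x powr q) (commutator b (riesz_potential \<alpha>))"
  define q' where "q' = q / (q - 1)"
  have q': "1 < q'" "1 / q + 1 / q' = 1" using W.mu.conj_exponents by (auto simp: q'_def)
  obtain z l where Ql: "Q = cbox z (z + l *\<^sub>R One)" "0 < l" using Q by (auto simp: cubes_def)
  define n where "n = real DIM('a)"
  have n: "0 < n" by (simp add: n_def)
  define V where "V = l ^ DIM('a)"
  have V: "0 < V" using Ql by (simp add: V_def)
  have eQ: "emeasure lebesgue Q = ennreal V"
    unfolding Ql(1) V_def using Ql(2) by (simp add: emeasure_lborel_cbox_eq inner_simps less_imp_le)
  have mQ: "measure lebesgue Q = V" using eQ V by (simp add: measure_def)
  note [measurable] = loc_integrable_measurable[OF b] F(1) cube_measure(1)[OF Q]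
  define \<kappa> where "\<kappa> = (n * l) powr (- (n - \<alpha>))"
  have \<kappa>: "0 < \<kappa>" using n Ql by (simp add: \<kappa>_def)
  define vF where "vF = measure lebesgue F"
  have vF: "V \<le> 2 * vF" "0 < vF" using F(3) mQ V by (auto simp: vF_def)
  have eF: "0 < emeasure lebesgue F"
    using vF(2) unfolding vF_def measure_def by (metis enn2real_0 less_irrefl zero_less_iff_neq_zero)
  let ?I = "\<integral>\<^sup>+x\<in>F. ennreal (\<mu> x powr p) \<partial>lebesgue"
  have IF: "?I \<le> (\<integral>\<^sup>+x\<in>Q. ennreal (\<mu> x powr p) \<partial>lebesgue)"
    using F(2) by (intro nn_integral_mono) (auto simp: indicator_def)
  have I: "0 < ?I" "?I < top"
  proof -
    have "AE x in lebesgue. 0 < \<mu> x powr p" using W.mu.pos by eventually_elim auto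
    then show "0 < ?I" by (intro nn_set_integral_pos F eF) measurable
    show "?I < top" using IF muckenhoupt_cube_finite(2)[OF W.mu.power_p_muckenhoupt pq(1) Q] by (rule le_less_trans)
  qed
  \<comment> \<open>The norm of the indicator of \<open>F\<close>, positive and finite, so that dividing by it is legitimate.\<close>
  define A where "A = enn2real (ennpowr ?I (1 / p))"
  have A: "ennpowr ?I (1 / p) = ennreal A" "0 < A"
  proof -
    have "0 < ennpowr ?I (1 / p)" "ennpowr ?I (1 / p) < top"
      using I by (auto simp: zero_less_iff_neq_zero less_top[symmetric])
    then show "ennpowr ?I (1 / p) = ennreal A" "0 < A" by (auto simp: A_def enn2real_positive_iff)
  qed
  define f where "f y = complex_of_real (1 / A) * indicator F y" for y
  have f: "f \<in> test_functions" unfolding f_def[abs_def]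
    using F Ql(1) by (intro indicator_test_function) (auto intro: bounded_subset[OF bounded_cbox])
  have "Lp_norm p (\<lambda>x. \<mu> x powr p) f \<le> 1"
  proof -
    have "(\<integral>\<^sup>+x. ennreal (cmod (f x) powr p * \<mu> x powr p) \<partial>lebesgue) = (\<integral>\<^sup>+x. ennreal ((1 / A) powr p) * (ennreal (\<mu> x powr p) * indicator F x) \<partial>lebesgue)"
      using A by (intro nn_integral_cong) (auto simp: f_def indicator_def norm_divide ennreal_mult)
    also have "\<dots> = ennreal ((1 / A) powr p) * ?I" by (rule nn_integral_cmult) measurable
    finally have "Lp_norm p (\<lambda>x. \<mu> x powr p) f = ennreal (1 / A) * ennreal A"
      using pq A by (simp add: Lp_norm_def ennpowr_mult ennpowr_ennreal powr_powr)
    then show ?thesis using A by (simp add: ennreal_mult'[symmetric])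
  qed
  then have fN: "Lp_norm q (\<lambda>x. lam x powr q) (commutator b (riesz_potential \<alpha>) f) \<le> N"
    unfolding N_def op_norm_def using f by (intro SUP_upper) auto
  define u where "u x = ennreal (Re (\<theta> * b x) - m) * indicator Q x" for x
  have um [measurable]: "u \<in> borel_measurable lebesgue" unfolding u_def by measurable
  define k where "k = 1 / A * \<kappa> * vF"
  have k: "0 < k" using A \<kappa> vF by (simp add: k_def)
  have lb: "AE x in lebesgue. x \<in> Q \<longrightarrow> m \<le> Re (\<theta> * b x) \<longrightarrow>
      (Re (\<theta> * b x) - m) * k \<le> cmod (commutator b (riesz_potential \<alpha>) f x)"
    using commutator_indicator_lower_AE[OF \<alpha>(1,2) b Ql F(1,2) _ \<theta> Fm, of "1 / A"] A(2)
    unfolding k_def \<kappa>_def n_def vF_def f_def[abs_def] by simp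
  have point: "AE x in lebesgue. u x * ennreal k \<le> ennreal (cmod (commutator b (riesz_potential \<alpha>) f x))"
    using lb
  proof eventually_elim
    case (elim x)
    show ?case
    proof (cases "x \<in> Q \<and> m \<le> Re (\<theta> * b x)")
      case True
      then have "ennreal ((Re (\<theta> * b x) - m) * k) \<le> ennreal (cmod (commutator b (riesz_potential \<alpha>) f x))"
        using elim by (intro ennreal_leI) auto
      moreover have "ennreal ((Re (\<theta> * b x) - m) * k) = ennreal (Re (\<theta> * b x) - m) * ennreal k"
        using True k by (intro ennreal_mult) auto
      moreover have "u x = ennreal (Re (\<theta> * b x) - m)" using True by (simp add: u_def)
      ultimately show ?thesis by metis
    next
      case False
      then have "u x = 0" by (auto simp: u_def indicator_def ennreal_neg)
      then show ?thesis by simp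
    qed
  qed
  define S where "S = (\<integral>\<^sup>+x. ennpowr (u x) q * ennreal (lam x powr q) \<partial>lebesgue)"
  define L where "L = (\<integral>\<^sup>+x\<in>Q. ennreal (lam x powr (- q')) \<partial>lebesgue)"
  have kS: "ennreal k * ennpowr S (1 / q) \<le> N"
  proof -
    have "ennpowr (ennreal k) q * S = (\<integral>\<^sup>+x. ennpowr (ennreal k) q * (ennpowr (u x) q * ennreal (lam x powr q)) \<partial>lebesgue)"
      unfolding S_def by (rule nn_integral_cmult[symmetric]) measurable
    also have "\<dots> \<le> (\<integral>\<^sup>+x. ennreal (cmod (commutator b (riesz_potential \<alpha>) f x) powr q * lam x powr q) \<partial>lebesgue)"
    proof (intro nn_integral_mono_AE)
      show "AE x in lebesgue. ennpowr (ennreal k) q * (ennpowr (u x) q * ennreal (lam x powr q)) \<le>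
         ennreal (cmod (commutator b (riesz_potential \<alpha>) f x) powr q * lam x powr q)"
        using point
      proof eventually_elim
        case (elim x)
        have "ennpowr (u x * ennreal k) q \<le> ennpowr (ennreal (cmod (commutator b (riesz_potential \<alpha>) f x))) q"
          using elim pq by (intro ennpowr_mono) auto
        then have "ennpowr (u x * ennreal k) q * ennreal (lam x powr q) \<le> ennreal (cmod (commutator b (riesz_potential \<alpha>) f x) powr q) * ennreal (lam x powr q)"
          by (intro mult_right_mono) (auto simp: ennpowr_ennreal)
        then show ?case using pq by (simp add: ennpowr_mult ennreal_mult mult_ac)
      qed
    qed
    finally have "ennpowr (ennpowr (ennreal k) q * S) (1 / q) \<le> Lp_norm q (\<lambda>x. lam x powr q) (commutator b (riesz_potential \<alpha>) f)"
      unfolding Lp_norm_def using pq by (intro ennpowr_mono) auto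
    also have "\<dots> \<le> N" by (rule fN)
    finally show ?thesis using pq by (simp add: ennpowr_mult ennpowr_ennpowr)
  qed
  have "(\<integral>\<^sup>+x\<in>Q. ennreal (Re (\<theta> * b x) - m) \<partial>lebesgue) =
     (\<integral>\<^sup>+x. (u x * ennreal (lam x powr 1)) * (ennreal (lam x powr (-1)) * indicator Q x) \<partial>lebesgue)"
    using W.lam.pos
  proof (intro nn_integral_cong_AE, eventually_elim)
    case (elim x)
    have "ennreal (lam x powr 1) * ennreal (lam x powr (-1)) = 1"
      using elim by (simp add: powr_minus ennreal_mult'[symmetric])
    then have "(u x * ennreal (lam x powr 1)) * (ennreal (lam x powr (-1)) * indicator Q x) = u x * indicator Q x"
      by (metis (no_types, lifting) mult.assoc mult.right_neutral)
    then show ?case by (simp add: u_def indicator_def)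
  qed
  also have "\<dots> \<le> ennpowr (\<integral>\<^sup>+x. ennpowr (u x * ennreal (lam x powr 1)) q \<partial>lebesgue) (1 / q) *
     ennpowr (\<integral>\<^sup>+x. ennpowr (ennreal (lam x powr (-1)) * indicator Q x) q' \<partial>lebesgue) (1 / q')"
    using pq q' by (intro nn_integral_Hoelder) auto
  also have "(\<integral>\<^sup>+x. ennpowr (u x * ennreal (lam x powr 1)) q \<partial>lebesgue) = S"
    unfolding S_def using W.lam.pos
    by (intro nn_integral_cong_AE, eventually_elim) (use pq in \<open>simp add: ennpowr_mult ennpowr_ennreal\<close>)
  also have "(\<integral>\<^sup>+x. ennpowr (ennreal (lam x powr (-1)) * indicator Q x) q' \<partial>lebesgue) = L"
    unfolding L_def indicator_ennpowr by (simp only: ennpowr_ennreal[OF powr_ge_zero] powr_powr mult_minus1)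
  finally have main: "(\<integral>\<^sup>+x\<in>Q. ennreal (Re (\<theta> * b x) - m) \<partial>lebesgue) \<le> ennpowr S (1 / q) * ennpowr L (1 / q')" .
  have Sle: "ennpowr S (1 / q) \<le> ennreal (2 / (\<kappa> * V)) * ennreal A * N"
  proof -
    have "ennpowr S (1 / q) = ennreal (1 / k) * (ennreal k * ennpowr S (1 / q))"
      using k by (simp add: mult.assoc[symmetric] ennreal_mult'[symmetric])
    also have "\<dots> \<le> ennreal (1 / k) * N" by (intro mult_left_mono kS) simp
    also have "\<dots> \<le> ennreal (2 / (\<kappa> * V) * A) * N"
    proof (intro mult_right_mono ennreal_leI)
      have "1 / k = A / \<kappa> * (1 / vF)" by (simp add: k_def)
      also have "\<dots> \<le> A / \<kappa> * (2 / V)"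
        using vF V A \<kappa> by (intro mult_left_mono) (auto simp: field_simps)
      also have "\<dots> = 2 / (\<kappa> * V) * A" by simp
      finally show "1 / k \<le> 2 / (\<kappa> * V) * A" .
    qed simp
    also have "\<dots> = ennreal (2 / (\<kappa> * V)) * ennreal A * N"
      using \<kappa> V A(2) by (subst ennreal_mult) auto
    finally show ?thesis .
  qed
  note sc = nn_avg_scale[OF eQ V]
  have int_avg: "(\<integral>\<^sup>+x\<in>Q. ennreal (g x) \<partial>lebesgue) = ennreal V * nn_avg Q g" for g
    unfolding sc using V by (simp add: mult.assoc[symmetric] ennreal_mult'[symmetric])
  define K3 where "K3 = (Km * Kl) powr (1 / q)"
  have "ennreal A * ennpowr L (1 / q') \<le> ennpowr (\<integral>\<^sup>+x\<in>Q. ennreal (\<mu> x powr p) \<partial>lebesgue) (1 / p) * ennpowr L (1 / q')"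
    unfolding A(1)[symmetric] using pq by (intro mult_right_mono ennpowr_mono IF) auto
  also have "\<dots> = ennreal (V powr (1 / p)) * ennreal (V powr (1 / q')) *
     (ennpowr (nn_avg Q (\<lambda>x. \<mu> x powr p)) (1 / p) * ennpowr (nn_avg Q (\<lambda>x. lam x powr (- q'))) (1 / q'))"
    unfolding L_def int_avg using pq q' V by (simp add: ennpowr_mult ennpowr_ennreal mult_ac)
  also have "\<dots> \<le> ennreal (V powr (1 / p)) * ennreal (V powr (1 / q')) * (ennreal K3 * nn_avg Q W.\<nu>)"
    unfolding K3_def q'_def by (intro mult_left_mono W.product_average_le_\<nu> Q) auto
  finally have AL: "ennreal A * ennpowr L (1 / q') \<le> ennreal (V powr (1 / p)) * ennreal (V powr (1 / q')) * (ennreal K3 * nn_avg Q W.\<nu>)" .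
  have scale: "2 / (\<kappa> * V) * (V powr (1 / p) * V powr (1 / q')) * (1 / V) = 2 * n powr (n - \<alpha>)"
  proof -
    have ln: "V = l powr n" using Ql(2) by (simp add: V_def n_def powr_realpow)
    have e1: "1 / p + 1 / q' = 1 + \<alpha> / n" using \<alpha>(3) q'(2) by (simp add: n_def)
    have "V powr (1 / p) * V powr (1 / q') = V * V powr (\<alpha> / n)"
      unfolding powr_add[symmetric] e1 using V by (simp add: powr_add)
    moreover have "V powr (\<alpha> / n) = l powr \<alpha>" using n by (simp add: ln powr_powr)
    moreover have "1 / \<kappa> = n powr (n - \<alpha>) * l powr (n - \<alpha>)"
    proof -
      have "1 / (n * l) powr (- e) = n powr e * l powr e" for e
        by (simp add: powr_mult powr_minus divide_inverse)
      then show ?thesis unfolding \<kappa>_def .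
    qed
    moreover have "l powr (n - \<alpha>) * l powr \<alpha> = V" using ln by (simp flip: powr_add)
    moreover have "2 / (\<kappa> * V) * (V * l powr \<alpha>) * (1 / V) = 2 * (1 / \<kappa>) * l powr \<alpha> / V" using V by simp
    ultimately have "2 / (\<kappa> * V) * (V powr (1 / p) * V powr (1 / q')) * (1 / V) = 2 * n powr (n - \<alpha>) * (l powr (n - \<alpha>) * l powr \<alpha>) / V"
      by (simp add: mult.assoc)
    then show ?thesis using \<open>l powr (n - \<alpha>) * l powr \<alpha> = V\<close> V by simp
  qed
  have K3: "0 \<le> K3" by (simp add: K3_def)
  note main
  also have "ennpowr S (1 / q) * ennpowr L (1 / q') \<le> (ennreal (2 / (\<kappa> * V)) * ennreal A * N) * ennpowr L (1 / q')"
    by (intro mult_right_mono Sle) simp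
  also have "\<dots> = ennreal (2 / (\<kappa> * V)) * N * (ennreal A * ennpowr L (1 / q'))" by (simp only: mult_ac)
  also have "\<dots> \<le> ennreal (2 / (\<kappa> * V)) * N * (ennreal (V powr (1 / p)) * ennreal (V powr (1 / q')) * (ennreal K3 * nn_avg Q W.\<nu>))"
    by (intro mult_left_mono AL) simp
  also have "\<dots> = ennreal (2 / (\<kappa> * V)) * N * (ennreal (V powr (1 / p)) * ennreal (V powr (1 / q')) * (ennreal K3 * (ennreal (1 / V) * (\<integral>\<^sup>+x\<in>Q. ennreal (W.\<nu> x) \<partial>lebesgue))))"
    unfolding sc ..
  also have "\<dots> = (ennreal (2 / (\<kappa> * V)) * (ennreal (V powr (1 / p)) * ennreal (V powr (1 / q'))) * ennreal (1 / V)) * ennreal K3 * N * (\<integral>\<^sup>+x\<in>Q. ennreal (W.\<nu> x) \<partial>lebesgue)"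
    by (simp only: mult_ac)
  also have "ennreal (2 / (\<kappa> * V)) * (ennreal (V powr (1 / p)) * ennreal (V powr (1 / q'))) * ennreal (1 / V) =
      ennreal (2 / (\<kappa> * V) * (V powr (1 / p) * V powr (1 / q')) * (1 / V))"
    using \<kappa> V by (simp add: ennreal_mult'[symmetric])
  also have "\<dots> * ennreal K3 = ennreal (lower_const \<alpha> q DIM('a) Km Kl)"
    unfolding scale lower_const_def K3_def[symmetric] n_def[symmetric] using K3 by (simp add: ennreal_mult'[symmetric])
  finally show ?thesis unfolding N_def W.\<nu>_def .
qed

text \<open>
  A median splits the oscillation of \<open>Re b\<close> into two one-sided parts, and likewise for \<open>Im b\<close>: four applications of
  \<open>one_sided_oscillation_bound\<close>. Passing from the medians to the average of \<open>b\<close> doubles the bound.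
\<close>

theorem oscillation_le_commutator_norm:
  fixes \<mu> lam :: "'a::euclidean_space \<Rightarrow> real" and b :: "'a \<Rightarrow> complex"
  assumes \<alpha>: "0 < \<alpha>" "\<alpha> < real DIM('a)" "\<alpha> / real DIM('a) + 1 / q = 1 / p"
    and bw: "bloom_weights p q Km Kl \<mu> lam" and b: "loc_integrable b" and Q: "Q \<in> cubes"
  shows "(\<integral>\<^sup>+x\<in>Q. ennreal (cmod (b x - avg Q b)) \<partial>lebesgue) \<le>
    8 * (ennreal (lower_const \<alpha> q DIM('a) Km Kl) *
    op_norm p (\<lambda>x. \<mu> x powr p) q (\<lambda>x. lam x powr q) (commutator b (riesz_potential \<alpha>)) *
    (\<integral>\<^sup>+x\<in>Q. ennreal (\<mu> x * inverse (lam x)) \<partial>lebesgue))" (is "_ \<le> 8 * ?X")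
proof -
  note [measurable] = loc_integrable_measurable[OF b] cube_measure(1)[OF Q]
  obtain v where v: "0 < v" "emeasure lebesgue Q = ennreal v" using cube_measure(2)[OF Q] by blast
  have mv: "measure lebesgue Q = v" using v by (simp add: measure_def)
  have Qlm: "Q \<in> lmeasurable" using v cube_measure(1)[OF Q] by (simp add: fmeasurable_def)
  note one_sided = one_sided_oscillation_bound[OF \<alpha> bw b Q]
  have both: "\<exists>m. (\<integral>\<^sup>+x\<in>Q. ennreal \<bar>Re (\<theta> * b x) - m\<bar> \<partial>lebesgue) \<le> ?X + ?X" if \<theta>: "cmod \<theta> = 1" for \<theta>
  proof -
    have \<phi>: "(\<lambda>x. Re (\<theta> * b x)) \<in> borel_measurable lebesgue" by measurable
    have "0 < measure lebesgue Q" using v mv by simp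
    from median_exists[OF \<phi> Qlm this] obtain m where
      m: "measure lebesgue Q \<le> 2 * measure lebesgue {x\<in>Q. Re (\<theta> * b x) \<le> m}"
         "measure lebesgue Q \<le> 2 * measure lebesgue {x\<in>Q. m \<le> Re (\<theta> * b x)}" by blast
    have s: "{x\<in>Q. Re (\<theta> * b x) \<le> m} \<in> sets lebesgue" "{x\<in>Q. m \<le> Re (\<theta> * b x)} \<in> sets lebesgue"
    proof -
      have "{x\<in>space lebesgue. x \<in> Q \<and> Re (\<theta> * b x) \<le> m} \<in> sets lebesgue" "{x\<in>space lebesgue. x \<in> Q \<and> m \<le> Re (\<theta> * b x)} \<in> sets lebesgue"
        by measurable
      then show "{x\<in>Q. Re (\<theta> * b x) \<le> m} \<in> sets lebesgue" "{x\<in>Q. m \<le> Re (\<theta> * b x)} \<in> sets lebesgue" by simp_all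
    qed
    have 1: "(\<integral>\<^sup>+x\<in>Q. ennreal (Re (\<theta> * b x) - m) \<partial>lebesgue) \<le> ?X"
      by (rule one_sided[OF s(1) _ m(1) \<theta>]) auto
    have 2: "(\<integral>\<^sup>+x\<in>Q. ennreal (Re (- \<theta> * b x) - (- m)) \<partial>lebesgue) \<le> ?X"
      by (rule one_sided[OF s(2) _ m(2)]) (use \<theta> in auto)
    have "(\<integral>\<^sup>+x\<in>Q. ennreal \<bar>Re (\<theta> * b x) - m\<bar> \<partial>lebesgue) =
       (\<integral>\<^sup>+x. ennreal (Re (\<theta> * b x) - m) * indicator Q x + ennreal (Re (- \<theta> * b x) - (- m)) * indicator Q x \<partial>lebesgue)"
      by (intro nn_integral_cong) (auto simp: indicator_def abs_if ennreal_neg)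
    also have "\<dots> = (\<integral>\<^sup>+x\<in>Q. ennreal (Re (\<theta> * b x) - m) \<partial>lebesgue) + (\<integral>\<^sup>+x\<in>Q. ennreal (Re (- \<theta> * b x) - (- m)) \<partial>lebesgue)"
      by (rule nn_integral_add) measurable
    also have "\<dots> \<le> ?X + ?X" by (rule add_mono[OF 1 2])
    finally show ?thesis by blast
  qed
  obtain m1 where m1: "(\<integral>\<^sup>+x\<in>Q. ennreal \<bar>Re (1 * b x) - m1\<bar> \<partial>lebesgue) \<le> ?X + ?X" using both[of 1] by auto
  obtain m2 where m2: "(\<integral>\<^sup>+x\<in>Q. ennreal \<bar>Re (- \<i> * b x) - m2\<bar> \<partial>lebesgue) \<le> ?X + ?X" using both[of "- \<i>"] by auto
  define c where "c = Complex m1 m2"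
  have "(\<integral>\<^sup>+x\<in>Q. ennreal (cmod (b x - c)) \<partial>lebesgue) \<le>
     (\<integral>\<^sup>+x. ennreal \<bar>Re (1 * b x) - m1\<bar> * indicator Q x + ennreal \<bar>Re (- \<i> * b x) - m2\<bar> * indicator Q x \<partial>lebesgue)"
  proof (intro nn_integral_mono)
    fix x
    have "cmod (b x - c) \<le> \<bar>Re (1 * b x) - m1\<bar> + \<bar>Re (- \<i> * b x) - m2\<bar>"
      using cmod_le[of "b x - c"] by (simp add: c_def)
    then have "ennreal (cmod (b x - c)) \<le> ennreal \<bar>Re (1 * b x) - m1\<bar> + ennreal \<bar>Re (- \<i> * b x) - m2\<bar>"
      by (simp add: ennreal_leI flip: ennreal_plus)
    then show "ennreal (cmod (b x - c)) * indicator Q x \<le> ennreal \<bar>Re (1 * b x) - m1\<bar> * indicator Q x + ennreal \<bar>Re (- \<i> * b x) - m2\<bar> * indicator Q x"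
      by (auto simp: indicator_def)
  qed
  also have "\<dots> = (\<integral>\<^sup>+x\<in>Q. ennreal \<bar>Re (1 * b x) - m1\<bar> \<partial>lebesgue) + (\<integral>\<^sup>+x\<in>Q. ennreal \<bar>Re (- \<i> * b x) - m2\<bar> \<partial>lebesgue)"
    by (rule nn_integral_add) measurable
  also have "\<dots> \<le> (?X + ?X) + (?X + ?X)" by (rule add_mono[OF m1 m2])
  finally have bc: "(\<integral>\<^sup>+x\<in>Q. ennreal (cmod (b x - c)) \<partial>lebesgue) \<le> (?X + ?X) + (?X + ?X)" .
  have bQ: "set_integrable lebesgue Q b"
    using b Q by (auto simp: loc_integrable_def cubes_def)
  have "(\<integral>\<^sup>+x\<in>Q. ennreal (cmod (b x - avg Q b)) \<partial>lebesgue) \<le>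
     (\<integral>\<^sup>+x. ennreal (cmod (b x - c)) * indicator Q x + ennreal (cmod (avg Q b - c)) * indicator Q x \<partial>lebesgue)"
  proof (intro nn_integral_mono)
    fix x
    have "cmod (b x - avg Q b) \<le> cmod (b x - c) + cmod (avg Q b - c)"
      using norm_triangle_ineq4[of "b x - c" "avg Q b - c"] by simp
    then have "ennreal (cmod (b x - avg Q b)) \<le> ennreal (cmod (b x - c)) + ennreal (cmod (avg Q b - c))"
      by (simp add: ennreal_leI flip: ennreal_plus)
    then show "ennreal (cmod (b x - avg Q b)) * indicator Q x \<le> ennreal (cmod (b x - c)) * indicator Q x + ennreal (cmod (avg Q b - c)) * indicator Q x"
      by (auto simp: indicator_def)
  qed
  also have "\<dots> = (\<integral>\<^sup>+x\<in>Q. ennreal (cmod (b x - c)) \<partial>lebesgue) + ennreal (cmod (avg Q b - c)) * emeasure lebesgue Q"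
    by (subst nn_integral_add) (auto simp: nn_integral_cmult_indicator)
  also have "\<dots> \<le> (\<integral>\<^sup>+x\<in>Q. ennreal (cmod (b x - c)) \<partial>lebesgue) + (\<integral>\<^sup>+x\<in>Q. ennreal (cmod (b x - c)) \<partial>lebesgue)"
    using v by (intro add_left_mono norm_avg_minus_le bQ cube_measure(1)[OF Q]) auto
  also have "\<dots> \<le> ((?X + ?X) + (?X + ?X)) + ((?X + ?X) + (?X + ?X))" by (rule add_mono[OF bc bc])
  also have "\<dots> = 8 * ?X" by (simp add: mult_2[symmetric] mult.assoc[symmetric])
  finally show ?thesis .
qed

section \<open>Equivalence of the norms\<close>

lemma bloom_weightsI:
  assumes "1 < p" "p < q" "\<mu> \<in> Apq p q" "lam \<in> Apq p q"
  shows "bloom_weights p q (enn2real (Apq_const p q \<mu>) + 1) (enn2real (Apq_const p q lam) + 1) \<mu> lam"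
proof -
  have "Apq_weight p q (enn2real (Apq_const p q w) + 1) w" if "w \<in> Apq p q" for w :: "'a \<Rightarrow> real"
  proof
    have fin: "Apq_const p q w < top" and "weight w" using that by (auto simp: Apq_def)
    show "weight w" by fact
    have "Apq_const p q w = ennreal (enn2real (Apq_const p q w))" using fin by simp
    also have "\<dots> \<le> ennreal (enn2real (Apq_const p q w) + 1)" by (intro ennreal_leI) simp
    finally show "Apq_const p q w \<le> ennreal (enn2real (Apq_const p q w) + 1)" .
  qed (use assms in auto)
  then show ?thesis using assms by (simp add: bloom_weights_def)
qed

theorem bmo_norm_le_commutator_norm:
  fixes \<mu> lam :: "'a::euclidean_space \<Rightarrow> real"
  assumes \<alpha>: "0 < \<alpha>" "\<alpha> < real DIM('a)" "\<alpha> / real DIM('a) + 1 / q = 1 / p"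
    and bw: "bloom_weights p q Km Kl \<mu> lam" and b: "loc_integrable b"
  shows "bmo_norm (\<lambda>x. \<mu> x * inverse (lam x)) b \<le> ennreal (8 * lower_const \<alpha> q DIM('a) Km Kl) *
    op_norm p (\<lambda>x. \<mu> x powr p) q (\<lambda>x. lam x powr q) (commutator b (riesz_potential \<alpha>))"
  unfolding bmo_norm_def
proof (rule SUP_least)
  interpret W: bloom_weights p q Km Kl \<mu> lam by (rule bw)
  fix Q :: "'a set" assume Q: "Q \<in> cubes"
  let ?n = "\<integral>\<^sup>+x\<in>Q. ennreal (\<mu> x * inverse (lam x)) \<partial>lebesgue"
  let ?o = "\<integral>\<^sup>+x\<in>Q. ennreal (cmod (b x - avg Q b)) \<partial>lebesgue"
  let ?N = "op_norm p (\<lambda>x. \<mu> x powr p) q (\<lambda>x. lam x powr q) (commutator b (riesz_potential \<alpha>))"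
  have n: "0 < ?n" "?n < top"
    using muckenhoupt_cube_finite[OF W.\<nu>_muckenhoupt _ Q] by (simp_all add: W.\<nu>_def)
  have c: "0 \<le> lower_const \<alpha> q DIM('a) Km Kl" by (simp add: lower_const_def)
  have "?n * (?o / ?n) = ?o" using ennreal_divide_mult_cancel[OF n] by (simp add: mult.commute)
  also have "\<dots> \<le> 8 * (ennreal (lower_const \<alpha> q DIM('a) Km Kl) * ?N * ?n)"
    by (rule oscillation_le_commutator_norm[OF \<alpha> bw b Q])
  also have "\<dots> = ?n * (ennreal (8 * lower_const \<alpha> q DIM('a) Km Kl) * ?N)"
    using c by (simp add: ennreal_mult mult_ac)
  finally show "?o / ?n \<le> ennreal (8 * lower_const \<alpha> q DIM('a) Km Kl) * ?N"
    using n by (subst (asm) ennreal_mult_le_mult_iff) (auto simp: less_top[symmetric])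
qed

theorem commutator_norm_le_bmo_norm:
  fixes \<mu> lam :: "'a::euclidean_space \<Rightarrow> real"
  assumes \<alpha>: "0 < \<alpha>" "\<alpha> < real DIM('a)" "\<alpha> / real DIM('a) + 1 / q = 1 / p"
    and bw: "bloom_weights p q Km Kl \<mu> lam" and b: "loc_integrable b"
    and C: "6 powr (real DIM('a) - \<alpha>) * 2 ^ DIM('a) * bloom_const p q DIM('a) Km Kl \<le> C" "0 < C"
  shows "op_norm p (\<lambda>x. \<mu> x powr p) q (\<lambda>x. lam x powr q) (commutator b (riesz_potential \<alpha>)) \<le>
    ennreal C * bmo_norm (\<lambda>x. \<mu> x * inverse (lam x)) b"
    (is "?N \<le> _ * ?B")
proof (cases ?B)
  case top
  then show ?thesis using C by (simp add: ennreal_mult_top)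
next
  case (real r)
  interpret W: bloom_weights p q Km Kl \<mu> lam by (rule bw)
  have le: "?N \<le> ennreal (C * s)" if s: "0 < s" "r \<le> s" for s
  proof -
    have "?N \<le> ennreal (6 powr (real DIM('a) - \<alpha>) * 2 ^ DIM('a) * bloom_const p q DIM('a) Km Kl * s)"
    proof (rule commutator_norm_upper_bound[OF \<alpha> bw b s(1)])
      fix Q :: "'a set" assume Q: "Q \<in> cubes"
      let ?n = "\<integral>\<^sup>+x\<in>Q. ennreal (\<mu> x * inverse (lam x)) \<partial>lebesgue"
      let ?o = "\<integral>\<^sup>+x\<in>Q. ennreal (cmod (b x - avg Q b)) \<partial>lebesgue"
      have n: "0 < ?n" "?n < top"
        using muckenhoupt_cube_finite[OF W.\<nu>_muckenhoupt _ Q] by (simp_all add: W.\<nu>_def)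
      have "?o / ?n \<le> ?B" unfolding bmo_norm_def using Q by (rule SUP_upper)
      also have "\<dots> \<le> ennreal s" using real s by (simp add: ennreal_leI)
      finally have "?o / ?n * ?n \<le> ennreal s * ?n" by (rule mult_right_mono) simp
      then show "?o \<le> ennreal s * ?n" using ennreal_divide_mult_cancel[OF n] by simp
    qed
    also have "\<dots> \<le> ennreal (C * s)" using C s by (intro ennreal_leI mult_right_mono) auto
    finally show ?thesis .
  qed
  have "?N \<le> ennreal (C * r)"
  proof (rule ennreal_le_epsilon)
    fix e :: real assume e: "0 < e"
    \<comment> \<open>\<open>commutator_norm_upper_bound\<close> wants a positive bound on the oscillation, and \<open>r\<close> may be 0.\<close>
    have "?N \<le> ennreal (C * (r + e / C))" using e C real by (intro le) (auto intro: add_nonneg_pos)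
    also have "C * (r + e / C) = C * r + e" using C by (simp add: distrib_left)
    also have "ennreal (C * r + e) = ennreal (C * r) + ennreal e" using e C real by (intro ennreal_plus) auto
    finally show "?N \<le> ennreal (C * r) + ennreal e" .
  qed
  then show ?thesis using real C by (simp add: ennreal_mult)
qed

theorem theorem1p1:
  fixes \<alpha> p q :: real and M L :: ennreal
  assumes "0 < \<alpha>" and "\<alpha> < real CARD('n::finite)"
    and "1 < p" and "p < q"
    and "\<alpha> / real CARD('n) + 1 / q = 1 / p"
  shows "\<exists>c C :: real. 0 < c \<and> c \<le> C \<and>
    (\<forall>(\<mu> :: real ^ 'n \<Rightarrow> real) (lam :: real ^ 'n \<Rightarrow> real).
       \<mu> \<in> Apq p q \<and> lam \<in> Apq p q \<and> Apq_const p q \<mu> = M \<and> Apq_const p q lam = L \<longrightarrow>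
       (\<forall>b :: real ^ 'n \<Rightarrow> complex. loc_integrable b \<longrightarrow>
          (let N = op_norm p (\<lambda>x. \<mu> x powr p) q (\<lambda>x. lam x powr q)
                     (commutator b (riesz_potential \<alpha>));
               B = bmo_norm (\<lambda>x. \<mu> x * inverse (lam x)) b
           in ennreal c * B \<le> N \<and> N \<le> ennreal C * B \<and> (N < top \<longleftrightarrow> B < top))))"
proof -
  define Km where "Km = enn2real M + 1"
  define Kl where "Kl = enn2real L + 1"
  define D where "D = 8 * lower_const \<alpha> q CARD('n) Km Kl"
  define U where "U = 6 powr (real CARD('n) - \<alpha>) * 2 ^ CARD('n) * bloom_const p q CARD('n) Km Kl"
  define c where "c = 1 / D"
  define C where "C = max c U"
  have "0 < Km" "0 < Kl" by (auto simp: Km_def Kl_def add_nonneg_pos)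
  then have D: "0 < D" by (simp add: D_def lower_const_def)
  then have c: "0 < c" by (simp add: c_def)
  have dim: "DIM(real ^ 'n) = CARD('n)" by simp
  note \<alpha> = assms(1,2,5)[folded dim]
  show ?thesis
  proof (rule exI[of _ c], rule exI[of _ C], intro conjI allI impI)
    show "0 < c" by fact
    show "c \<le> C" by (simp add: C_def)
    fix \<mu> lam :: "real ^ 'n \<Rightarrow> real" and b :: "real ^ 'n \<Rightarrow> complex"
    assume w: "\<mu> \<in> Apq p q \<and> lam \<in> Apq p q \<and> Apq_const p q \<mu> = M \<and> Apq_const p q lam = L" and b: "loc_integrable b"
    define N where "N = op_norm p (\<lambda>x. \<mu> x powr p) q (\<lambda>x. lam x powr q) (commutator b (riesz_potential \<alpha>))"
    define B where "B = bmo_norm (\<lambda>x. \<mu> x * inverse (lam x)) b"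
    have bw: "bloom_weights p q Km Kl \<mu> lam"
      using bloom_weightsI[OF assms(3,4), of \<mu> lam] w by (simp add: Km_def Kl_def)
    have "B \<le> ennreal D * N"
      using bmo_norm_le_commutator_norm[OF \<alpha> bw b] unfolding B_def N_def D_def dim .
    then have "ennreal c * B \<le> ennreal c * (ennreal D * N)" by (rule mult_left_mono) simp
    also have "\<dots> = N" using D by (simp add: c_def mult.assoc[symmetric] ennreal_mult'[symmetric])
    finally have lower: "ennreal c * B \<le> N" .
    have upper: "N \<le> ennreal C * B"
      unfolding N_def B_def
      by (rule commutator_norm_le_bmo_norm[OF \<alpha> bw b]) (use c in \<open>auto simp: C_def U_def\<close>)
    have "N < top \<longleftrightarrow> B < top"
    proof
      assume "N < top"
      then have "ennreal c * B < top" using lower by (rule le_less_trans[rotated])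
      then show "B < top" using c by (auto simp: ennreal_mult_less_top)
    next
      assume "B < top"
      then have "ennreal C * B < top" by (simp add: ennreal_mult_less_top)
      then show "N < top" using upper by (rule le_less_trans[rotated])
    qed
    then show "let N = op_norm p (\<lambda>x. \<mu> x powr p) q (\<lambda>x. lam x powr q) (commutator b (riesz_potential \<alpha>));
               B = bmo_norm (\<lambda>x. \<mu> x * inverse (lam x)) b
           in ennreal c * B \<le> N \<and> N \<le> ennreal C * B \<and> (N < top \<longleftrightarrow> B < top)"
      unfolding Let_def N_def[symmetric] B_def[symmetric] using lower upper by blast
  qed
qed

end
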